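(* Let $\alpha\in(0,1)$ and let $\mu$ be a probability measure with $\operatorname{supp}(\mu)\subset[\underline\theta,\bar\theta]$, $-\alpha<\underline\theta\le 0\le\bar\theta<+\infty$. Let $(\Pi_n)_{n\ge1}$ be the exchangeable Gibbs partition with parameter $\alpha$ and weights $v_{n,k}=\int v_{n,k}(\alpha,\theta)\,d\mu(\theta)$, with number of blocks $\mathsf k_n$, predictive simplex $\mathsf p_n$, its estimator $\hat{\mathsf p}_n$, and quasi-maximum likelihood estimator $\hat\alpha_n$. Then, as $n\to\infty$, $$n\sqrt{\frac{\mathfrak i(\alpha)}{\mathsf k_n}}\cdot\mathsf{TV}(\hat{\mathsf p}_n,\mathsf p_n)\to|N|\qquad\mathcal F_\infty\text{-stably},$$ where $N\sim\mathcal N(0,1)$ is independent of $\mathcal F_\infty$. Thus, for any $\epsilon\in(0,1)$, with $\tau_{1-\epsilon/2}$ the $(1-\epsilon/2)$-quantile of $\mathcal N(0,1)$, $$\lim_{n\to\infty}\mathbb P\left(\forall I\subset\{0,1,\dots,\mathsf k_n\}:\ \ |\mathsf p_n(I)-\hat{\mathsf p}_n(I)|\le\frac{\sqrt{\mathsf k_n}}{n}\,\frac{\tau_{1-\epsilon/2}}{\sqrt{\mathfrak i(\hat\alpha_n)}}\right)=1-\epsilon.$$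
   Context: Weights: for $1\le k\le n$, $v_{n,k}(\alpha,\theta)=\frac{\prod_{i=1}^{k-1}(\theta+i\alpha)}{\prod_{i=1}^{n-1}(\theta+i)}$ (empty products equal 1) and $v_{n,k}=\int v_{n,k}(\alpha,\theta)\,d\mu(\theta)$; $\mu$ does not depend on $\alpha$. Gibbs partition: $\Pi_n$ is a random partition of $\{1,\dots,n\}$ defined sequentially on a probability space $(\Omega,\mathcal F,P)$. $\Pi_1=\{\{1\}\}$. Given $\Pi_n=\{U_1,\dots,U_{\mathsf k_n}\}$ ($\mathsf k_n$ = number of blocks), $\Pi_{n+1}$ is obtained by putting $n+1$ into a new block with probability $\mathsf p_{n,0}=v_{n+1,\mathsf k_n+1}/v_{n,\mathsf k_n}$ and into $U_i$ with probability $\mathsf p_{n,i}=\frac{v_{n+1,\mathsf k_n}}{v_{n,\mathsf k_n}}(|U_i|-\alpha)$, $i=1,\dots,\mathsf k_n$. The predictive simplex is $\mathsf p_n=(\mathsf p_{n,0},\dots,\mathsf p_{n,\mathsf k_n})$. Let $\mathsf k_{n,j}$ be the number of blocks of $\Pi_n$ of size $j$, $\mathcal F_n=\sigma(\Pi_n)$ and $\mathcal F_\infty=\sigma(\cup_n\mathcal F_n)$. QMLE: for $n\ge2$, $\hat\alpha_n$ is the maximizer over $x\in(0,1)$ of $(\mathsf k_n-1)\log x+\sum_{j=2}^n\mathsf k_{n,j}\sum_{i=1}^{j-1}\log(i-x)$, understood as: $\hat\alpha_n=0$ if $\mathsf k_n=1$; $\hat\alpha_n=1$ if $\mathsf k_n=n$;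 and if $1<\mathsf k_n<n$, $\hat\alpha_n$ is the unique solution $x\in(0,1)$ of $\frac{\mathsf k_n-1}{x}-\sum_{j=2}^n\mathsf k_{n,j}\sum_{i=1}^{j-1}\frac1{i-x}=0$. Estimator: $\hat{\mathsf p}_n=(\hat{\mathsf p}_{n,0},\dots,\hat{\mathsf p}_{n,\mathsf k_n})$ with $\hat{\mathsf p}_{n,0}=\frac{\mathsf k_n}{n}\hat\alpha_n$ and $\hat{\mathsf p}_{n,i}=\frac{|U_i|-\hat\alpha_n}{n}$ for $i=1,\dots,\mathsf k_n$. For $I\subset\{0,\dots,\mathsf k_n\}$, $\mathsf p_n(I)=\sum_{i\in I}\mathsf p_{n,i}$ and $\hat{\mathsf p}_n(I)=\sum_{i\in I}\hat{\mathsf p}_{n,i}$. Total variation: $\mathsf{TV}(\hat{\mathsf p}_n,\mathsf p_n)=\frac12\sum_{i=0}^{\mathsf k_n}|\hat{\mathsf p}_{n,i}-\mathsf p_{n,i}|$. Fisher information: for $x\in(0,1)$, $\mathfrak i(x)=\sum_{j\ge1}\mathfrak p_x(j)\left(\frac{\partial}{\partial x}\log\mathfrak p_x(j)\right)^2$ with $\mathfrak p_x(j)=\frac{x\prod_{i=1}^{j-1}(i-x)}{j!}$. By convention $1/\sqrt{\mathfrak i(x)}=0$ for $x\in\{0,1\}$. Stable convergence: for a sub-$\sigma$-field $\mathcal G\subset\mathcal F$, real random variables $X_n\to X$ $\mathcal G$-stably if $\lim_n\mathbb E[f\,\mathbb E[h(X_n)\mid\mathcal G]]=\mathbb E[f\,\mathbb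 E[h(X)\mid\mathcal G]]$ for every $\mathcal F$-measurable integrable $f$ and every bounded continuous $h:\mathbb R\to\mathbb R$. The probability space is assumed rich enough (enlarged if necessary) to carry $N$ independent of $\mathcal F_\infty$. *)

theory Defs
  imports "HOL-Probability.Probability"
begin

section \<open>Gibbs partitions\<close>

definition measure_support :: "real measure \<Rightarrow> real set" where
  "measure_support \<mu> = {x. \<forall>U. open U \<longrightarrow> x \<in> U \<longrightarrow> emeasure \<mu> U > 0}"

definition gibbs_weight_at :: "real \<Rightarrow> real \<Rightarrow> nat \<Rightarrow> nat \<Rightarrow> real" where
  "gibbs_weight_at \<alpha> \<theta> n k = (\<Prod>i=1..<k. \<theta> + real i * \<alpha>) / (\<Prod>i=1..<n. \<theta> + real i)"

definition gibbs_weight :: "real \<Rightarrow> real measure \<Rightarrow> nat \<Rightarrow> nat \<Rightarrow> real" where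
  "gibbs_weight \<alpha> \<mu> n k = (LINT \<theta>|\<mu>. gibbs_weight_at \<alpha> \<theta> n k)"

text \<open>A partition is a set of blocks. To index its blocks by \<open>1, \<dots>, card \<pi>\<close> they are listed in
  order of appearance, i.e. by increasing least element.\<close>

definition block :: "nat set set \<Rightarrow> nat \<Rightarrow> nat set" where
  "block \<pi> i = (THE U. U \<in> \<pi> \<and> card {V \<in> \<pi>. Min V \<le> Min U} = i)"

text \<open>The partition obtained from a partition \<open>\<pi>\<close> of \<open>{1..n}\<close> by putting \<open>n + 1\<close> into a new
  block (\<open>i = 0\<close>) or into the \<open>i\<close>-th block (\<open>1 \<le> i \<le> card \<pi>\<close>).\<close>

definition add_element :: "nat \<Rightarrow> nat set set \<Rightarrow> nat \<Rightarrow> nat set set" where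
  "add_element n \<pi> i =
     (if i = 0 then insert {n + 1} \<pi>
      else insert (insert (n + 1) (block \<pi> i)) (\<pi> - {block \<pi> i}))"

definition predictive :: "real \<Rightarrow> real measure \<Rightarrow> nat \<Rightarrow> nat set set \<Rightarrow> nat \<Rightarrow> real" where
  "predictive \<alpha> \<mu> n \<pi> i =
     (if i = 0 then gibbs_weight \<alpha> \<mu> (n + 1) (card \<pi> + 1) / gibbs_weight \<alpha> \<mu> n (card \<pi>)
      else gibbs_weight \<alpha> \<mu> (n + 1) (card \<pi>) / gibbs_weight \<alpha> \<mu> n (card \<pi>)
             * (real (card (block \<pi> i)) - \<alpha>))"

text \<open>Since \<open>\<Pi>\<^sub>n\<^sub>+\<^sub>1\<close> always extends \<open>\<Pi>\<^sub>n\<close>, the event \<open>\<Pi>\<^sub>n = \<pi>\<close> fixes the whole history up to time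
  \<open>n\<close>, so conditioning on it is conditioning on the past. The value of the sequence at
  index 0 is irrelevant.\<close>

definition gibbs_partition ::
    "'w measure \<Rightarrow> real \<Rightarrow> real measure \<Rightarrow> (nat \<Rightarrow> 'w \<Rightarrow> nat set set) \<Rightarrow> bool" where
  "gibbs_partition M \<alpha> \<mu> X \<longleftrightarrow>
     (\<forall>n\<ge>1. X n \<in> M \<rightarrow>\<^sub>M count_space {\<pi>. partition_on {1..n} \<pi>}) \<and>
     (\<forall>\<omega>\<in>space M. X 1 \<omega> = {{1}}) \<and>
     (\<forall>n\<ge>1. \<forall>\<omega>\<in>space M. \<exists>i\<le>card (X n \<omega>). X (n + 1) \<omega> = add_element n (X n \<omega>) i) \<and>
     (\<forall>n\<ge>1. \<forall>\<pi>. \<P>(\<omega> in M. X n \<omega> = \<pi>) > 0 \<longrightarrow>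
        (\<forall>i\<le>card \<pi>. \<P>(\<omega> in M. X (n + 1) \<omega> = add_element n \<pi> i \<bar> X n \<omega> = \<pi>)
                      = predictive \<alpha> \<mu> n \<pi> i))"

definition partition_sigma :: "'w measure \<Rightarrow> (nat \<Rightarrow> 'w \<Rightarrow> nat set set) \<Rightarrow> nat \<Rightarrow> 'w measure" where
  "partition_sigma M X n =
     vimage_algebra (space M) (X n) (count_space {\<pi>. partition_on {1..n} \<pi>})"

definition limit_sigma :: "'w measure \<Rightarrow> (nat \<Rightarrow> 'w \<Rightarrow> nat set set) \<Rightarrow> 'w measure" where
  "limit_sigma M X = sigma (space M) (\<Union>n\<in>{1..}. sets (partition_sigma M X n))"

section \<open>Estimators\<close>

definition num_blocks_of_size :: "nat set set \<Rightarrow> nat \<Rightarrow> nat" where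
  "num_blocks_of_size \<pi> j = card {U \<in> \<pi>. card U = j}"

definition qmle :: "nat \<Rightarrow> nat set set \<Rightarrow> real" where
  "qmle n \<pi> =
     (if card \<pi> = 1 then 0
      else if card \<pi> = n then 1
      else (THE x. 0 < x \<and> x < 1 \<and>
              (real (card \<pi>) - 1) / x
                - (\<Sum>j=2..n. real (num_blocks_of_size \<pi> j) * (\<Sum>i=1..<j. 1 / (real i - x))) = 0))"

definition predictive_est :: "nat \<Rightarrow> nat set set \<Rightarrow> nat \<Rightarrow> real" where
  "predictive_est n \<pi> i =
     (if i = 0 then real (card \<pi>) / real n * qmle n \<pi>
      else (real (card (block \<pi> i)) - qmle n \<pi>) / real n)"

definition tv_dist :: "nat \<Rightarrow> (nat \<Rightarrow> real) \<Rightarrow> (nat \<Rightarrow> real) \<Rightarrow> real" where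
  "tv_dist k p q = (\<Sum>i=0..k. \<bar>p i - q i\<bar>) / 2"

section \<open>Fisher information\<close>

definition sibuya_prob :: "real \<Rightarrow> nat \<Rightarrow> real" where
  "sibuya_prob x j = x * (\<Prod>i=1..<j. real i - x) / fact j"

definition fisher_info :: "real \<Rightarrow> real" where
  "fisher_info x =
     (\<Sum>j. sibuya_prob x (Suc j) * (deriv (\<lambda>y. ln (sibuya_prob y (Suc j))) x)\<^sup>2)"

text \<open>\<open>1 / sqrt (fisher_info x)\<close>, with the convention that it vanishes at 0 and 1.\<close>

definition inv_sqrt_fisher :: "real \<Rightarrow> real" where
  "inv_sqrt_fisher x = (if x = 0 \<or> x = 1 then 0 else 1 / sqrt (fisher_info x))"

section \<open>Stable convergence and quantiles\<close>

definition stable_convergence ::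
    "'w measure \<Rightarrow> 'w measure \<Rightarrow> (nat \<Rightarrow> 'w \<Rightarrow> real) \<Rightarrow> ('w \<Rightarrow> real) \<Rightarrow> bool" where
  "stable_convergence M G X Y \<longleftrightarrow>
     subalgebra M G \<and> (\<forall>n. X n \<in> borel_measurable M) \<and> Y \<in> borel_measurable M \<and>
     (\<forall>f h. integrable M f \<longrightarrow> continuous_on UNIV h \<longrightarrow> bounded (range h) \<longrightarrow>
        (\<lambda>n. LINT \<omega>|M. f \<omega> * real_cond_exp M G (\<lambda>\<omega>. h (X n \<omega>)) \<omega>)
          \<longlonglongrightarrow> (LINT \<omega>|M. f \<omega> * real_cond_exp M G (\<lambda>\<omega>. h (Y \<omega>)) \<omega>))"

definition quantile :: "real measure \<Rightarrow> real \<Rightarrow> real" where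
  "quantile \<nu> p = Inf {x. p \<le> cdf \<nu> x}"

end

theory Submission
  imports Defs "HOL-Real_Asymp.Real_Asymp"
begin

text \<open>The argument compares everything with the first derivative \<open>S\<close> of the log likelihood of the
partition at \<open>\<theta> = 0\<close>, as a function of \<open>\<alpha>\<close>: with \<open>k\<close> blocks, \<open>S\<close> (\<open>score\<close>) is
\<open>(k - 1) / \<alpha>\<close> minus the sum of \<open>1 / (i - \<alpha>)\<close> over all blocks \<open>U\<close> and \<open>1 \<le> i < card U\<close>. Mixing over the
bounded parameter \<open>\<theta>\<close> changes one step of the chain only slightly: a new block is opened with
probability \<open>\<alpha> k / n + O(1/n)\<close> and a block \<open>U\<close> is enlarged with probability
\<open>(1/n + O(1/n\<^sup>2)) (card U - \<alpha>)\<close> (\<open>new_prob_approx\<close>, \<open>join_rate_approx\<close>). With the main terms alone \<open>S\<close>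
would be a martingale.

For the total variation distance, the same approximations show that the estimated and the true
predictive probabilities differ by \<open>k (qmle - \<alpha>) / n\<close> for a new block and by \<open>- (qmle - \<alpha>) / n\<close> for each
of the \<open>k\<close> old blocks, with errors that sum to \<open>O(1/n)\<close>. Hence the distance is
\<open>k \<bar>qmle - \<alpha>\<bar> / n + O(1/n)\<close> (\<open>tv_dist_approx\<close>), and after multiplication with \<open>n / sqrt k\<close> only
\<open>sqrt k (qmle - \<alpha>)\<close> matters. The likelihood score is decreasing with an explicit second order
expansion at \<open>\<alpha>\<close>, so evaluating its sign at two nearby points locates the estimator (\<open>qmle_close\<close>):
\<open>sqrt k (qmle - \<alpha>)\<close> is close to \<open>S / (sqrt k fisher_info \<alpha>)\<close>, because the observed information divided
by \<open>k\<close> converges to \<open>fisher_info \<alpha>\<close>.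

It remains to show that \<open>S / sqrt k\<close> is asymptotically normal with variance \<open>fisher_info \<alpha>\<close>,
conditionally on any event of the past. Normalising by the current number \<open>k\<close> of blocks, whose own
growth of order \<open>n\<^sup>\<alpha>\<close> has a random factor, makes the limits deterministic. Every limit along
the chain is obtained from one fact about numerical sequences (\<open>drift_tendsto_0\<close>): if
\<open>x (n + 1) \<le> (1 - a / n) x n + e n / n\<close> with \<open>a > 0\<close>, \<open>x \<ge> 0\<close> and \<open>e \<longlonglongrightarrow> 0\<close>, then \<open>x \<longlonglongrightarrow> 0\<close>. It is
applied to the expectation of \<open>1 / k\<close>, to the mean square distance between the proportion of blocks of
size \<open>j\<close> and the Sibuya probability of \<open>j\<close> (by induction on \<open>j\<close>), to the expectation of \<open>(S / k)\<^sup>2\<close>, and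
finally to characteristic functions. On the logarithmic time scale \<open>S / sqrt k\<close> behaves like an
Ornstein--Uhlenbeck process: a step at time \<open>n\<close> contracts it by \<open>1 - \<alpha> / (2 n)\<close>, since \<open>k\<close> grows, and
adds variance \<open>\<alpha> fisher_info \<alpha> / n\<close> (\<open>partition_step_iexp\<close>). Therefore the distance between the
characteristic function at \<open>t\<close> and the Gaussian one is at most \<open>C n \<bar>t\<bar>\<close>, where \<open>C\<close> obeys the same
kind of recursion (\<open>z_score_char_tendsto\<close>). An indicator of a past event is carried through this
recursion unchanged; this gives convergence conditionally on events of the history, and a Dynkin
argument followed by approximation in mean extends it to all integrable functions measurable for
the limit \<open>\<sigma>\<close>-algebra (\<open>mixes_generated\<close>), which is stable convergence.

For the confidence statement, the largest deviation over sets of indices is the total variation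
distance, since both vectors have total mass 1 (\<open>forall_subset_le_iff_tv_dist_le\<close>), and replacing
\<open>fisher_info \<alpha>\<close> by its value at the estimator costs a term that vanishes in probability.\<close>

section \<open>Recursions with a harmonic drift\<close>

text \<open>The product of the factors \<open>1 - a / m\<close> is at most the exponential of \<open>- a\<close> times a piece of the
divergent harmonic series.\<close>

lemma contracting_recursion_tendsto_0:
  fixes y :: "nat \<Rightarrow> real"
  assumes a: "0 < a" and M: "a \<le> real M" "1 \<le> M"
    and nonneg: "\<And>m. M \<le> m \<Longrightarrow> 0 \<le> y m"
    and step: "\<And>m. M \<le> m \<Longrightarrow> y (Suc m) \<le> (1 - a / real m) * y m"
  shows "y \<longlonglongrightarrow> 0"
proof -
  have bound: "y m \<le> y M * exp (- a * (harm (m - 1) - harm (M - 1)))" if "M \<le> m" for m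
    using that
  proof (induction m rule: dec_induct)
    case base
    show ?case by simp
  next
    case (step m)
    then have m: "1 \<le> m" "a \<le> real m" using M by auto
    have "harm m = harm (m - 1) + (1::real) / real m"
      using m by (cases m) (auto simp: harm_Suc inverse_eq_divide)
    then have e: "exp (- a * (harm m - harm (M - 1)))
        = exp (- (a / real m)) * exp (- a * (harm (m - 1) - harm (M - 1)))"
      by (simp add: exp_add[symmetric] algebra_simps)
    have "y (Suc m) \<le> (1 - a / real m) * y m" using assms(5) step by simp
    also have "\<dots> \<le> exp (- (a / real m)) * y m"
      using exp_ge_add_one_self[of "- (a / real m)"] nonneg[of m] step
      by (intro mult_right_mono) auto
    also have "\<dots> \<le> exp (- (a / real m)) * (y M * exp (- a * (harm (m - 1) - harm (M - 1))))"
      using step by (intro mult_left_mono) auto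
    finally show ?case using e by (simp add: mult_ac)
  qed
  have h: "filterlim (\<lambda>m. harm (m - 1) - harm (M - 1) :: real) at_top sequentially"
  proof -
    have "filterlim (\<lambda>m. harm m - harm (M - 1) :: real) at_top sequentially"
      using filterlim_tendsto_add_at_top[OF tendsto_const[of "- harm (M - 1)"] harm_at_top]
      by (simp add: algebra_simps)
    then have "filterlim (\<lambda>m. harm (Suc m - 1) - harm (M - 1) :: real) at_top sequentially"
      by simp
    then show ?thesis
      by (subst (asm) filterlim_sequentially_Suc[of "\<lambda>m. harm (m - 1) - harm (M - 1) :: real"])
  qed
  have "((\<lambda>m. y M * exp (- a * (harm (m - 1) - harm (M - 1)))) \<longlongrightarrow> y M * 0) sequentially"
  proof (intro tendsto_mult tendsto_const)
    have "filterlim (\<lambda>m. - a * (harm (m - 1) - harm (M - 1) :: real)) at_bot sequentially"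
      using filterlim_tendsto_neg_mult_at_bot[OF tendsto_const _ h, of "- a"] a by simp
    then show "(\<lambda>m. exp (- a * (harm (m - 1) - harm (M - 1)))) \<longlonglongrightarrow> 0"
      by (rule filterlim_compose[OF exp_at_bot])
  qed
  then show ?thesis
    using nonneg bound
    by (intro tendsto_sandwich[of "\<lambda>_. 0" y _ "\<lambda>m. y M * exp (- a * (harm (m - 1) - harm (M - 1)))"])
       (auto simp: eventually_sequentially)
qed

text \<open>Above any level \<open>d > 0\<close> the error is eventually absorbed by the drift, so the excess of \<open>x\<close> over \<open>d\<close>
obeys a contracting recursion.\<close>

lemma drift_tendsto_0:
  fixes x e :: "nat \<Rightarrow> real"
  assumes a: "0 < a" and nonneg: "\<And>m. 1 \<le> m \<Longrightarrow> 0 \<le> x m"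
    and step: "\<forall>\<^sub>F m in sequentially. x (Suc m) \<le> (1 - a / real m) * x m + e m / real m"
    and e: "e \<longlonglongrightarrow> 0"
  shows "x \<longlonglongrightarrow> 0"
proof (rule tendstoI)
  fix \<epsilon> :: real assume \<epsilon>: "0 < \<epsilon>"
  define d where "d = \<epsilon> / 2"
  have d: "0 < d" using \<epsilon> by (simp add: d_def)
  have "\<forall>\<^sub>F m in sequentially. e m < a * d"
    using order_tendstoD(2)[OF e, of "a * d"] a d by simp
  with step have "\<forall>\<^sub>F m in sequentially. e m < a * d \<and>
      x (Suc m) \<le> (1 - a / real m) * x m + e m / real m"
    by eventually_elim auto
  then obtain M0 where M0: "\<And>m. M0 \<le> m \<Longrightarrow> e m < a * d"
      "\<And>m. M0 \<le> m \<Longrightarrow> x (Suc m) \<le> (1 - a / real m) * x m + e m / real m"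
    unfolding eventually_sequentially by blast
  define M where "M = Max {M0, 1, nat \<lceil>a\<rceil>}"
  have M: "M0 \<le> M" "1 \<le> M" "a \<le> real M"
    unfolding M_def by (auto simp: le_max_iff_disj) linarith
  define y where "y m = max 0 (x m - d)" for m
  have "y \<longlonglongrightarrow> 0"
  proof (rule contracting_recursion_tendsto_0[OF a M(3) M(2)])
    fix m assume m: "M \<le> m"
    then have m': "1 \<le> m" "a \<le> real m" "0 < real m" using M by auto
    show "0 \<le> y m" by (simp add: y_def)
    have c: "0 \<le> 1 - a / real m" using m' by (simp add: divide_simps)
    have "x (Suc m) - d \<le> (1 - a / real m) * x m + (a * d) / real m - d"
      using M0[of m] m M m' by (smt (verit) divide_right_mono of_nat_0_le_iff order_trans)
    also have "\<dots> = (1 - a / real m) * (x m - d)" using m' by (simp add: field_simps)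
    also have "\<dots> \<le> (1 - a / real m) * y m" using c by (intro mult_left_mono) (auto simp: y_def)
    finally show "y (Suc m) \<le> (1 - a / real m) * y m"
      using c by (simp add: y_def)
  qed
  then have "\<forall>\<^sub>F m in sequentially. y m < d" using d order_tendstoD(2) by blast
  then show "\<forall>\<^sub>F m in sequentially. dist (x m) 0 < \<epsilon>"
    using eventually_ge_at_top[of 1]
  proof eventually_elim
    case (elim m)
    then have "x m - d < d" by (simp add: y_def)
    then show ?case using nonneg[of m] elim by (simp add: d_def)
  qed
qed

text \<open>Once \<open>m \<ge> a\<close>, the new value lies below a convex combination of the old one and \<open>C / a\<close>.\<close>

lemma drift_bounded:
  fixes x :: "nat \<Rightarrow> real"
  assumes a: "0 < a"
    and step: "\<And>m. 1 \<le> m \<Longrightarrow> x (Suc m) \<le> (1 - a / real m) * x m + C / real m"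
  obtains B where "\<And>m. 1 \<le> m \<Longrightarrow> x m \<le> B"
proof -
  define M where "M = max 1 (nat \<lceil>a\<rceil>)"
  have M: "1 \<le> M" "a \<le> real M" unfolding M_def by auto linarith
  define B where "B = Max (insert (C / a) (x ` {..M}))"
  have B: "C / a \<le> B" "\<And>m. m \<le> M \<Longrightarrow> x m \<le> B" unfolding B_def by (intro Max_ge; auto)+
  have "x m \<le> B" if "M \<le> m" for m
    using that
  proof (induction m rule: dec_induct)
    case base
    show ?case using B by simp
  next
    case (step m)
    then have m: "1 \<le> m" "a \<le> real m" using M by auto
    have "x (Suc m) \<le> (1 - a / real m) * x m + C / real m" using assms(2) m by simp
    also have "\<dots> \<le> (1 - a / real m) * B + (a * B) / real m"
      using m a B(1) step
      by (intro add_mono mult_left_mono divide_right_mono) (auto simp: field_simps)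
    also have "\<dots> = B" by (simp add: algebra_simps)
    finally show ?case .
  qed
  then show ?thesis using B that by (meson linear)
qed

section \<open>The Sibuya distribution and its Fisher information\<close>

text \<open>The mass of \<open>{J + 1, J + 2, \<dots>}\<close> under \<open>sibuya_prob x\<close>, in closed form.\<close>

definition sibuya_tail :: "real \<Rightarrow> nat \<Rightarrow> real" where
  "sibuya_tail x J = (\<Prod>i=1..J. real i - x) / fact J"

text \<open>Minus the derivative in \<open>x\<close> of the logarithm of \<open>\<Prod>i=1..<j. real i - x\<close>: what a block of size \<open>j\<close>
contributes to the score.\<close>

definition sibuya_harm :: "real \<Rightarrow> nat \<Rightarrow> real" where
  "sibuya_harm x j = (\<Sum>i=1..<j. 1 / (real i - x))"

text \<open>The expectation of \<open>1 / (j - x)\<close> for a Sibuya variable \<open>j\<close>; the only non-elementary part of the Fisher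
information.\<close>

definition sibuya_q :: "real \<Rightarrow> real" where
  "sibuya_q x = (\<Sum>j. sibuya_prob x (Suc j) / (real (Suc j) - x))"

lemma sibuya_harm_Suc: "1 \<le> j \<Longrightarrow> sibuya_harm x (Suc j) = sibuya_harm x j + 1 / (real j - x)"
  by (simp add: sibuya_harm_def)

lemma sibuya_harm_1 [simp]: "sibuya_harm x (Suc 0) = 0"
  by (simp add: sibuya_harm_def)

lemma sibuya_tail_0 [simp]: "sibuya_tail x 0 = 1"
  by (simp add: sibuya_tail_def)

lemma sibuya_tail_Suc:
  "sibuya_tail x (Suc j) = (1 - x / real (Suc j)) * sibuya_tail x j"
  by (simp add: sibuya_tail_def field_simps del: of_nat_Suc)

lemma sibuya_prob_Suc: "sibuya_prob x (Suc j) = x / real (Suc j) * sibuya_tail x j"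
proof -
  have "{1..<Suc j} = {1..j}" by auto
  then show ?thesis by (simp add: sibuya_prob_def sibuya_tail_def del: of_nat_Suc)
qed

lemma sibuya_prob_eq_tail_diff:
  "sibuya_prob x (Suc j) = sibuya_tail x j - sibuya_tail x (Suc j)"
  by (simp add: sibuya_prob_Suc sibuya_tail_Suc algebra_simps)

lemma sibuya_tail_eq_prob:
  assumes "x \<noteq> 0"
  shows "sibuya_tail x (Suc j) = sibuya_prob x (Suc j) * (real (Suc j) - x) / x"
  using assms by (simp add: sibuya_prob_Suc sibuya_tail_Suc field_simps del: of_nat_Suc)

text \<open>A balance equation: in a partition of \<open>n\<close> points, blocks of size \<open>j + 2\<close> arise from blocks of size
\<open>j + 1\<close>, each growing at rate \<open>(j + 1 - x) / n\<close>. It is what makes these probabilities the limiting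
proportions of block sizes.\<close>

lemma sibuya_prob_recursion:
  "real (Suc (Suc j)) * sibuya_prob x (Suc (Suc j)) = (real (Suc j) - x) * sibuya_prob x (Suc j)"
  by (simp add: sibuya_prob_Suc sibuya_tail_Suc field_simps del: of_nat_Suc)

context
  fixes x :: real
  assumes x: "0 < x" "x < 1"
begin

lemma sibuya_tail_pos: "0 < sibuya_tail x j"
proof (induction j)
  case (Suc j)
  have "0 < 1 - x / real (Suc j)" using x by (simp add: field_simps)
  with Suc show ?case unfolding sibuya_tail_Suc by simp
qed simp

lemma sibuya_tail_le_1: "sibuya_tail x j \<le> 1"
proof (induction j)
  case (Suc j)
  have "(1 - x / real (Suc j)) * sibuya_tail x j \<le> 1 * sibuya_tail x j"
    using x sibuya_tail_pos[of j] by (intro mult_right_mono) auto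
  with Suc show ?case by (simp add: sibuya_tail_Suc del: of_nat_Suc)
qed simp

lemma sibuya_prob_pos: "0 < sibuya_prob x (Suc j)"
  using x sibuya_tail_pos by (simp add: sibuya_prob_Suc del: of_nat_Suc)

lemma sibuya_tail_tendsto_0: "sibuya_tail x \<longlonglongrightarrow> 0"
proof -
  have "(\<lambda>m. sibuya_tail x (m - 1)) \<longlonglongrightarrow> 0"
  proof (rule contracting_recursion_tendsto_0[where M = 1 and a = x])
    fix m :: nat assume "1 \<le> m"
    then show "sibuya_tail x (Suc m - 1) \<le> (1 - x / real m) * sibuya_tail x (m - 1)"
      by (cases m) (auto simp: sibuya_tail_Suc)
  qed (use x sibuya_tail_pos in \<open>auto intro: less_imp_le\<close>)
  then have "(\<lambda>m. sibuya_tail x (Suc m - 1)) \<longlonglongrightarrow> 0"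
    by (rule LIMSEQ_Suc)
  then show ?thesis by simp
qed

lemma sibuya_prob_sums_tail: "(\<lambda>j. sibuya_prob x (Suc (j + J))) sums sibuya_tail x J"
proof -
  have "(\<lambda>j. sibuya_tail x (j + J) - sibuya_tail x (Suc j + J)) sums (sibuya_tail x (0 + J) - 0)"
    by (rule telescope_sums') (use sibuya_tail_tendsto_0 in \<open>simp add: LIMSEQ_ignore_initial_segment\<close>)
  then show ?thesis by (simp add: sibuya_prob_eq_tail_diff)
qed

lemma sibuya_prob_sums_1: "(\<lambda>j. sibuya_prob x (Suc j)) sums 1"
  using sibuya_prob_sums_tail[of 0] by simp

text \<open>Summation by parts. The boundary term vanishes because \<open>a\<close> is increasing: the tail mass beyond \<open>J\<close>
times \<open>a J\<close> is at most the remainder of the convergent series.\<close>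

lemma sibuya_abel_sums:
  fixes a :: "nat \<Rightarrow> real"
  assumes nonneg: "\<And>j. 0 \<le> a j" and mono: "\<And>j. a j \<le> a (Suc j)"
    and d: "(\<lambda>i. sibuya_tail x (Suc i) * (a (Suc i) - a i)) sums s"
  shows "(\<lambda>j. sibuya_prob x (Suc j) * a j) sums (a 0 + s)"
proof -
  let ?p = "\<lambda>j. sibuya_prob x (Suc j)" and ?T = "sibuya_tail x"
  have fin: "(\<Sum>j<J. ?p j * a j) = a 0 + (\<Sum>i<J. ?T (Suc i) * (a (Suc i) - a i)) - ?T J * a J" for J
    by (induction J) (simp_all add: sibuya_prob_eq_tail_diff algebra_simps)
  have sm: "summable (\<lambda>j. ?p j * a j)"
  proof (rule summableI_nonneg_bounded)
    fix J
    have "(\<Sum>i<J. ?T (Suc i) * (a (Suc i) - a i)) \<le> s"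
    proof -
      have "0 \<le> ?T (Suc i) * (a (Suc i) - a i)" for i
        using mono[of i] sibuya_tail_pos[of "Suc i"] by simp
      then have "(\<Sum>i<J. ?T (Suc i) * (a (Suc i) - a i)) \<le> (\<Sum>i. ?T (Suc i) * (a (Suc i) - a i))"
        by (intro sum_le_suminf sums_summable[OF d]) auto
      then show ?thesis using sums_unique[OF d] by simp
    qed
    moreover have "0 \<le> ?T J * a J" using nonneg sibuya_tail_pos[of J] by simp
    ultimately show "(\<Sum>j<J. ?p j * a j) \<le> a 0 + s" using fin[of J] by simp
    show "0 \<le> ?p J * a J" using nonneg sibuya_prob_pos[of J] by simp
  qed
  have rest: "?T J * a J \<le> (\<Sum>j. ?p (j + J) * a (j + J))" for J
  proof -
    have "a J \<le> a (j + J)" for j by (rule lift_Suc_mono_le[of a]) (auto intro: mono)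
    then have "?p (j + J) * a J \<le> ?p (j + J) * a (j + J)" for j
      using less_imp_le[OF sibuya_prob_pos[of "j + J"]] by (rule mult_left_mono)
    then show ?thesis
      by (rule sums_le[OF _ sums_mult2[OF sibuya_prob_sums_tail] summable_sums])
         (rule summable_ignore_initial_segment[OF sm])
  qed
  have Ta: "0 \<le> ?T J * a J" for J using nonneg[of J] sibuya_tail_pos[of J] by simp
  have "(\<lambda>J. ?T J * a J) \<longlonglongrightarrow> 0"
  proof (rule tendsto_sandwich[OF _ _ tendsto_const])
    show "(\<lambda>J. \<Sum>j. ?p (j + J) * a (j + J)) \<longlonglongrightarrow> 0"
    proof (rule tendstoI)
      fix e :: real assume "0 < e"
      then obtain N where "\<And>n. N \<le> n \<Longrightarrow> norm (\<Sum>j. ?p (j + n) * a (j + n)) < e"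
        using suminf_exist_split[OF _ sm] by blast
      then show "\<forall>\<^sub>F J in sequentially. dist (\<Sum>j. ?p (j + J) * a (j + J)) 0 < e"
        unfolding eventually_sequentially by auto
    qed
  qed (use rest Ta in \<open>simp_all\<close>)
  moreover have "(\<lambda>J. \<Sum>i<J. ?T (Suc i) * (a (Suc i) - a i)) \<longlonglongrightarrow> s"
    using d by (simp add: sums_def)
  ultimately have "(\<lambda>J. a 0 + (\<Sum>i<J. ?T (Suc i) * (a (Suc i) - a i)) - ?T J * a J) \<longlonglongrightarrow> a 0 + s - 0"
    by (intro tendsto_intros)
  then show ?thesis by (simp add: sums_def fin)
qed

end

text \<open>A summable majorant that is uniform on compact intervals, for continuity of \<open>sibuya_q\<close>.\<close>

lemma sibuya_prob_div_bound:
  assumes "0 < x" "x \<le> h" "h < 1"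
  shows "norm (sibuya_prob x (Suc j) / (real (Suc j) - x)) \<le> (1 / (1 - h)) * (1 / real (Suc j) ^ 2)"
proof -
  have x: "0 < x" "x < 1" using assms by auto
  have "sibuya_prob x (Suc j) \<le> 1 / real (Suc j)"
    using x sibuya_tail_le_1[OF x, of j] sibuya_tail_pos[OF x, of j]
    by (simp add: sibuya_prob_Suc divide_right_mono mult_le_one less_imp_le del: of_nat_Suc)
  moreover have "(1 - h) * real (Suc j) \<le> real (Suc j) - x"
    using assms by (simp add: algebra_simps) (smt (verit) mult_nonneg_nonneg of_nat_0_le_iff)
  moreover have "0 < (1 - h) * real (Suc j)" using assms by simp
  ultimately have "sibuya_prob x (Suc j) / (real (Suc j) - x) \<le> (1 / real (Suc j)) / ((1 - h) * real (Suc j))"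
    using sibuya_prob_pos[OF x, of j] by (intro frac_le) auto
  moreover have "0 \<le> sibuya_prob x (Suc j) / (real (Suc j) - x)"
    using sibuya_prob_pos[OF x, of j] x by simp
  ultimately show ?thesis
    by (simp only: real_norm_def abs_of_nonneg) (simp add: power2_eq_square mult_ac)
qed

lemma summable_inverse_Suc_squares: "summable (\<lambda>j. C * (1 / real (Suc j) ^ 2))"
  using inverse_power_summable[of 2, where ?'a = real]
  by (intro summable_mult) (simp add: summable_Suc_iff[of "\<lambda>n. 1 / real n ^ 2"] inverse_eq_divide del: of_nat_Suc)

lemma sibuya_q_sums:
  assumes "0 < x" "x < 1"
  shows "(\<lambda>j. sibuya_prob x (Suc j) / (real (Suc j) - x)) sums sibuya_q x"
  unfolding sibuya_q_def
  by (rule summable_sums, rule summable_comparison_test[OF _ summable_inverse_Suc_squares[of "1 / (1 - x)"]])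
     (use sibuya_prob_div_bound[of x x] assms in auto)

lemma sibuya_q_nonneg:
  assumes "0 < x" "x < 1"
  shows "0 \<le> sibuya_q x"
  using sums_le[OF _ sums_zero sibuya_q_sums[OF assms]] sibuya_prob_pos[OF assms] assms
  by (simp add: less_imp_le)

lemma isCont_sibuya_q:
  assumes "0 < x" "x < 1"
  shows "isCont sibuya_q x"
proof -
  obtain l h where lh: "0 < l" "l < x" "x < h" "h < 1"
    using assms by (meson dense)
  let ?f = "\<lambda>j y. sibuya_prob y (Suc j) / (real (Suc j) - y)"
  have "uniform_limit {l..h} (\<lambda>n y. \<Sum>j<n. ?f j y) (\<lambda>y. \<Sum>j. ?f j y) sequentially"
    by (rule Weierstrass_m_test[OF _ summable_inverse_Suc_squares[of "1 / (1 - h)"]])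
       (use sibuya_prob_div_bound lh in auto)
  moreover have "continuous_on {l..h} (\<lambda>y. \<Sum>j<n. ?f j y)" for n
    unfolding sibuya_prob_def using lh by (intro continuous_intros) auto
  ultimately have "continuous_on {l..h} (\<lambda>y. \<Sum>j. ?f j y)"
    by (intro uniform_limit_theorem[where F = sequentially]) auto
  then have "continuous_on {l..h} sibuya_q"
    by (rule continuous_on_eq) (use lh in \<open>auto simp: sibuya_q_def\<close>)
  then show ?thesis
    using lh by (intro continuous_on_interior[of "{l..h}"]) auto
qed

context
  fixes x :: real
  assumes x: "0 < x" "x < 1"
begin

lemma sibuya_harm_nonneg: "0 \<le> sibuya_harm x j"
  unfolding sibuya_harm_def using x by (intro sum_nonneg) auto

text \<open>In the Abel sum, the increment \<open>1 / (i + 1 - x)\<close> of \<open>sibuya_harm\<close> cancels against the tail, leaving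
\<open>sibuya_prob x (i + 1) / x\<close>. The same cancellation drives the next two means.\<close>

lemma sibuya_mean_harm: "(\<lambda>j. sibuya_prob x (Suc j) * sibuya_harm x (Suc j)) sums (1 / x)"
proof -
  have eq: "sibuya_tail x (Suc i) * (sibuya_harm x (Suc (Suc i)) - sibuya_harm x (Suc i))
      = sibuya_prob x (Suc i) * (1 / x)" for i
    using x by (simp add: sibuya_harm_Suc sibuya_tail_eq_prob field_simps del: of_nat_Suc)
  have "(\<lambda>j. sibuya_prob x (Suc j) * sibuya_harm x (Suc j)) sums (sibuya_harm x (Suc 0) + 1 / x)"
  proof (rule sibuya_abel_sums[OF x])
    show "(\<lambda>i. sibuya_tail x (Suc i) * (sibuya_harm x (Suc (Suc i)) - sibuya_harm x (Suc i))) sums (1 / x)"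
      using sums_mult2[OF sibuya_prob_sums_1[OF x], of "1 / x"] unfolding eq by simp
  qed (use x sibuya_harm_nonneg in \<open>auto simp: sibuya_harm_Suc\<close>)
  then show ?thesis by simp
qed

lemma square_increment:
  fixes p d h z :: real
  assumes "z \<noteq> 0" "d \<noteq> 0"
  shows "p * d / z * ((h + 1 / d)\<^sup>2 - h\<^sup>2) = p * h * (2 / z) + p / d * (1 / z)"
proof -
  have "(h + 1 / d)\<^sup>2 - h\<^sup>2 = (2 * h + 1 / d) / d"
    by (simp add: power2_eq_square algebra_simps add_divide_distrib)
  then have "p * d / z * ((h + 1 / d)\<^sup>2 - h\<^sup>2) = p / z * (2 * h + 1 / d)"
    using assms by simp
  then show ?thesis by (simp add: algebra_simps)
qed

lemma sibuya_mean_harm_squared: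
  "(\<lambda>j. sibuya_prob x (Suc j) * (sibuya_harm x (Suc j))\<^sup>2) sums (2 / x\<^sup>2 + sibuya_q x / x)"
proof -
  have eq: "sibuya_tail x (Suc i) * ((sibuya_harm x (Suc (Suc i)))\<^sup>2 - (sibuya_harm x (Suc i))\<^sup>2)
      = sibuya_prob x (Suc i) * sibuya_harm x (Suc i) * (2 / x)
        + sibuya_prob x (Suc i) / (real (Suc i) - x) * (1 / x)" for i
  proof -
    define d where "d = real (Suc i) - x"
    have "0 < d" unfolding d_def using x by linarith
    then have "d \<noteq> 0" by simp
    have h: "sibuya_harm x (Suc (Suc i)) = sibuya_harm x (Suc i) + 1 / d"
      by (simp add: sibuya_harm_Suc d_def)
    have T: "sibuya_tail x (Suc i) = sibuya_prob x (Suc i) * d / x"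
      unfolding d_def using x by (intro sibuya_tail_eq_prob) auto
    have "x \<noteq> 0" using x by simp
    then show ?thesis using \<open>d \<noteq> 0\<close> unfolding d_def[symmetric] h T
      by (rule square_increment)
  qed
  have "(\<lambda>j. sibuya_prob x (Suc j) * (sibuya_harm x (Suc j))\<^sup>2) sums
     ((sibuya_harm x (Suc 0))\<^sup>2 + (1 / x * (2 / x) + sibuya_q x * (1 / x)))"
  proof (rule sibuya_abel_sums[OF x])
    show "(\<lambda>i. sibuya_tail x (Suc i) * ((sibuya_harm x (Suc (Suc i)))\<^sup>2 - (sibuya_harm x (Suc i))\<^sup>2))
        sums (1 / x * (2 / x) + sibuya_q x * (1 / x))"
      unfolding eq
      by (intro sums_add sums_mult2 sibuya_mean_harm sibuya_q_sums x)
    show "(sibuya_harm x (Suc j))\<^sup>2 \<le> (sibuya_harm x (Suc (Suc j)))\<^sup>2" for j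
      using x sibuya_harm_nonneg by (intro power_mono) (auto simp: sibuya_harm_Suc)
  qed simp
  then show ?thesis by (simp add: power2_eq_square)
qed

text \<open>Together with \<open>fisher_info_eq\<close> this is the information identity: \<open>1 / x\<^sup>2\<close> plus this mean, the expected
negative second derivative of the log likelihood, equals the Fisher information.\<close>

lemma sibuya_mean_observed_info:
  "(\<lambda>j. sibuya_prob x (Suc j) * (\<Sum>i=1..<Suc j. 1 / (real i - x)\<^sup>2)) sums (sibuya_q x / x)"
proof -
  have eq: "sibuya_tail x (Suc i) * ((\<Sum>i=1..<Suc (Suc i). 1 / (real i - x)\<^sup>2) - (\<Sum>i=1..<Suc i. 1 / (real i - x)\<^sup>2))
      = sibuya_prob x (Suc i) / (real (Suc i) - x) * (1 / x)" for i
  proof -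
    define d where "d = real (Suc i) - x"
    have "0 < d" unfolding d_def using x by linarith
    then have "d \<noteq> 0" by simp
    have T: "sibuya_tail x (Suc i) = sibuya_prob x (Suc i) * d / x"
      unfolding d_def using x by (intro sibuya_tail_eq_prob) auto
    have g: "(\<Sum>i=1..<Suc (Suc i). 1 / (real i - x)\<^sup>2) = (\<Sum>i=1..<Suc i. 1 / (real i - x)\<^sup>2) + 1 / d\<^sup>2"
      by (simp add: d_def)
    show ?thesis using x \<open>d \<noteq> 0\<close> unfolding d_def[symmetric] g T add_diff_cancel_left'
      by (simp add: power2_eq_square)
  qed
  have "(\<lambda>j. sibuya_prob x (Suc j) * (\<Sum>i=1..<Suc j. 1 / (real i - x)\<^sup>2)) sums
     ((\<Sum>i=1..<Suc 0. 1 / (real i - x)\<^sup>2) + sibuya_q x * (1 / x))"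
  proof (rule sibuya_abel_sums[OF x, where a = "\<lambda>j. \<Sum>i=1..<Suc j. 1 / (real i - x)\<^sup>2"])
    show "(\<lambda>i. sibuya_tail x (Suc i) * ((\<Sum>i=1..<Suc (Suc i). 1 / (real i - x)\<^sup>2) - (\<Sum>i=1..<Suc i. 1 / (real i - x)\<^sup>2)))
        sums (sibuya_q x * (1 / x))"
      unfolding eq by (intro sums_mult2 sibuya_q_sums x)
  qed (auto intro!: sum_nonneg add_nonneg_nonneg)
  then show ?thesis by simp
qed

lemma deriv_ln_sibuya_prob:
  "deriv (\<lambda>y. ln (sibuya_prob y (Suc j))) x = 1 / x - sibuya_harm x (Suc j)"
proof (rule DERIV_imp_deriv)
  let ?l = "\<lambda>y. ln y + (\<Sum>i=1..<Suc j. ln (real i - y)) - ln (fact (Suc j))"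
  have "(?l has_real_derivative (1 / x + (\<Sum>i=1..<Suc j. - 1 / (real i - x)) - 0)) (at x)"
    using x by (auto intro!: derivative_eq_intros sum.cong simp: divide_simps)
  then have d: "(?l has_real_derivative (1 / x - sibuya_harm x (Suc j))) (at x)"
    by (simp add: sibuya_harm_def sum_negf)
  have "?l y = ln (sibuya_prob y (Suc j))" if "y \<in> {0<..<1}" for y
  proof -
    have pos: "0 < real i - y" if "i \<in> {1..<Suc j}" for i
      using that \<open>y \<in> {0<..<1}\<close> by auto
    then have "0 < (\<Prod>i=1..<Suc j. real i - y)" by (intro prod_pos) auto
    moreover have "ln (\<Prod>i=1..<Suc j. real i - y) = (\<Sum>i=1..<Suc j. ln (real i - y))"
      using pos by (intro ln_prod) auto
    ultimately show ?thesis
      using that by (simp add: sibuya_prob_def ln_mult ln_div del: fact_Suc)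
  qed
  then show "((\<lambda>y. ln (sibuya_prob y (Suc j))) has_real_derivative (1 / x - sibuya_harm x (Suc j))) (at x)"
    using has_field_derivative_transform_within_open[OF d, of "{0<..<1}"] x by auto
qed

text \<open>The score of one observation \<open>j\<close> is \<open>1 / x - sibuya_harm x j\<close>; expand the square and insert the first
two moments of \<open>sibuya_harm\<close>.\<close>

lemma fisher_info_eq: "fisher_info x = 1 / x\<^sup>2 + sibuya_q x / x"
proof -
  have "(\<lambda>j. sibuya_prob x (Suc j) * (1 / x\<^sup>2) - sibuya_prob x (Suc j) * sibuya_harm x (Suc j) * (2 / x)
       + sibuya_prob x (Suc j) * (sibuya_harm x (Suc j))\<^sup>2)
      sums (1 * (1 / x\<^sup>2) - 1 / x * (2 / x) + (2 / x\<^sup>2 + sibuya_q x / x))"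
    by (intro sums_add sums_diff sums_mult2 sibuya_prob_sums_1 sibuya_mean_harm sibuya_mean_harm_squared x)
  moreover have "(\<lambda>j. sibuya_prob x (Suc j) * (1 / x\<^sup>2) - sibuya_prob x (Suc j) * sibuya_harm x (Suc j) * (2 / x)
       + sibuya_prob x (Suc j) * (sibuya_harm x (Suc j))\<^sup>2)
     = (\<lambda>j. sibuya_prob x (Suc j) * (1 / x - sibuya_harm x (Suc j))\<^sup>2)"
    using x by (intro ext) (simp add: power2_diff power_divide algebra_simps)
  ultimately show ?thesis
    unfolding fisher_info_def by (simp add: deriv_ln_sibuya_prob sums_iff power2_eq_square)
qed

end

lemma fisher_info_pos: "0 < x \<Longrightarrow> x < 1 \<Longrightarrow> 0 < fisher_info x"
  using sibuya_q_nonneg[of x] by (simp add: fisher_info_eq add_pos_nonneg)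

lemma isCont_fisher_info:
  assumes "0 < x" "x < 1"
  shows "isCont fisher_info x"
proof -
  have "isCont (\<lambda>x. 1 / x\<^sup>2 + sibuya_q x / x) x"
    using assms isCont_sibuya_q by (intro continuous_intros) auto
  moreover have "\<forall>\<^sub>F y in nhds x. fisher_info y = 1 / y\<^sup>2 + sibuya_q y / y"
    using assms by (intro eventually_nhds_in_open[THEN eventually_mono, of "{0<..<1}"])
      (auto simp: fisher_info_eq)
  ultimately show ?thesis by (subst isCont_cong)
qed

section \<open>Partitions and block statistics\<close>

text \<open>For \<open>f = Min\<close> on the blocks of a partition, the inverse of this bijection is \<open>block\<close>.\<close>

lemma bij_betw_rank:
  fixes f :: "'a \<Rightarrow> 'b::linorder"
  assumes "finite A" "inj_on f A"
  shows "bij_betw (\<lambda>U. card {V \<in> A. f V \<le> f U}) A {1..card A}"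
proof -
  let ?r = "\<lambda>U. card {V \<in> A. f V \<le> f U}"
  have less: "?r U < ?r U'" if "U \<in> A" "U' \<in> A" "f U < f U'" for U U'
  proof (rule psubset_card_mono)
    show "{V \<in> A. f V \<le> f U} \<subset> {V \<in> A. f V \<le> f U'}" using that by force
  qed (use assms in simp)
  have "inj_on ?r A"
  proof (rule inj_onI)
    fix U U' assume *: "U \<in> A" "U' \<in> A" "?r U = ?r U'"
    then have "f U = f U'" using less[of U U'] less[of U' U] by (metis less_irrefl linorder_neqE)
    with * assms(2) show "U = U'" by (auto dest: inj_onD)
  qed
  moreover have "?r ` A \<subseteq> {1..card A}"
  proof clarsimp
    fix U assume "U \<in> A"
    then have "U \<in> {V \<in> A. f V \<le> f U}" by simp
    then have "0 < ?r U" using assms(1) by (auto simp: card_gt_0_iff)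
    then show "Suc 0 \<le> ?r U \<and> ?r U \<le> card A"
      using assms(1) by (auto intro: card_mono)
  qed
  ultimately show ?thesis
    by (simp add: bij_betw_def card_image card_subset_eq)
qed

text \<open>The statistics used below are built from such sums; a step of the chain adds a singleton or enlarges
one block, so their increments are explicit.\<close>

definition block_sum :: "(nat \<Rightarrow> real) \<Rightarrow> nat set set \<Rightarrow> real" where
  "block_sum f \<pi> = (\<Sum>U\<in>\<pi>. f (card U))"

definition join_block :: "nat \<Rightarrow> nat set set \<Rightarrow> nat set \<Rightarrow> nat set set" where
  "join_block n \<pi> U = insert (insert (n + 1) U) (\<pi> - {U})"

text \<open>Undoes \<open>add_element n\<close>. That the past can be read off the present partition rests on it.\<close>

definition restrict_partition :: "nat \<Rightarrow> nat set set \<Rightarrow> nat set set" where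
  "restrict_partition n \<pi> = (\<lambda>U. U - {n + 1}) ` \<pi> - {{}}"

context
  fixes n :: nat and \<pi> :: "nat set set"
  assumes part: "partition_on {1..n} \<pi>"
begin

lemma partition_finite: "finite \<pi>"
  using part finite_elements by blast

lemma partition_block:
  assumes "U \<in> \<pi>"
  shows "finite U" "U \<noteq> {}" "U \<subseteq> {1..n}" "n + 1 \<notin> U" "1 \<le> card U"
proof -
  show sub: "U \<subseteq> {1..n}" using part assms by (auto simp: partition_on_def)
  show fin: "finite U" using sub finite_subset by blast
  show ne: "U \<noteq> {}" using part assms by (auto simp: partition_on_def)
  show "n + 1 \<notin> U" using sub by auto
  show "1 \<le> card U" using fin ne by (simp add: Suc_le_eq card_gt_0_iff)
qed

lemma partition_sum_card: "(\<Sum>U\<in>\<pi>. card U) = n"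
proof -
  have "card (\<Union>\<pi>) = (\<Sum>U\<in>\<pi>. card U)"
    using part partition_block by (intro card_Union_disjoint) (auto simp: partition_on_def)
  then show ?thesis using part by (simp add: partition_on_def)
qed

lemma partition_card_le: "card \<pi> \<le> n"
proof -
  have "(\<Sum>U\<in>\<pi>. 1) \<le> (\<Sum>U\<in>\<pi>. card U)" using partition_block by (intro sum_mono) auto
  then show ?thesis by (simp add: partition_sum_card)
qed

lemma partition_card_pos:
  assumes "1 \<le> n"
  shows "1 \<le> card \<pi>"
proof -
  have "\<pi> \<noteq> {}" using part assms by (auto simp: partition_on_def)
  then show ?thesis using partition_finite by (simp add: Suc_le_eq card_gt_0_iff)
qed

lemma block_sum_size_minus: "block_sum (\<lambda>j. real j - c) \<pi> = real n - real (card \<pi>) * c"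
  using partition_sum_card by (simp add: block_sum_def sum_subtractf flip: of_nat_sum)

lemma inj_on_Min_partition: "inj_on Min \<pi>"
proof (rule inj_onI)
  fix U V assume *: "U \<in> \<pi>" "V \<in> \<pi>" "Min U = Min V"
  then have "Min U \<in> U \<inter> V" using partition_block by (metis IntI Min_in)
  with * part show "U = V" by (auto simp: partition_on_def disjoint_def)
qed

lemma bij_betw_block: "bij_betw (block \<pi>) {1..card \<pi>} \<pi>"
proof -
  let ?r = "\<lambda>U. card {V \<in> \<pi>. Min V \<le> Min U}"
  have r: "bij_betw ?r \<pi> {1..card \<pi>}"
    by (rule bij_betw_rank[OF partition_finite inj_on_Min_partition])
  have "block \<pi> (?r U) = U" if "U \<in> \<pi>" for U
    unfolding block_def using that r by (intro the_equality) (auto simp: bij_betw_def dest: inj_onD)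
  then have inv: "\<And>U. U \<in> \<pi> \<Longrightarrow> block \<pi> (?r U) = U" by simp
  have im: "?r ` \<pi> = {1..card \<pi>}" using r by (simp add: bij_betw_def)
  have "block \<pi> i \<in> \<pi> \<and> ?r (block \<pi> i) = i" if i: "i \<in> {1..card \<pi>}" for i
  proof -
    obtain U where "U \<in> \<pi>" "i = ?r U" using i im by blast
    then show ?thesis using inv by simp
  qed
  then show ?thesis
    using inv im by (intro bij_betw_byWitness[where f' = ?r]) auto
qed

lemma block_in: "i \<in> {1..card \<pi>} \<Longrightarrow> block \<pi> i \<in> \<pi>"
  using bij_betw_block by (auto simp: bij_betw_def)

lemma sum_blocks: "(\<Sum>i=1..card \<pi>. g (block \<pi> i)) = (\<Sum>U\<in>\<pi>. g U)"
  by (rule sum.reindex_bij_betw[OF bij_betw_block])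

lemma add_element_eq:
  "add_element n \<pi> 0 = insert {n + 1} \<pi>"
  "1 \<le> i \<Longrightarrow> add_element n \<pi> i = join_block n \<pi> (block \<pi> i)"
  by (auto simp: add_element_def join_block_def)

lemma new_block_notin: "{n + 1} \<notin> \<pi>"
  using partition_block(4) by auto

lemma card_new_block: "card (insert {n + 1} \<pi>) = card \<pi> + 1"
  using new_block_notin partition_finite by simp

lemma block_sum_new_block: "block_sum f (insert {n + 1} \<pi>) = block_sum f \<pi> + f 1"
  using new_block_notin partition_finite by (simp add: block_sum_def)

lemma enlarged_block_notin: "U \<in> \<pi> \<Longrightarrow> insert (n + 1) U \<notin> \<pi>"
  using partition_block(4) by auto

lemma card_join_block: "U \<in> \<pi> \<Longrightarrow> card (join_block n \<pi> U) = card \<pi>"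
  using enlarged_block_notin partition_finite card_Suc_Diff1[of \<pi> U]
  by (simp add: join_block_def)

lemma block_sum_join_block:
  assumes "U \<in> \<pi>"
  shows "block_sum f (join_block n \<pi> U) = block_sum f \<pi> + (f (card U + 1) - f (card U))"
proof -
  have "block_sum f (join_block n \<pi> U) = f (card U + 1) + (\<Sum>V\<in>\<pi> - {U}. f (card V))"
    using assms enlarged_block_notin[OF assms] partition_finite partition_block[OF assms]
    by (simp add: block_sum_def join_block_def)
  then show ?thesis
    using partition_finite assms by (simp add: block_sum_def sum_diff1)
qed

lemma restrict_new_block: "restrict_partition n (insert {n + 1} \<pi>) = \<pi>"
proof -
  have "(\<lambda>U. U - {n + 1}) ` \<pi> = (\<lambda>U. U) ` \<pi>"
    using partition_block(4) by (intro image_cong) auto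
  then show ?thesis using partition_block(2) by (auto simp: restrict_partition_def)
qed

lemma restrict_join_block:
  assumes "U \<in> \<pi>"
  shows "restrict_partition n (join_block n \<pi> U) = \<pi>"
proof -
  have "(\<lambda>U. U - {n + 1}) ` (\<pi> - {U}) = (\<lambda>U. U) ` (\<pi> - {U})"
    using partition_block(4) by (intro image_cong) auto
  moreover have "insert (n + 1) U - {n + 1} = U" using partition_block(4)[OF assms] by auto
  ultimately have "(\<lambda>U. U - {n + 1}) ` join_block n \<pi> U = \<pi>"
    using assms by (auto simp: join_block_def)
  then show ?thesis using partition_block(2) by (auto simp: restrict_partition_def)
qed

lemma restrict_add_element: "i \<le> card \<pi> \<Longrightarrow> restrict_partition n (add_element n \<pi> i) = \<pi>"
  using restrict_new_block restrict_join_block block_in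
  by (cases "i = 0") (auto simp: add_element_eq)

lemma inj_on_join_block: "inj_on (join_block n \<pi>) \<pi>"
proof (rule inj_onI)
  fix U V assume *: "U \<in> \<pi>" "V \<in> \<pi>" "join_block n \<pi> U = join_block n \<pi> V"
  then have "insert (n + 1) U \<in> join_block n \<pi> V" by (auto simp: join_block_def)
  then have "insert (n + 1) U = insert (n + 1) V"
    using enlarged_block_notin *(1) by (auto simp: join_block_def)
  then show "U = V"
    using partition_block(4)[OF *(1)] partition_block(4)[OF *(2)] by (simp add: insert_ident)
qed

lemma inj_on_add_element: "inj_on (add_element n \<pi>) {0..card \<pi>}"
proof (rule inj_onI)
  fix i j assume *: "i \<in> {0..card \<pi>}" "j \<in> {0..card \<pi>}" "add_element n \<pi> i = add_element n \<pi> j"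
  have c: "card (add_element n \<pi> 0) \<noteq> card (add_element n \<pi> l)" if "1 \<le> l" "l \<le> card \<pi>" for l
  proof -
    have "block \<pi> l \<in> \<pi>" using that block_in by simp
    then show ?thesis
      unfolding add_element_eq(1) add_element_eq(2)[OF that(1)] card_new_block
      by (subst card_join_block) auto
  qed
  show "i = j"
  proof (cases "i = 0 \<or> j = 0")
    case True
    then show ?thesis using c[of i] c[of j] * by (metis atLeastAtMost_iff le0 less_one not_le)
  next
    case False
    then have "block \<pi> i = block \<pi> j"
      using * block_in by (intro inj_onD[OF inj_on_join_block]) (auto simp: add_element_eq)
    then show ?thesis
      using * False by (intro inj_onD[OF bij_betw_imp_inj_on[OF bij_betw_block]]) auto
  qed
qed

end

section \<open>Weights and transition probabilities\<close>

text \<open>Outside \<open>C\<close> every point has a null neighbourhood, and by the Lindelof property countably many of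
these cover the complement of \<open>C\<close>.\<close>

lemma AE_measure_support:
  fixes \<mu> :: "real measure"
  assumes sets: "sets \<mu> = sets borel" and C: "closed C" and supp: "measure_support \<mu> \<subseteq> C"
  shows "AE \<theta> in \<mu>. \<theta> \<in> C"
proof -
  define \<F> where "\<F> = {U. open U \<and> emeasure \<mu> U = 0}"
  obtain \<F>' where F': "\<F>' \<subseteq> \<F>" "countable \<F>'" "\<Union>\<F>' = \<Union>\<F>"
    using Lindelof_openin[of \<F> UNIV] by (auto simp: \<F>_def)
  have "U \<in> null_sets \<mu>" if "U \<in> \<F>'" for U
    using F'(1) sets that by (intro null_setsI) (auto simp: \<F>_def)
  then have "\<Union>\<F>' \<in> null_sets \<mu>"
    using F'(2) null_sets_UN'[of \<F>' "\<lambda>U. U"] by simp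
  moreover have "- C \<subseteq> \<Union>\<F>"
  proof
    fix x assume "x \<in> - C"
    then have "x \<notin> measure_support \<mu>" using supp by auto
    then obtain U where "open U" "x \<in> U" "\<not> emeasure \<mu> U > 0"
      unfolding measure_support_def by blast
    then show "x \<in> \<Union>\<F>" by (auto simp: \<F>_def)
  qed
  ultimately show ?thesis
    using F'(3) by (intro AE_I'[of "\<Union>\<F>'"]) auto
qed

locale gibbs_mixture = mu: real_distribution \<mu> for \<mu> :: "real measure" +
  fixes \<alpha> \<theta>lo \<theta>hi :: real
  assumes \<alpha>: "0 < \<alpha>" "\<alpha> < 1"
    and supp: "measure_support \<mu> \<subseteq> {\<theta>lo..\<theta>hi}"
    and \<theta>: "- \<alpha> < \<theta>lo" "\<theta>lo \<le> 0" "0 \<le> \<theta>hi"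
begin

abbreviation wt :: "nat \<Rightarrow> nat \<Rightarrow> real \<Rightarrow> real" where
  "wt n k \<theta> \<equiv> gibbs_weight_at \<alpha> \<theta> n k"

abbreviation weight :: "nat \<Rightarrow> nat \<Rightarrow> real" where
  "weight \<equiv> gibbs_weight \<alpha> \<mu>"

lemma AE_\<theta>: "AE \<theta> in \<mu>. \<theta>lo \<le> \<theta> \<and> \<theta> \<le> \<theta>hi"
  using AE_measure_support[OF mu.events_eq_borel _ supp] by simp

lemma factors_pos:
  assumes "\<theta>lo \<le> \<theta>" "1 \<le> i"
  shows "0 < \<theta> + real i * \<alpha>" "0 < \<theta> + real i"
proof -
  have "1 * \<alpha> \<le> real i * \<alpha>" "real i * \<alpha> \<le> real i * 1"
    using \<alpha> assms by (auto intro!: mult_right_mono mult_left_mono)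
  then show "0 < \<theta> + real i * \<alpha>" "0 < \<theta> + real i" using \<theta> assms by linarith+
qed

lemma wt_pos: "\<theta>lo \<le> \<theta> \<Longrightarrow> 0 < wt n k \<theta>"
  unfolding gibbs_weight_at_def using factors_pos by (intro divide_pos_pos prod_pos) auto

lemma wt_bounds:
  assumes "\<theta>lo \<le> \<theta>" "\<theta> \<le> \<theta>hi"
  shows "(\<Prod>i=1..<k. \<theta>lo + real i * \<alpha>) / (\<Prod>i=1..<n. \<theta>hi + real i) \<le> wt n k \<theta>"
    and "wt n k \<theta> \<le> (\<Prod>i=1..<k. \<theta>hi + real i * \<alpha>) / (\<Prod>i=1..<n. \<theta>lo + real i)"
  unfolding gibbs_weight_at_def using assms factors_pos factors_pos[of \<theta>lo]
  by (auto intro!: frac_le prod_mono prod_pos prod_nonneg simp: less_imp_le)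

lemma wt_borel [measurable]: "wt n k \<in> borel_measurable borel"
  unfolding gibbs_weight_at_def by measurable

lemma integrable_wt: "integrable \<mu> (wt n k)"
proof (rule mu.integrable_const_bound)
  show "AE \<theta> in \<mu>. norm (wt n k \<theta>) \<le> (\<Prod>i=1..<k. \<theta>hi + real i * \<alpha>) / (\<Prod>i=1..<n. \<theta>lo + real i)"
    using AE_\<theta> by eventually_elim (use wt_bounds(2) wt_pos in \<open>simp add: abs_of_pos\<close>)
qed simp

lemma weight_pos: "0 < weight n k"
proof -
  let ?l = "(\<Prod>i=1..<k. \<theta>lo + real i * \<alpha>) / (\<Prod>i=1..<n. \<theta>hi + real i)"
  have "?l \<le> weight n k"
    unfolding gibbs_weight_def using AE_\<theta>
    by (intro mu.integral_ge_const integrable_wt, eventually_elim) (use wt_bounds(1) in simp)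
  moreover have "0 < ?l"
    using factors_pos[of \<theta>lo] factors_pos[of \<theta>hi] \<theta> by (intro divide_pos_pos prod_pos) auto
  ultimately show ?thesis by simp
qed

lemma wt_Suc_n: "1 \<le> n \<Longrightarrow> wt (n + 1) k \<theta> = wt n k \<theta> / (\<theta> + real n)"
  by (simp add: gibbs_weight_at_def field_simps)

lemma wt_Suc_k: "1 \<le> k \<Longrightarrow> wt n (k + 1) \<theta> = wt n k \<theta> * (\<theta> + real k * \<alpha>)"
  by (simp add: gibbs_weight_at_def)

text \<open>Pointwise in \<open>\<theta>\<close> this is \<open>(n - k \<alpha>) + (\<theta> + k \<alpha>) = \<theta> + n\<close>. It says that the transition
probabilities sum to 1.\<close>

lemma weight_recursion:
  assumes "1 \<le> n" "1 \<le> k"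
  shows "weight n k = (real n - real k * \<alpha>) * weight (n + 1) k + weight (n + 1) (k + 1)"
proof -
  have "AE \<theta> in \<mu>. wt n k \<theta> = (real n - real k * \<alpha>) * wt (n + 1) k \<theta> + wt (n + 1) (k + 1) \<theta>"
    using AE_\<theta>
  proof eventually_elim
    case (elim \<theta>)
    then have "0 < \<theta> + real n" using factors_pos assms by auto
    moreover have "(real n - real k * \<alpha>) * (w / d) + w / d * (\<theta> + real k * \<alpha>) = w"
      if "d = \<theta> + real n" "0 < d" for w d
    proof -
      have "(real n - real k * \<alpha>) * (w / d) + w / d * (\<theta> + real k * \<alpha>) = (w / d) * d"
        unfolding that(1) by (simp only: algebra_simps)
      then show ?thesis using that(2) by simp
    qed
    ultimately show ?case using assms by (simp only: wt_Suc_n wt_Suc_k)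
  qed
  then have "weight n k = (LINT \<theta>|\<mu>. (real n - real k * \<alpha>) * wt (n + 1) k \<theta> + wt (n + 1) (k + 1) \<theta>)"
    unfolding gibbs_weight_def by (intro integral_cong_AE) auto
  then show ?thesis by (simp add: gibbs_weight_def integrable_wt)
qed

lemma weight_Suc_n_bounds:
  assumes "1 \<le> n"
  shows "weight n k / (\<theta>hi + real n) \<le> weight (n + 1) k"
    and "weight (n + 1) k \<le> weight n k / (\<theta>lo + real n)"
proof -
  have "AE \<theta> in \<mu>. wt n k \<theta> / (\<theta>hi + real n) \<le> wt (n + 1) k \<theta> \<and>
      wt (n + 1) k \<theta> \<le> wt n k \<theta> / (\<theta>lo + real n)"
    using AE_\<theta>
  proof eventually_elim
    case (elim \<theta>)
    then have "0 < \<theta> + real n" "0 < \<theta>lo + real n" "0 < wt n k \<theta>"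
      using factors_pos(2)[OF _ assms] wt_pos by auto
    then show ?case
      unfolding wt_Suc_n[OF assms] using elim by (auto intro!: divide_left_mono)
  qed
  then have "(LINT \<theta>|\<mu>. wt n k \<theta> / (\<theta>hi + real n)) \<le> (LINT \<theta>|\<mu>. wt (n + 1) k \<theta>)"
    "(LINT \<theta>|\<mu>. wt (n + 1) k \<theta>) \<le> (LINT \<theta>|\<mu>. wt n k \<theta> / (\<theta>lo + real n))"
    by (intro integral_mono_AE integrable_wt integrable_divide; simp)+
  then show "weight n k / (\<theta>hi + real n) \<le> weight (n + 1) k"
    "weight (n + 1) k \<le> weight n k / (\<theta>lo + real n)" by (simp_all add: gibbs_weight_def)
qed

text \<open>\<open>\<theta> + k \<alpha>\<close> is at least \<open>k (\<alpha> + \<theta>lo)\<close> because \<open>\<theta>lo \<le> 0\<close>; this keeps the number of blocks growing.\<close>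

lemma weight_new_block_ge:
  assumes "1 \<le> n" "1 \<le> k"
  shows "real k * (\<alpha> + \<theta>lo) * weight (n + 1) k \<le> weight (n + 1) (k + 1)"
proof -
  have "(LINT \<theta>|\<mu>. real k * (\<alpha> + \<theta>lo) * wt (n + 1) k \<theta>) \<le> (LINT \<theta>|\<mu>. wt (n + 1) (k + 1) \<theta>)"
    using AE_\<theta>
  proof (intro integral_mono_AE integrable_wt integrable_mult_right, eventually_elim)
    case (elim \<theta>)
    have "real k * \<theta>lo \<le> 1 * \<theta>lo" using assms \<theta> by (intro mult_right_mono_neg) auto
    then have "real k * (\<alpha> + \<theta>lo) \<le> \<theta> + real k * \<alpha>" using elim by (simp add: algebra_simps)
    then show ?case using wt_pos[of \<theta> "n + 1" k] elim assms by (simp only: wt_Suc_k) (simp add: mult.commute)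
  qed
  then show ?thesis by (simp add: gibbs_weight_def)
qed

text \<open>From a partition of \<open>n\<close> points into \<open>k\<close> blocks, a block of size \<open>j\<close> is enlarged with probability
\<open>join_rate n k * (j - \<alpha>)\<close>, and a new block is opened with probability \<open>new_prob n k\<close>.\<close>

definition join_rate :: "nat \<Rightarrow> nat \<Rightarrow> real" where
  "join_rate n k = weight (n + 1) k / weight n k"

definition new_prob :: "nat \<Rightarrow> nat \<Rightarrow> real" where
  "new_prob n k = weight (n + 1) (k + 1) / weight n k"

lemma new_prob_eq:
  assumes "1 \<le> n" "1 \<le> k"
  shows "new_prob n k = 1 - join_rate n k * (real n - real k * \<alpha>)"
  using weight_recursion[OF assms] weight_pos[of n k]
  by (simp add: new_prob_def join_rate_def field_simps)

text \<open>A single constant for all error bounds: \<open>(\<theta>hi - \<theta>lo) / (1 + \<theta>lo)\<close> measures the effect of mixing over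
\<open>\<theta>\<close>, \<open>1 / (1 + \<theta>lo)\<close> bounds \<open>n / (\<theta>lo + n)\<close>, and the summand 1 lets it absorb absolute constants.\<close>

definition rate_const :: real where
  "rate_const = 1 + 2 * (\<theta>hi - \<theta>lo) / (1 + \<theta>lo) + 1 / (1 + \<theta>lo)"

definition growth_const :: real where
  "growth_const = (\<alpha> + \<theta>lo) / (1 + \<theta>hi)"

lemma rate_const_ge: "1 \<le> rate_const"
  unfolding rate_const_def using \<theta> \<alpha> by (simp add: add_nonneg_nonneg)

lemma growth_const_pos: "0 < growth_const"
  unfolding growth_const_def using \<theta> by simp

lemma join_rate_bounds:
  assumes "1 \<le> n"
  shows "1 / (\<theta>hi + real n) \<le> join_rate n k" "join_rate n k \<le> 1 / (\<theta>lo + real n)"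
proof -
  have "(weight n k / (\<theta>hi + real n)) / weight n k \<le> join_rate n k"
    "join_rate n k \<le> (weight n k / (\<theta>lo + real n)) / weight n k"
    unfolding join_rate_def
    by (intro divide_right_mono weight_Suc_n_bounds[OF assms] less_imp_le[OF weight_pos])+
  then show "1 / (\<theta>hi + real n) \<le> join_rate n k" "join_rate n k \<le> 1 / (\<theta>lo + real n)"
    using weight_pos[of n k] by auto
qed

lemma lo_scale: "1 \<le> n \<Longrightarrow> real n * (1 + \<theta>lo) \<le> \<theta>lo + real n"
proof -
  assume "1 \<le> n"
  then have "real n * \<theta>lo \<le> 1 * \<theta>lo" using \<theta> by (intro mult_right_mono_neg) auto
  then show ?thesis by (simp add: algebra_simps)
qed

lemma hi_scale: "1 \<le> n \<Longrightarrow> \<theta>hi + real n \<le> real n * (1 + \<theta>hi)"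
proof -
  assume "1 \<le> n"
  then have "1 * \<theta>hi \<le> real n * \<theta>hi" using \<theta> by (intro mult_right_mono) auto
  then show ?thesis by (simp add: algebra_simps)
qed

lemma join_rate_pos: "1 \<le> n \<Longrightarrow> 0 < join_rate n k"
  using weight_pos by (simp add: join_rate_def)

lemma join_rate_le:
  assumes "1 \<le> n"
  shows "join_rate n k \<le> rate_const / real n"
proof -
  have p: "0 < real n * (1 + \<theta>lo)" using assms \<theta> \<alpha> by simp
  have "join_rate n k \<le> 1 / (real n * (1 + \<theta>lo))"
    using join_rate_bounds(2)[OF assms, of k] lo_scale[OF assms] p
    by (meson frac_le less_eq_real_def order_trans zero_less_one order_refl)
  also have "\<dots> = (1 / (1 + \<theta>lo)) / real n" by simp
  also have "\<dots> \<le> rate_const / real n"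
    using \<theta> \<alpha> by (intro divide_right_mono) (auto simp: rate_const_def)
  finally show ?thesis .
qed

text \<open>\<open>join_rate n k\<close> is a weighted mean of \<open>1 / (\<theta> + n)\<close> over \<open>\<theta>\<close> in a bounded interval.\<close>

lemma join_rate_approx:
  assumes "1 \<le> n"
  shows "\<bar>join_rate n k - 1 / real n\<bar> \<le> rate_const / 2 / (real n)\<^sup>2"
proof -
  have n: "0 < real n" using assms by simp
  have lo: "0 < 1 + \<theta>lo" using \<theta> \<alpha> by simp
  have lon: "0 < \<theta>lo + real n" using assms \<theta> \<alpha> by linarith
  have hin: "0 < \<theta>hi + real n" using assms \<theta> \<alpha> by linarith
  define D where "D = (\<theta>hi - \<theta>lo) / (1 + \<theta>lo)"
  have D: "- \<theta>lo / (1 + \<theta>lo) \<le> D" "\<theta>hi \<le> D"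
  proof -
    show "- \<theta>lo / (1 + \<theta>lo) \<le> D" unfolding D_def using \<theta> lo by (intro divide_right_mono) auto
    have "0 \<le> - \<theta>lo * (\<theta>hi + 1)" using \<theta> by (intro mult_nonneg_nonneg) auto
    then have "\<theta>hi * (1 + \<theta>lo) \<le> \<theta>hi - \<theta>lo" by (simp add: algebra_simps)
    then show "\<theta>hi \<le> D" unfolding D_def using lo by (simp add: pos_le_divide_eq)
  qed
  have "1 / (\<theta>lo + real n) - 1 / real n = - \<theta>lo / (real n * (\<theta>lo + real n))"
    using n lon by (simp add: field_simps)
  also have "\<dots> \<le> - \<theta>lo / (real n * (real n * (1 + \<theta>lo)))"
    using \<theta> n lo lo_scale[OF assms] by (intro divide_left_mono mult_left_mono mult_pos_pos) auto
  also have "\<dots> = (- \<theta>lo / (1 + \<theta>lo)) / (real n)\<^sup>2" by (simp add: power2_eq_square)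
  also have "\<dots> \<le> D / (real n)\<^sup>2" using D by (intro divide_right_mono) auto
  finally have up: "join_rate n k - 1 / real n \<le> D / (real n)\<^sup>2"
    using join_rate_bounds(2)[OF assms, of k] by simp
  have "1 / real n - 1 / (\<theta>hi + real n) = \<theta>hi / (real n * (\<theta>hi + real n))"
    using n hin by (simp add: field_simps)
  also have "\<dots> \<le> \<theta>hi / (real n * real n)"
    using \<theta> n by (intro divide_left_mono mult_left_mono mult_pos_pos) auto
  also have "\<dots> \<le> D / (real n)\<^sup>2"
    using D by (simp add: power2_eq_square divide_right_mono)
  finally have lw: "1 / real n - join_rate n k \<le> D / (real n)\<^sup>2"
    using join_rate_bounds(1)[OF assms, of k] by simp
  have "rate_const = 1 + 2 * D + 1 / (1 + \<theta>lo)" by (simp add: rate_const_def D_def)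
  moreover have "0 \<le> 1 / (1 + \<theta>lo)" using lo by simp
  ultimately have "D \<le> rate_const / 2" by simp
  then have "D / (real n)\<^sup>2 \<le> rate_const / 2 / (real n)\<^sup>2" by (intro divide_right_mono) auto
  then show ?thesis using up lw by linarith
qed

text \<open>By \<open>new_prob_eq\<close>, the error of \<open>join_rate\<close> is multiplied by \<open>n - k \<alpha>\<close>, which is at most \<open>n\<close>.\<close>

lemma new_prob_approx:
  assumes "1 \<le> k" "k \<le> n"
  shows "\<bar>new_prob n k - \<alpha> * real k / real n\<bar> \<le> rate_const / real n"
proof -
  have n: "1 \<le> n" "0 < real n" using assms by auto
  define g where "g = join_rate n k - 1 / real n"
  have g: "\<bar>g\<bar> \<le> rate_const / 2 / (real n)\<^sup>2" unfolding g_def by (rule join_rate_approx[OF n(1)])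
  have "\<alpha> * real k \<le> 1 * real n" using assms \<alpha> by (intro mult_mono) auto
  then have k: "\<bar>\<alpha> * real k - real n\<bar> \<le> real n" using \<alpha> by auto
  have "new_prob n k - \<alpha> * real k / real n = (\<alpha> * real k - real n) * g"
    unfolding new_prob_eq[OF n(1) assms(1)] g_def using n by (simp add: field_simps)
  then have "\<bar>new_prob n k - \<alpha> * real k / real n\<bar> \<le> real n * (rate_const / 2 / (real n)\<^sup>2)"
    using g k by (simp only: abs_mult) (intro mult_mono, auto)
  also have "\<dots> \<le> rate_const / real n" using n rate_const_ge by (simp add: power2_eq_square field_simps)
  finally show ?thesis .
qed

lemma new_prob_ge:
  assumes "1 \<le> k" "k \<le> n"
  shows "growth_const * real k / real n \<le> new_prob n k"
proof -
  have n: "1 \<le> n" "0 < real n" using assms by auto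
  have "growth_const * real k / real n = real k * (\<alpha> + \<theta>lo) * (1 / (real n * (1 + \<theta>hi)))"
    by (simp add: growth_const_def mult_ac)
  also have "\<dots> \<le> real k * (\<alpha> + \<theta>lo) * (1 / (\<theta>hi + real n))"
    using \<theta> n hi_scale[OF n(1)] by (intro mult_left_mono frac_le) auto
  also have "\<dots> \<le> real k * (\<alpha> + \<theta>lo) * join_rate n k"
    using \<theta> join_rate_bounds(1)[OF n(1), of k] by (intro mult_left_mono) auto
  also have "\<dots> \<le> new_prob n k"
    using weight_new_block_ge[OF n(1) assms(1)] weight_pos[of n k]
    by (simp add: join_rate_def new_prob_def divide_right_mono less_imp_le)
  finally show ?thesis .
qed

lemma new_prob_nonneg: "0 \<le> new_prob n k"
  using weight_pos by (simp add: new_prob_def less_imp_le)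

lemma new_prob_le_1:
  assumes "1 \<le> k" "k \<le> n"
  shows "new_prob n k \<le> 1"
proof -
  have "real k * \<alpha> \<le> real n * 1" using assms \<alpha> by (intro mult_mono) auto
  then show ?thesis
    using new_prob_eq[of n k] join_rate_pos[of n k] assms by (simp add: mult_nonneg_nonneg less_imp_le)
qed

lemma new_prob_le:
  assumes "1 \<le> k" "k \<le> n"
  shows "new_prob n k \<le> 2 * rate_const * real k / real n"
proof -
  have "new_prob n k \<le> \<alpha> * real k / real n + rate_const / real n" using new_prob_approx[OF assms] by linarith
  also have "\<dots> = (\<alpha> * real k + rate_const) / real n" by (simp add: add_divide_distrib)
  also have "\<dots> \<le> (rate_const * real k + rate_const * real k) / real n"
    using rate_const_ge \<alpha> assms by (intro divide_right_mono add_mono mult_right_mono) auto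
  finally show ?thesis by (simp add: mult_ac)
qed

lemma predictive_eq:
  "predictive \<alpha> \<mu> n \<pi> 0 = new_prob n (card \<pi>)"
  "1 \<le> i \<Longrightarrow> predictive \<alpha> \<mu> n \<pi> i = join_rate n (card \<pi>) * (real (card (block \<pi> i)) - \<alpha>)"
  by (auto simp: predictive_def new_prob_def join_rate_def)

end

section \<open>The partition chain\<close>

text \<open>The conditional expectation of \<open>F (X (n + 1))\<close> given \<open>X n = \<pi>\<close>.\<close>

definition partition_step ::
    "real \<Rightarrow> real measure \<Rightarrow> nat \<Rightarrow> (nat set set \<Rightarrow> 'b) \<Rightarrow> nat set set \<Rightarrow> 'b::real_vector" where
  "partition_step \<alpha> \<mu> n F \<pi> = (\<Sum>i=0..card \<pi>. predictive \<alpha> \<mu> n \<pi> i *\<^sub>R F (add_element n \<pi> i))"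

lemma (in gibbs_mixture) partition_step_eq:
  assumes "partition_on {1..n} \<pi>"
  shows "partition_step \<alpha> \<mu> n F \<pi> = new_prob n (card \<pi>) *\<^sub>R F (insert {n + 1} \<pi>)
     + (\<Sum>U\<in>\<pi>. (join_rate n (card \<pi>) * (real (card U) - \<alpha>)) *\<^sub>R F (join_block n \<pi> U))"
proof -
  have "(\<Sum>i=1..card \<pi>. predictive \<alpha> \<mu> n \<pi> i *\<^sub>R F (add_element n \<pi> i))
     = (\<Sum>i=1..card \<pi>. (join_rate n (card \<pi>) * (real (card (block \<pi> i)) - \<alpha>)) *\<^sub>R F (join_block n \<pi> (block \<pi> i)))"
    by (intro sum.cong) (auto simp: predictive_eq add_element_eq[OF assms])
  also have "\<dots> = (\<Sum>U\<in>\<pi>. (join_rate n (card \<pi>) * (real (card U) - \<alpha>)) *\<^sub>R F (join_block n \<pi> U))"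
    by (rule sum_blocks[OF assms])
  finally show ?thesis
    by (simp add: partition_step_def sum.atLeast_Suc_atMost predictive_eq add_element_eq[OF assms])
qed

locale gibbs_chain = prob_space M + gibbs_mixture \<mu> \<alpha> \<theta>lo \<theta>hi
  for M :: "'w measure" and \<mu> :: "real measure" and \<alpha> \<theta>lo \<theta>hi :: real +
  fixes X :: "nat \<Rightarrow> 'w \<Rightarrow> nat set set"
  assumes gibbs: "gibbs_partition M \<alpha> \<mu> X"
begin

lemma X_measurable: "1 \<le> n \<Longrightarrow> X n \<in> M \<rightarrow>\<^sub>M count_space {\<pi>. partition_on {1..n} \<pi>}"
  using gibbs by (simp add: gibbs_partition_def)

lemma X_partition: "1 \<le> n \<Longrightarrow> \<omega> \<in> space M \<Longrightarrow> partition_on {1..n} (X n \<omega>)"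
  using measurable_space[OF X_measurable] by simp

lemma X_extends:
  assumes "1 \<le> n" "\<omega> \<in> space M"
  obtains i where "i \<le> card (X n \<omega>)" "X (n + 1) \<omega> = add_element n (X n \<omega>) i"
proof -
  have "\<forall>n\<ge>1. \<forall>\<omega>\<in>space M. \<exists>i\<le>card (X n \<omega>). X (n + 1) \<omega> = add_element n (X n \<omega>) i"
    using gibbs unfolding gibbs_partition_def by (elim conjE)
  with assms that show ?thesis by blast
qed

lemma X_restrict:
  assumes "1 \<le> n" "\<omega> \<in> space M"
  shows "restrict_partition n (X (n + 1) \<omega>) = X n \<omega>"
proof -
  obtain i where "i \<le> card (X n \<omega>)" "X (n + 1) \<omega> = add_element n (X n \<omega>) i"
    by (rule X_extends[OF assms])
  then show ?thesis using restrict_add_element[OF X_partition[OF assms]] by simp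
qed

text \<open>Since each step can be undone, the past is a function of the present. Weighting by an event of the
past is therefore weighting by a function of the current state.\<close>

lemma X_history:
  assumes "1 \<le> r" "r \<le> n"
  obtains g where "\<And>\<omega>. \<omega> \<in> space M \<Longrightarrow> X r \<omega> = g (X n \<omega>)"
  using assms(2)
proof (induction n arbitrary: thesis rule: dec_induct)
  case base
  show ?case by (rule base[of "\<lambda>x. x"]) simp
next
  case (step n)
  obtain g where g: "\<And>\<omega>. \<omega> \<in> space M \<Longrightarrow> X r \<omega> = g (X n \<omega>)"
    using step.IH by blast
  have "X r \<omega> = (g \<circ> restrict_partition n) (X (Suc n) \<omega>)" if "\<omega> \<in> space M" for \<omega>
    using g[OF that] X_restrict[of n \<omega>] that step assms(1) by simp
  then show ?case by (rule step.prems)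
qed

lemma card_X: "1 \<le> n \<Longrightarrow> \<omega> \<in> space M \<Longrightarrow> 1 \<le> card (X n \<omega>) \<and> card (X n \<omega>) \<le> n"
  using partition_card_le[OF X_partition] partition_card_pos[OF X_partition] by simp

lemma finite_partitions: "finite {\<pi>. partition_on {1..n::nat} \<pi>}"
  by (rule finite_subset[of _ "Pow (Pow {1..n})"]) (auto simp: partition_on_def)

lemma borel_measurable_X:
  fixes F :: "nat set set \<Rightarrow> 'b::topological_space"
  shows "1 \<le> n \<Longrightarrow> (\<lambda>\<omega>. F (X n \<omega>)) \<in> borel_measurable M"
  by (rule measurable_compose[OF X_measurable]) auto

lemma X_event: "1 \<le> n \<Longrightarrow> {\<omega> \<in> space M. P (X n \<omega>)} \<in> events"
  using measurable_sets[OF borel_measurable_X[of n P], of "{True}"]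
  by (simp add: vimage_def Int_def conj_commute)

lemma integrable_X:
  fixes F :: "nat set set \<Rightarrow> 'b::{banach, second_countable_topology}"
  assumes "1 \<le> n"
  shows "integrable M (\<lambda>\<omega>. F (X n \<omega>))"
proof (rule integrable_const_bound[OF _ borel_measurable_X[OF assms]])
  have "norm (F (X n \<omega>)) \<le> Max ((\<lambda>\<pi>. norm (F \<pi>)) ` {\<pi>. partition_on {1..n} \<pi>})" if "\<omega> \<in> space M" for \<omega>
    using X_partition[OF assms that] finite_partitions by (intro Max_ge) auto
  then show "AE \<omega> in M. norm (F (X n \<omega>)) \<le> Max ((\<lambda>\<pi>. norm (F \<pi>)) ` {\<pi>. partition_on {1..n} \<pi>})"
    by simp
qed

text \<open>The hypothesis on conditional probabilities is silent on states of probability 0; there both sides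
vanish.\<close>

lemma prob_transition:
  assumes "1 \<le> n" "i \<le> card \<pi>"
  shows "\<P>(\<omega> in M. X n \<omega> = \<pi> \<and> X (n + 1) \<omega> = add_element n \<pi> i)
    = \<P>(\<omega> in M. X n \<omega> = \<pi>) * predictive \<alpha> \<mu> n \<pi> i"
proof (cases "\<P>(\<omega> in M. X n \<omega> = \<pi>) > 0")
  case True
  have "\<forall>n\<ge>1. \<forall>\<pi>. \<P>(\<omega> in M. X n \<omega> = \<pi>) > 0 \<longrightarrow>
        (\<forall>i\<le>card \<pi>. \<P>(\<omega> in M. X (n + 1) \<omega> = add_element n \<pi> i \<bar> X n \<omega> = \<pi>) = predictive \<alpha> \<mu> n \<pi> i)"
    using gibbs unfolding gibbs_partition_def by (elim conjE)
  then have "\<P>(\<omega> in M. X (n + 1) \<omega> = add_element n \<pi> i \<bar> X n \<omega> = \<pi>) = predictive \<alpha> \<mu> n \<pi> i"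
    using True assms by simp
  then show ?thesis using True by (simp add: cond_prob_def field_simps conj_commute)
next
  case False
  then have 0: "\<P>(\<omega> in M. X n \<omega> = \<pi>) = 0" by (simp add: zero_less_measure_iff)
  have "\<P>(\<omega> in M. X n \<omega> = \<pi> \<and> X (n + 1) \<omega> = add_element n \<pi> i) \<le> \<P>(\<omega> in M. X n \<omega> = \<pi>)"
    by (intro finite_measure_mono X_event assms) auto
  then show ?thesis using 0 by (simp add: measure_le_0_iff)
qed

text \<open>The Markov property in integrated form: both sides are finite sums over the states at time \<open>n\<close> and
the outcomes of one step, which are pairwise distinct by \<open>inj_on_add_element\<close>.\<close>

lemma expectation_step:
  fixes F :: "nat set set \<Rightarrow> 'b::{banach, second_countable_topology}"
  assumes n: "1 \<le> n"
  shows "(LINT \<omega>|M. G (X n \<omega>) *\<^sub>R F (X (Suc n) \<omega>)) = (LINT \<omega>|M. G (X n \<omega>) *\<^sub>R partition_step \<alpha> \<mu> n F (X n \<omega>))"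
proof -
  let ?P = "{\<pi>. partition_on {1..n} \<pi>}"
  let ?ev = "\<lambda>\<pi>. {\<omega> \<in> space M. X n \<omega> = \<pi>}"
  let ?ev2 = "\<lambda>\<pi> i. {\<omega> \<in> space M. X n \<omega> = \<pi> \<and> X (n + 1) \<omega> = add_element n \<pi> i}"
  have ev2: "?ev2 \<pi> i \<in> events" for \<pi> i
    using sets.Int[OF X_event[OF n, of "\<lambda>\<rho>. \<rho> = \<pi>"] X_event[of "n + 1" "\<lambda>\<rho>. \<rho> = add_element n \<pi> i"]]
    by (simp add: Int_def conj_ac)
  have integrable_ind: "integrable M (\<lambda>\<omega>. indicator E \<omega> *\<^sub>R c)" if "E \<in> events" for E and c :: 'b
    using that by (intro integrable_scaleR_left integrable_real_indicator) (simp_all add: emeasure_eq_measure)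
  have integral_ind: "(LINT \<omega>|M. indicator E \<omega> *\<^sub>R c) = prob E *\<^sub>R c" if "E \<in> events" for E and c :: 'b
    using that sets.sets_into_space[OF that]
    by (simp add: integral_scaleR_left integrable_real_indicator emeasure_eq_measure Int_absorb2)
  have int_single: "(LINT \<omega>|M. (\<Sum>\<pi>\<in>P. indicator (E \<pi>) \<omega> *\<^sub>R c \<pi>)) = (\<Sum>\<pi>\<in>P. prob (E \<pi>) *\<^sub>R c \<pi>)"
    if "\<And>\<pi>. E \<pi> \<in> events" for P :: "nat set set set" and E and c :: "nat set set \<Rightarrow> 'b"
    using that by (simp add: integrable_ind integral_ind)
  have int_double: "(LINT \<omega>|M. (\<Sum>\<pi>\<in>P. \<Sum>i=0..N \<pi>. indicator (E \<pi> i) \<omega> *\<^sub>R c \<pi> i))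
      = (\<Sum>\<pi>\<in>P. \<Sum>i=0..N \<pi>. prob (E \<pi> i) *\<^sub>R c \<pi> i)"
    if "\<And>\<pi> i. E \<pi> i \<in> events"
    for P :: "nat set set set" and N :: "nat set set \<Rightarrow> nat" and E and c :: "nat set set \<Rightarrow> nat \<Rightarrow> 'b"
  proof -
    have "(LINT \<omega>|M. (\<Sum>\<pi>\<in>P. \<Sum>i=0..N \<pi>. indicator (E \<pi> i) \<omega> *\<^sub>R c \<pi> i))
      = (\<Sum>\<pi>\<in>P. LINT \<omega>|M. (\<Sum>i=0..N \<pi>. indicator (E \<pi> i) \<omega> *\<^sub>R c \<pi> i))"
      by (intro Bochner_Integration.integral_sum Bochner_Integration.integrable_sum integrable_ind that)
    also have "\<dots> = (\<Sum>\<pi>\<in>P. \<Sum>i=0..N \<pi>. LINT \<omega>|M. indicator (E \<pi> i) \<omega> *\<^sub>R c \<pi> i)"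
      by (intro sum.cong refl Bochner_Integration.integral_sum integrable_ind that)
    finally show ?thesis by (simp only: integral_ind[OF that])
  qed
  have pw1: "G (X n \<omega>) *\<^sub>R F (X (Suc n) \<omega>)
      = (\<Sum>\<pi>\<in>?P. \<Sum>i=0..card \<pi>. indicator (?ev2 \<pi> i) \<omega> *\<^sub>R (G \<pi> *\<^sub>R F (add_element n \<pi> i)))"
    if \<omega>: "\<omega> \<in> space M" for \<omega>
  proof -
    obtain i where i: "i \<le> card (X n \<omega>)" "X (n + 1) \<omega> = add_element n (X n \<omega>) i"
      using X_extends[OF n \<omega>] by blast
    note part = X_partition[OF n \<omega>]
    have *: "indicator (?ev2 \<pi> j) \<omega> = (if \<pi> = X n \<omega> then if j = i then 1 else 0 else 0 :: real)"
      if "j \<in> {0..card \<pi>}" for \<pi> j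
      using that i \<omega> inj_onD[OF inj_on_add_element[OF part], of j i]
      by (auto simp: indicator_def)
    have sc: "(if P then 1 else 0 :: real) *\<^sub>R x = (if P then x else 0)" for P and x :: 'b
      by simp
    have "(\<Sum>\<pi>\<in>?P. \<Sum>j=0..card \<pi>. indicator (?ev2 \<pi> j) \<omega> *\<^sub>R (G \<pi> *\<^sub>R F (add_element n \<pi> j)))
       = (\<Sum>\<pi>\<in>?P. \<Sum>j=0..card \<pi>. (if \<pi> = X n \<omega> then if j = i then 1 else 0 else 0 :: real) *\<^sub>R (G \<pi> *\<^sub>R F (add_element n \<pi> j)))"
      by (intro sum.cong refl arg_cong2[where f = scaleR] *)
    also have "\<dots> = (\<Sum>\<pi>\<in>?P. if \<pi> = X n \<omega> then \<Sum>j=0..card \<pi>. if j = i then G \<pi> *\<^sub>R F (add_element n \<pi> j) else 0 else 0)"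
      by (intro sum.cong refl) (auto simp: sc simp del: scaleR_scaleR)
    also have "\<dots> = G (X n \<omega>) *\<^sub>R F (X (Suc n) \<omega>)"
      using finite_partitions[of n] part i by (simp add: sum.delta')
    finally show ?thesis ..
  qed
  have pw2: "G (X n \<omega>) *\<^sub>R partition_step \<alpha> \<mu> n F (X n \<omega>)
      = (\<Sum>\<pi>\<in>?P. indicator (?ev \<pi>) \<omega> *\<^sub>R (G \<pi> *\<^sub>R partition_step \<alpha> \<mu> n F \<pi>))"
    if \<omega>: "\<omega> \<in> space M" for \<omega>
  proof -
    have "(\<Sum>\<pi>\<in>?P. indicator (?ev \<pi>) \<omega> *\<^sub>R (G \<pi> *\<^sub>R partition_step \<alpha> \<mu> n F \<pi>))
       = (\<Sum>\<pi>\<in>?P. if \<pi> = X n \<omega> then G \<pi> *\<^sub>R partition_step \<alpha> \<mu> n F \<pi> else 0)"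
      using \<omega> by (intro sum.cong refl) (auto simp: indicator_def)
    then show ?thesis using finite_partitions[of n] X_partition[OF n \<omega>] by (simp add: sum.delta')
  qed
  have "(LINT \<omega>|M. G (X n \<omega>) *\<^sub>R F (X (Suc n) \<omega>))
      = (LINT \<omega>|M. (\<Sum>\<pi>\<in>?P. \<Sum>i=0..card \<pi>. indicator (?ev2 \<pi> i) \<omega> *\<^sub>R (G \<pi> *\<^sub>R F (add_element n \<pi> i))))"
    by (intro Bochner_Integration.integral_cong refl pw1)
  also have "\<dots> = (\<Sum>\<pi>\<in>?P. \<Sum>i=0..card \<pi>. (prob (?ev \<pi>) * predictive \<alpha> \<mu> n \<pi> i) *\<^sub>R (G \<pi> *\<^sub>R F (add_element n \<pi> i)))"
    unfolding int_double[of ?ev2, OF ev2]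
    by (intro sum.cong refl arg_cong2[where f = scaleR] prob_transition[OF n]) simp
  also have "\<dots> = (\<Sum>\<pi>\<in>?P. prob (?ev \<pi>) *\<^sub>R (G \<pi> *\<^sub>R partition_step \<alpha> \<mu> n F \<pi>))"
    by (simp add: partition_step_def scaleR_sum_right mult_ac)
  also have "\<dots> = (LINT \<omega>|M. (\<Sum>\<pi>\<in>?P. indicator (?ev \<pi>) \<omega> *\<^sub>R (G \<pi> *\<^sub>R partition_step \<alpha> \<mu> n F \<pi>)))"
    by (rule int_single[of ?ev, OF X_event[OF n], symmetric])
  also have "\<dots> = (LINT \<omega>|M. G (X n \<omega>) *\<^sub>R partition_step \<alpha> \<mu> n F (X n \<omega>))"
    by (intro Bochner_Integration.integral_cong refl pw2[symmetric])
  finally show ?thesis .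
qed

lemma expectation_step_le:
  fixes F B :: "nat set set \<Rightarrow> real"
  assumes n: "1 \<le> n"
    and step: "\<And>\<pi>. partition_on {1..n} \<pi> \<Longrightarrow> partition_step \<alpha> \<mu> n F \<pi> \<le> B \<pi>"
  shows "(LINT \<omega>|M. F (X (Suc n) \<omega>)) \<le> (LINT \<omega>|M. B (X n \<omega>))"
proof -
  have "(LINT \<omega>|M. F (X (Suc n) \<omega>)) = (LINT \<omega>|M. partition_step \<alpha> \<mu> n F (X n \<omega>))"
    using expectation_step[OF n, of "\<lambda>_. 1" F] by simp
  also have "\<dots> \<le> (LINT \<omega>|M. B (X n \<omega>))"
    using step X_partition[OF n] by (intro integral_mono integrable_X n) auto
  finally show ?thesis .
qed

end

section \<open>Laws of large numbers for block sizes and score\<close>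

lemmas card_new_block_Suc = card_new_block[unfolded Suc_eq_plus1[symmetric]]
lemmas block_sum_new_block_Suc = block_sum_new_block[unfolded Suc_eq_plus1[symmetric]]

context gibbs_mixture
begin

lemma sum_join_prob:
  assumes "partition_on {1..n} \<pi>" "1 \<le> n"
  shows "(\<Sum>U\<in>\<pi>. join_rate n (card \<pi>) * (real (card U) - \<alpha>)) = 1 - new_prob n (card \<pi>)"
  using block_sum_size_minus[OF assms(1), of \<alpha>] new_prob_eq[OF assms(2) partition_card_pos[OF assms]]
  by (simp add: block_sum_def flip: sum_distrib_left)

lemma block_size_minus_pos: "partition_on {1..n::nat} \<pi> \<Longrightarrow> U \<in> \<pi> \<Longrightarrow> 1 - \<alpha> \<le> real (card U) - \<alpha> \<and> 0 < real (card U) - \<alpha>"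
  using partition_block(5)[of n \<pi> U] \<alpha> by auto

lemma partition_step_card:
  fixes f :: "nat \<Rightarrow> real"
  assumes "partition_on {1..n} \<pi>" "1 \<le> n"
  shows "partition_step \<alpha> \<mu> n (\<lambda>\<pi>. f (card \<pi>)) \<pi>
     = new_prob n (card \<pi>) * f (card \<pi> + 1) + (1 - new_prob n (card \<pi>)) * f (card \<pi>)"
  by (simp add: partition_step_eq[OF assms(1)] card_new_block_Suc[OF assms(1)]
      card_join_block[OF assms(1)] sum_join_prob[OF assms] flip: sum_distrib_right)

text \<open>A new block, of probability at least \<open>growth_const k / n\<close>, multiplies \<open>1 / k\<close> by \<open>k / (k + 1)\<close>, that is
by at most \<open>1 - 1 / (2 k)\<close>.\<close>

lemma partition_step_inverse_card:
  assumes "partition_on {1..n} \<pi>" "1 \<le> n"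
  shows "partition_step \<alpha> \<mu> n (\<lambda>\<pi>. 1 / real (card \<pi>)) \<pi> \<le> (1 - growth_const / 2 / real n) * (1 / real (card \<pi>))"
proof -
  let ?k = "real (card \<pi>)" and ?p = "new_prob n (card \<pi>)"
  have k: "1 \<le> card \<pi>" "card \<pi> \<le> n" using partition_card_pos partition_card_le assms by auto
  have "growth_const / 2 / real n = growth_const * ?k / real n * (1 / (?k + ?k))"
    using k by simp
  also have "\<dots> \<le> growth_const * ?k / real n * (1 / (?k + 1))"
    using k growth_const_pos by (intro mult_left_mono divide_left_mono mult_pos_pos) auto
  also have "\<dots> \<le> ?p * (1 / (?k + 1))"
    using new_prob_ge[OF k] by (intro mult_right_mono) auto
  finally have "growth_const / 2 / real n * (1 / ?k) \<le> ?p * (1 / (?k + 1)) * (1 / ?k)"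
    by (intro mult_right_mono) auto
  also have "?p * (1 / (?k + 1)) * (1 / ?k) = 1 / ?k - (?p * (1 / (?k + 1)) + (1 - ?p) * (1 / ?k))"
    using k by (simp add: divide_simps) (simp add: algebra_simps)
  finally show ?thesis
    using partition_step_card[OF assms, of "\<lambda>k. 1 / real k"] by (simp add: algebra_simps)
qed

definition share :: "nat \<Rightarrow> nat set set \<Rightarrow> real" where
  "share j \<pi> = block_sum (\<lambda>l. of_bool (l = j)) \<pi> / real (card \<pi>)"

text \<open>The extension by 0 to size 0 makes the balance equation uniform in \<open>j\<close>: new blocks enter as an
inhomogeneity at \<open>j = 0\<close>.\<close>

definition sibuya0 :: "nat \<Rightarrow> real" where
  "sibuya0 j = (if j = 0 then 0 else sibuya_prob \<alpha> j)"

definition share_error :: "nat \<Rightarrow> nat set set \<Rightarrow> real" where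
  "share_error j \<pi> = share j \<pi> - sibuya0 j"

lemma sibuya0_recursion: "real (Suc j) * sibuya0 (Suc j) = \<alpha> * of_bool (j = 0) + (real j - \<alpha>) * sibuya0 j"
proof (cases j)
  case 0
  then show ?thesis by (simp add: sibuya0_def sibuya_prob_Suc)
next
  case (Suc i)
  then show ?thesis using sibuya_prob_recursion[of i \<alpha>] by (simp add: sibuya0_def del: of_nat_Suc)
qed

lemma sibuya0_bounds: "0 \<le> sibuya0 j" "sibuya0 j \<le> 1"
proof -
  have "0 \<le> sibuya0 j \<and> sibuya0 j \<le> 1"
  proof (cases j)
    case (Suc i)
    have "sibuya_prob \<alpha> (Suc i) \<le> sibuya_tail \<alpha> i"
      using sibuya_tail_pos[OF \<alpha>, of "Suc i"] by (simp add: sibuya_prob_eq_tail_diff)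
    then show ?thesis
      using Suc sibuya_prob_pos[OF \<alpha>, of i] sibuya_tail_le_1[OF \<alpha>, of i] by (simp add: sibuya0_def)
  qed (simp add: sibuya0_def)
  then show "0 \<le> sibuya0 j" "sibuya0 j \<le> 1" by auto
qed

lemma share_bounds: "0 \<le> share j \<pi>" "share j \<pi> \<le> 1"
proof -
  show "0 \<le> share j \<pi>" by (auto simp: share_def block_sum_def intro!: divide_nonneg_nonneg sum_nonneg)
  have "block_sum (\<lambda>l. of_bool (l = j)) \<pi> \<le> (\<Sum>U\<in>\<pi>. 1)"
    unfolding block_sum_def by (intro sum_mono) auto
  then show "share j \<pi> \<le> 1" by (auto simp: share_def divide_le_eq_1)
qed

lemma share_error_le_1: "\<bar>share_error j \<pi>\<bar> \<le> 1"
  using share_bounds[of j \<pi>] sibuya0_bounds[of j] by (simp add: share_error_def)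

lemma share_0: "partition_on {1..n::nat} \<pi> \<Longrightarrow> share 0 \<pi> = 0"
  using partition_block(5)[of n \<pi>] by (force simp: share_def block_sum_def intro!: sum.neutral)

lemma sum_of_bool_share:
  assumes "partition_on {1..n} \<pi>" "1 \<le> n"
  shows "(\<Sum>U\<in>\<pi>. (real (card U) - \<alpha>) * of_bool (card U = j)) = (real j - \<alpha>) * (real (card \<pi>) * share j \<pi>)"
proof -
  have "(\<Sum>U\<in>\<pi>. (real (card U) - \<alpha>) * of_bool (card U = j)) = (\<Sum>U\<in>\<pi>. (real j - \<alpha>) * of_bool (card U = j))"
    by (intro sum.cong) auto
  then show ?thesis
    using partition_card_pos[OF assms] by (simp add: share_def block_sum_def flip: sum_distrib_left)
qed

definition share_const :: "nat \<Rightarrow> real" where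
  "share_const j = 2 * (rate_const + 1 + rate_const * real j) + 2 * rate_const + 2 * real j * rate_const"

text \<open>To first order the proportion \<open>r j\<close> of blocks of size \<open>j\<close> moves by
\<open>(\<alpha> of_bool (j = 1) - j r j + (j - 1 - \<alpha>) r (j - 1)) / n\<close> in one step. Subtracting the balance equation
for the Sibuya probabilities shows that the deviation at \<open>j\<close> is damped at rate \<open>j / n\<close> and driven only
by the deviation at \<open>j - 1\<close>; the remaining terms are of order \<open>1 / (k n)\<close>.\<close>

lemma partition_step_share_error:
  assumes part: "partition_on {1..n} \<pi>" and n: "1 \<le> n"
  shows "partition_step \<alpha> \<mu> n (\<lambda>\<pi>. (share_error (Suc j) \<pi>)\<^sup>2) \<pi>
     \<le> (1 - 2 * real (Suc j) / real n) * (share_error (Suc j) \<pi>)\<^sup>2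
       + (2 * real (Suc j) * \<bar>share_error j \<pi>\<bar> + share_const (Suc j) / real (card \<pi>)) / real n"
proof -
  define k p c m where "k = real (card \<pi>)" and "p = new_prob n (card \<pi>)" and "c = join_rate n (card \<pi>)" and "m = real n"
  define r r' w w' where "r = share (Suc j) \<pi>" and "r' = share j \<pi>" and "w = share_error (Suc j) \<pi>" and "w' = share_error j \<pi>"
  define \<delta> :: real where "\<delta> = of_bool (j = 0)"
  define R where "R = rate_const"
  define J where "J = real (Suc j)"
  have kn: "1 \<le> card \<pi>" "card \<pi> \<le> n" using partition_card_pos partition_card_le assms by auto
  have k: "1 \<le> k" "k \<le> m" "0 < k" "0 < m" using kn by (auto simp: k_def m_def)
  have R: "1 \<le> R" using rate_const_ge by (simp add: R_def)
  have J: "1 \<le> J" by (simp add: J_def)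
  have p: "\<bar>p - \<alpha> * k / m\<bar> \<le> R / m" "p \<le> 2 * R * k / m" "0 \<le> p"
    using new_prob_approx[OF kn] new_prob_le[OF kn] new_prob_nonneg by (simp_all add: p_def k_def m_def R_def)
  have c: "\<bar>c - 1 / m\<bar> \<le> R / 2 / m\<^sup>2" "0 < c" "c \<le> R / m"
    using join_rate_approx[OF n] join_rate_pos[OF n] join_rate_le[OF n] by (simp_all add: c_def m_def R_def)
  have r: "0 \<le> r" "r \<le> 1" "0 \<le> r'" "r' \<le> 1" using share_bounds by (simp_all add: r_def r'_def)
  have w: "\<bar>w\<bar> \<le> 1" using share_error_le_1 by (simp add: w_def)
  have wr: "w = r - sibuya0 (Suc j)" "w' = r' - sibuya0 j"
    by (simp_all add: w_def w'_def r_def r'_def share_error_def)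
  \<comment> \<open>\<open>e U / k\<close> is the change of the proportion when \<open>U\<close> grows.\<close>
  define e :: "nat set \<Rightarrow> real" where "e U = of_bool (card U = j) - of_bool (card U = Suc j)" for U
  define q where "q U = c * (real (card U) - \<alpha>)" for U :: "nat set"
  have q_sum: "(\<Sum>U\<in>\<pi>. q U) = 1 - p" using sum_join_prob[OF assms] by (simp add: q_def c_def p_def)
  have qe: "(\<Sum>U\<in>\<pi>. q U * e U) = c * k * ((real j - \<alpha>) * r' - (J - \<alpha>) * r)"
  proof -
    have "(\<Sum>U\<in>\<pi>. q U * e U) = c * ((\<Sum>U\<in>\<pi>. (real (card U) - \<alpha>) * of_bool (card U = j))
        - (\<Sum>U\<in>\<pi>. (real (card U) - \<alpha>) * of_bool (card U = Suc j)))"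
      unfolding q_def e_def sum_distrib_left right_diff_distrib[of c] sum_subtractf[symmetric]
      by (intro sum.cong) (simp_all add: algebra_simps)
    then show ?thesis
      unfolding sum_of_bool_share[OF assms] by (simp add: k_def r_def r'_def J_def algebra_simps)
  qed
  have qe2: "(\<Sum>U\<in>\<pi>. q U * (e U)\<^sup>2) \<le> 2 * J * R * k / m"
  proof -
    have "(\<Sum>U\<in>\<pi>. q U * (e U)\<^sup>2) = c * ((\<Sum>U\<in>\<pi>. (real (card U) - \<alpha>) * of_bool (card U = j))
        + (\<Sum>U\<in>\<pi>. (real (card U) - \<alpha>) * of_bool (card U = Suc j)))"
      unfolding sum.distrib[symmetric] sum_distrib_left
      by (intro sum.cong) (auto simp: q_def e_def)
    also have "\<dots> = c * k * ((real j - \<alpha>) * r' + (J - \<alpha>) * r)"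
      unfolding sum_of_bool_share[OF assms] by (simp add: k_def r_def r'_def J_def algebra_simps)
    also have "\<dots> \<le> (R / m) * k * (J * 1 + J * 1)"
    proof (rule mult_mono)
      show "c * k \<le> R / m * k" using c k by (intro mult_right_mono) auto
      have a: "(real j - \<alpha>) * r' \<le> J * 1"
      proof (cases "j = 0")
        case False
        then show ?thesis using \<alpha> r by (intro mult_mono) (auto simp: J_def)
      qed (use share_0[OF part] in \<open>simp add: r'_def J_def\<close>)
      have b: "(J - \<alpha>) * r \<le> J * 1" using \<alpha> r J by (intro mult_mono) auto
      show "(real j - \<alpha>) * r' + (J - \<alpha>) * r \<le> J * 1 + J * 1" using a b by (rule add_mono)
      have "0 \<le> (real j - \<alpha>) * r'"
        using \<alpha> r share_0[OF part] by (cases "j = 0") (auto simp: r'_def)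
      moreover have "0 \<le> (J - \<alpha>) * r" using \<alpha> r J by simp
      ultimately show "0 \<le> (real j - \<alpha>) * r' + (J - \<alpha>) * r" by simp
    qed (use R k in auto)
    finally show ?thesis by (simp add: mult_ac)
  qed
  have new: "share_error (Suc j) (insert {n + 1} \<pi>) = w + (\<delta> - r) / (k + 1)"
  proof -
    have "k * share (Suc j) \<pi> = block_sum (\<lambda>l. of_bool (l = Suc j)) \<pi>"
      using k by (simp add: share_def k_def)
    then have "share (Suc j) (insert {n + 1} \<pi>) = (k * r + \<delta>) / (k + 1)"
      by (simp add: share_def[of _ "insert {Suc n} \<pi>"] add.commute block_sum_new_block_Suc[OF part]
          card_new_block_Suc[OF part] r_def k_def \<delta>_def)
    also have "\<dots> = r + (\<delta> - r) / (k + 1)" using k by (simp add: field_simps)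
    finally show ?thesis by (simp add: share_error_def w_def r_def)
  qed
  have join: "share_error (Suc j) (join_block n \<pi> U) = w + e U / k" if "U \<in> \<pi>" for U
  proof -
    have "share (Suc j) (join_block n \<pi> U) = r + e U / k"
      using block_sum_join_block[OF part that, of "\<lambda>l. of_bool (l = Suc j)"] card_join_block[OF part that]
      by (simp add: share_def r_def k_def e_def add_divide_distrib)
    then show ?thesis by (simp add: share_error_def w_def r_def)
  qed
  have step: "partition_step \<alpha> \<mu> n (\<lambda>\<pi>. (share_error (Suc j) \<pi>)\<^sup>2) \<pi>
      = p * (w + (\<delta> - r) / (k + 1))\<^sup>2 + (\<Sum>U\<in>\<pi>. q U * (w + e U / k)\<^sup>2)"
    unfolding partition_step_eq[OF part] new by (simp add: p_def q_def c_def join)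
  also have "(\<Sum>U\<in>\<pi>. q U * (w + e U / k)\<^sup>2)
      = (\<Sum>U\<in>\<pi>. q U) * w\<^sup>2 + 2 * w / k * (\<Sum>U\<in>\<pi>. q U * e U) + (\<Sum>U\<in>\<pi>. q U * (e U)\<^sup>2) / k\<^sup>2"
    unfolding sum_distrib_left sum_distrib_right sum_divide_distrib sum.distrib[symmetric]
    by (intro sum.cong) (simp_all add: power2_sum power_divide algebra_simps)
  also have "\<dots> = (1 - p) * w\<^sup>2 + 2 * w * (c * ((real j - \<alpha>) * r' - (J - \<alpha>) * r)) + (\<Sum>U\<in>\<pi>. q U * (e U)\<^sup>2) / k\<^sup>2"
    using k unfolding q_sum qe by (simp add: mult_ac)
  also have "p * (w + (\<delta> - r) / (k + 1))\<^sup>2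
      = p * w\<^sup>2 + 2 * w * (p / (k + 1) * (\<delta> - r)) + p * ((\<delta> - r) / (k + 1))\<^sup>2"
    by (simp add: power2_sum algebra_simps)
  finally have eq: "partition_step \<alpha> \<mu> n (\<lambda>\<pi>. (share_error (Suc j) \<pi>)\<^sup>2) \<pi>
      = w\<^sup>2 + 2 * w * (p / (k + 1) * (\<delta> - r) + c * ((real j - \<alpha>) * r' - (J - \<alpha>) * r))
        + (p * ((\<delta> - r) / (k + 1))\<^sup>2 + (\<Sum>U\<in>\<pi>. q U * (e U)\<^sup>2) / k\<^sup>2)"
    by (simp add: algebra_simps)
  have d: "\<bar>\<delta> - r\<bar> \<le> 1" using r by (auto simp: \<delta>_def)
  have sq: "p * ((\<delta> - r) / (k + 1))\<^sup>2 + (\<Sum>U\<in>\<pi>. q U * (e U)\<^sup>2) / k\<^sup>2 \<le> (2 * R + 2 * J * R) / k / m"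
  proof -
    have "((\<delta> - r) / (k + 1))\<^sup>2 = \<bar>(\<delta> - r) / (k + 1)\<bar>\<^sup>2" by (simp only: power2_abs)
    also have "\<dots> \<le> (1 / k)\<^sup>2"
      using d k by (intro power_mono) (auto simp: abs_divide intro!: frac_le)
    finally have "p * ((\<delta> - r) / (k + 1))\<^sup>2 \<le> (2 * R * k / m) * (1 / k)\<^sup>2"
      using p k by (intro mult_mono) auto
    moreover have "(\<Sum>U\<in>\<pi>. q U * (e U)\<^sup>2) / k\<^sup>2 \<le> (2 * J * R * k / m) / k\<^sup>2"
      using qe2 by (intro divide_right_mono) auto
    moreover have "(2 * R * k / m) * (1 / k)\<^sup>2 + (2 * J * R * k / m) / k\<^sup>2 = (2 * R + 2 * J * R) / k / m"
      using k by (simp add: power2_eq_square field_simps)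
    ultimately show ?thesis by linarith
  qed
  have drift: "\<bar>p / (k + 1) * (\<delta> - r) + c * ((real j - \<alpha>) * r' - (J - \<alpha>) * r) - (- J * w + (real j - \<alpha>) * w') / m\<bar>
      \<le> (R + 1 + R * J) / k / m"
  proof -
    \<comment> \<open>the balance equation turns the drift of the proportion into a drift of the deviation\<close>
    have h: "- J * w + (real j - \<alpha>) * w' = \<alpha> * (\<delta> - r) + ((real j - \<alpha>) * r' - (J - \<alpha>) * r)"
      using sibuya0_recursion[of j] unfolding wr \<delta>_def J_def by (simp add: algebra_simps)
    have *: "p / (k + 1) * (\<delta> - r) + c * ((real j - \<alpha>) * r' - (J - \<alpha>) * r) - (- J * w + (real j - \<alpha>) * w') / m
       = (p / (k + 1) - \<alpha> / m) * (\<delta> - r) + (c - 1 / m) * ((real j - \<alpha>) * r' - (J - \<alpha>) * r)"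
      unfolding h by (simp add: algebra_simps add_divide_distrib diff_divide_distrib)
    have "p / (k + 1) - \<alpha> / m = ((p - \<alpha> * k / m) - \<alpha> / m) / (k + 1)"
    proof -
      have "(p - \<alpha> * k / m) - \<alpha> / m = p - \<alpha> / m * (k + 1)"
        by (simp add: algebra_simps add_divide_distrib)
      then have "((p - \<alpha> * k / m) - \<alpha> / m) / (k + 1) = (p - \<alpha> / m * (k + 1)) / (k + 1)"
        by (simp only:)
      also have "\<dots> = p / (k + 1) - \<alpha> / m" using k by (simp add: diff_divide_distrib)
      finally show ?thesis by simp
    qed
    then have "\<bar>p / (k + 1) - \<alpha> / m\<bar> = \<bar>(p - \<alpha> * k / m) - \<alpha> / m\<bar> / (k + 1)" using k by (simp add: abs_divide)
    also have "\<dots> \<le> (R / m + 1 / m) / (k + 1)"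
    proof (rule divide_right_mono)
      have "\<bar>\<alpha> / m\<bar> \<le> 1 / m" using \<alpha> k by (simp add: abs_divide divide_right_mono)
      then show "\<bar>(p - \<alpha> * k / m) - \<alpha> / m\<bar> \<le> R / m + 1 / m" using p(1) by linarith
    qed (use k in simp)
    also have "\<dots> \<le> (R / m + 1 / m) / k" using k R by (intro divide_left_mono) auto
    finally have 1: "\<bar>p / (k + 1) - \<alpha> / m\<bar> \<le> (R + 1) / k / m" by (simp add: add_divide_distrib mult.commute)
    have a: "\<bar>(real j - \<alpha>) * r'\<bar> \<le> J * 1"
      using \<alpha> r unfolding abs_mult by (intro mult_mono) (auto simp: J_def)
    have b: "\<bar>(J - \<alpha>) * r\<bar> \<le> J * 1"
      using \<alpha> r J unfolding abs_mult by (intro mult_mono) auto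
    have "\<bar>(c - 1 / m) * ((real j - \<alpha>) * r' - (J - \<alpha>) * r)\<bar> \<le> (R / 2 / m\<^sup>2) * (2 * J)"
      unfolding abs_mult using c a b R by (intro mult_mono) auto
    also have "\<dots> = R * J / m / m" by (simp add: power2_eq_square)
    also have "\<dots> \<le> R * J / k / m" using k R J by (intro divide_right_mono divide_left_mono) auto
    finally have 2: "\<bar>(c - 1 / m) * ((real j - \<alpha>) * r' - (J - \<alpha>) * r)\<bar> \<le> R * J / k / m" .
    have 3: "\<bar>(p / (k + 1) - \<alpha> / m) * (\<delta> - r)\<bar> \<le> (R + 1) / k / m * 1"
      unfolding abs_mult using 1 d R k by (intro mult_mono) auto
    show ?thesis unfolding * using 2 3 by (simp add: add_divide_distrib)
  qed
  have "2 * w * (p / (k + 1) * (\<delta> - r) + c * ((real j - \<alpha>) * r' - (J - \<alpha>) * r))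
      \<le> 2 * w * ((- J * w + (real j - \<alpha>) * w') / m) + 2 * ((R + 1 + R * J) / k / m)"
  proof -
    define x y b where "x = p / (k + 1) * (\<delta> - r) + c * ((real j - \<alpha>) * r' - (J - \<alpha>) * r)"
      and "y = (- J * w + (real j - \<alpha>) * w') / m" and "b = (R + 1 + R * J) / k / m"
    have "\<bar>x - y\<bar> \<le> b" using drift by (simp add: x_def y_def b_def)
    then have "\<bar>w * (x - y)\<bar> \<le> 1 * b" unfolding abs_mult using w by (intro mult_mono) auto
    then have "w * x \<le> w * y + b" by (simp add: right_diff_distrib)
    then have "2 * w * x \<le> 2 * w * y + 2 * b" by simp
    then show ?thesis by (simp only: x_def y_def b_def)
  qed
  also have "2 * w * ((- J * w + (real j - \<alpha>) * w') / m) = - (2 * J / m) * w\<^sup>2 + 2 * (w * ((real j - \<alpha>) * w')) / m"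
    by (simp add: power2_eq_square algebra_simps add_divide_distrib diff_divide_distrib)
  also have "2 * (w * ((real j - \<alpha>) * w')) / m \<le> 2 * (1 * (J * \<bar>w'\<bar>)) / m"
  proof -
    have "\<bar>w * ((real j - \<alpha>) * w')\<bar> \<le> 1 * (J * \<bar>w'\<bar>)"
      unfolding abs_mult using w \<alpha> by (intro mult_mono) (auto simp: J_def)
    then show ?thesis using k by (intro divide_right_mono mult_left_mono) auto
  qed
  finally have "2 * w * (p / (k + 1) * (\<delta> - r) + c * ((real j - \<alpha>) * r' - (J - \<alpha>) * r))
    \<le> - (2 * J / m) * w\<^sup>2 + 2 * (1 * (J * \<bar>w'\<bar>)) / m + 2 * ((R + 1 + R * J) / k / m)" by simp
  then have "partition_step \<alpha> \<mu> n (\<lambda>\<pi>. (share_error (Suc j) \<pi>)\<^sup>2) \<pi>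
     \<le> w\<^sup>2 + (- (2 * J / m) * w\<^sup>2 + 2 * (1 * (J * \<bar>w'\<bar>)) / m + 2 * ((R + 1 + R * J) / k / m)) + (2 * R + 2 * J * R) / k / m"
    unfolding eq using sq by linarith
  also have "\<dots> = (1 - 2 * J / m) * w\<^sup>2 + (2 * J * \<bar>w'\<bar> + share_const (Suc j) / k) / m"
  proof -
    have sc: "share_const (Suc j) = 2 * (R + 1 + R * J) + 2 * R + 2 * J * R"
      by (simp only: share_const_def R_def J_def)
    show ?thesis unfolding sc using k by (simp add: field_simps)
  qed
  finally show ?thesis by (simp only: J_def m_def w_def w'_def k_def)
qed

end

context gibbs_mixture
begin

text \<open>The derivative at \<open>\<alpha>\<close> of the log likelihood of the partition for \<open>\<theta> = 0\<close>.\<close>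

definition score :: "nat set set \<Rightarrow> real" where
  "score \<pi> = (real (card \<pi>) - 1) / \<alpha> - block_sum (sibuya_harm \<alpha>) \<pi>"

text \<open>Blocks \<open>U\<close> grow with probability close to \<open>(card U - \<alpha>) / n\<close> and then change the score by
\<open>- 1 / (card U - \<alpha>)\<close>; hence \<open>inverse_sizes \<pi> / n\<close> is their share in the variance of one step.\<close>

definition inverse_sizes :: "nat set set \<Rightarrow> real" where
  "inverse_sizes \<pi> = block_sum (\<lambda>j. 1 / (real j - \<alpha>)) \<pi>"

lemma score_new_block:
  assumes "partition_on {1..n} \<pi>"
  shows "score (insert {n + 1} \<pi>) = score \<pi> + 1 / \<alpha>"
  unfolding score_def card_new_block[OF assms] block_sum_new_block[OF assms]
  by (simp add: diff_divide_distrib add_divide_distrib)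

lemma score_join_block:
  assumes "partition_on {1..n} \<pi>" "U \<in> \<pi>"
  shows "score (join_block n \<pi> U) = score \<pi> - 1 / (real (card U) - \<alpha>)"
  unfolding score_def card_join_block[OF assms] block_sum_join_block[OF assms]
  using partition_block(5)[OF assms] by (simp add: sibuya_harm_Suc)

lemma inverse_sizes_bounds:
  assumes "partition_on {1..n} \<pi>"
  shows "0 \<le> inverse_sizes \<pi>" "inverse_sizes \<pi> \<le> real (card \<pi>) / (1 - \<alpha>)"
proof -
  show "0 \<le> inverse_sizes \<pi>"
    unfolding inverse_sizes_def block_sum_def using block_size_minus_pos[OF assms]
    by (intro sum_nonneg) (simp add: less_imp_le)
  have "inverse_sizes \<pi> \<le> (\<Sum>U\<in>\<pi>. 1 / (1 - \<alpha>))"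
    unfolding inverse_sizes_def block_sum_def
    using block_size_minus_pos[OF assms] \<alpha> by (intro sum_mono frac_le) auto
  then show "inverse_sizes \<pi> \<le> real (card \<pi>) / (1 - \<alpha>)" by simp
qed

definition score_const :: real where
  "score_const = 4 * (rate_const / \<alpha> + 2 + rate_const)\<^sup>2 / growth_const
     + 2 * rate_const / \<alpha>\<^sup>2 + rate_const / (1 - \<alpha>)"

text \<open>In the expected change of \<open>S\<^sup>2 h k\<close> the terms linear in \<open>S\<close> cancel to first order. What remains is the
decrease of the weight \<open>h\<close> when a block is opened, which yields the factor \<open>1 - growth_const / (4 n)\<close>,
and the variance of one step, of order \<open>k h k / n\<close>. The hypotheses on \<open>h\<close> hold for \<open>1 / k\<close> and
\<open>1 / k\<^sup>2\<close>.\<close>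

lemma partition_step_score:
  fixes h :: "nat \<Rightarrow> real"
  assumes part: "partition_on {1..n} \<pi>" and n: "1 \<le> n"
    and h: "0 < h (card \<pi> + 1)" "h (card \<pi> + 1) \<le> h (card \<pi>)"
      "h (card \<pi>) / (2 * real (card \<pi>)) \<le> h (card \<pi>) - h (card \<pi> + 1)"
      "real (card \<pi>) * (h (card \<pi>) - h (card \<pi> + 1)) \<le> 2 * h (card \<pi>)"
  shows "partition_step \<alpha> \<mu> n (\<lambda>\<pi>. (score \<pi>)\<^sup>2 * h (card \<pi>)) \<pi>
     \<le> (1 - growth_const / 4 / real n) * ((score \<pi>)\<^sup>2 * h (card \<pi>))
       + score_const * (real (card \<pi>) * h (card \<pi>)) / real n"
proof -
  define k p c m where "k = real (card \<pi>)" and "p = new_prob n (card \<pi>)" and "c = join_rate n (card \<pi>)" and "m = real n"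
  define s w w' Q where "s = score \<pi>" and "w = h (card \<pi>)" and "w' = h (card \<pi> + 1)" and "Q = inverse_sizes \<pi>"
  define R g where "R = rate_const" and "g = growth_const"
  have kn: "1 \<le> card \<pi>" "card \<pi> \<le> n" using partition_card_pos partition_card_le assms by auto
  have k: "1 \<le> k" "k \<le> m" "0 < k" "0 < m" using kn by (auto simp: k_def m_def)
  have R: "1 \<le> R" using rate_const_ge by (simp add: R_def)
  have g: "0 < g" using growth_const_pos by (simp add: g_def)
  have p: "\<bar>p - \<alpha> * k / m\<bar> \<le> R / m" "p \<le> 2 * R * k / m" "0 \<le> p" "g * k / m \<le> p"
    using new_prob_approx[OF kn] new_prob_le[OF kn] new_prob_ge[OF kn] new_prob_nonneg
    by (simp_all add: p_def k_def m_def R_def g_def)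
  have c: "\<bar>c - 1 / m\<bar> \<le> R / 2 / m\<^sup>2" "0 < c" "c \<le> R / m"
    using join_rate_approx[OF n] join_rate_pos[OF n] join_rate_le[OF n] by (simp_all add: c_def m_def R_def)
  have w: "0 < w'" "w' \<le> w" "w / (2 * k) \<le> w - w'" "k * (w - w') \<le> 2 * w" "0 < w"
    using h by (simp_all add: w_def w'_def k_def)
  have Q: "0 \<le> Q" "Q \<le> k / (1 - \<alpha>)" using inverse_sizes_bounds[OF part] by (simp_all add: Q_def k_def)
  define q where "q U = c * (real (card U) - \<alpha>)" for U :: "nat set"
  define d where "d U = real (card U) - \<alpha>" for U :: "nat set"
  have q_sum: "(\<Sum>U\<in>\<pi>. q U) = 1 - p" using sum_join_prob[OF assms(1,2)] by (simp add: q_def c_def p_def)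
  have d: "0 < d U" if "U \<in> \<pi>" for U using block_size_minus_pos[OF part that] by (simp add: d_def)
  have "(\<Sum>U\<in>\<pi>. q U * ((s - 1 / d U)\<^sup>2 * w)) = (\<Sum>U\<in>\<pi>. q U * s\<^sup>2 * w - 2 * c * s * w + c * w * (1 / d U))"
  proof (intro sum.cong refl)
    fix U assume "U \<in> \<pi>"
    then have "d U \<noteq> 0" "q U = c * d U" using d by (auto simp: q_def d_def)
    then show "q U * ((s - 1 / d U)\<^sup>2 * w) = q U * s\<^sup>2 * w - 2 * c * s * w + c * w * (1 / d U)"
      by (simp add: power2_eq_square field_simps)
  qed
  also have "\<dots> = (1 - p) * s\<^sup>2 * w - 2 * c * s * w * k + c * w * Q"
    by (simp add: sum.distrib sum_subtractf q_sum[symmetric] sum_distrib_right sum_distrib_left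
        Q_def inverse_sizes_def block_sum_def d_def k_def mult_ac)
  finally have sumq: "(\<Sum>U\<in>\<pi>. q U * ((s - 1 / d U)\<^sup>2 * w)) = (1 - p) * s\<^sup>2 * w - 2 * c * s * w * k + c * w * Q" .
  have "partition_step \<alpha> \<mu> n (\<lambda>\<pi>. (score \<pi>)\<^sup>2 * h (card \<pi>)) \<pi>
     = p * ((s + 1 / \<alpha>)\<^sup>2 * w') + (\<Sum>U\<in>\<pi>. q U * ((s - 1 / d U)\<^sup>2 * w))"
    unfolding partition_step_eq[OF part] score_new_block[OF part] card_new_block[OF part]
    by (simp add: score_join_block[OF part] card_join_block[OF part] p_def q_def c_def s_def w_def w'_def d_def)
  also have "\<dots> = s\<^sup>2 * w - p * s\<^sup>2 * (w - w') + 2 * s * (p * w' / \<alpha> - c * k * w) + (p * w' / \<alpha>\<^sup>2 + c * w * Q)"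
    unfolding sumq by (simp add: power2_sum power_divide algebra_simps)
  finally have eq: "partition_step \<alpha> \<mu> n (\<lambda>\<pi>. (score \<pi>)\<^sup>2 * h (card \<pi>)) \<pi>
    = s\<^sup>2 * w - p * s\<^sup>2 * (w - w') + 2 * s * (p * w' / \<alpha> - c * k * w) + (p * w' / \<alpha>\<^sup>2 + c * w * Q)" .
  have t1: "g / 2 / m * (s\<^sup>2 * w) \<le> p * s\<^sup>2 * (w - w')"
  proof -
    have "g / 2 / m * (s\<^sup>2 * w) = (g * k / m) * s\<^sup>2 * (w / (2 * k))" using k by simp
    also have "\<dots> \<le> p * s\<^sup>2 * (w - w')" using p w g k by (intro mult_mono) auto
    finally show ?thesis .
  qed
  define C1 where "C1 = R / \<alpha> + 2 + R"
  have C1: "0 \<le> C1" using R \<alpha> by (simp add: C1_def)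
  have B: "\<bar>p * w' / \<alpha> - c * k * w\<bar> \<le> w * C1 / m"
  proof -
    have "p * w' / \<alpha> - c * k * w = w' / \<alpha> * (p - \<alpha> * k / m) - k * (w - w') / m - k * w * (c - 1 / m)"
    proof -
      have "w' / \<alpha> * (p - \<alpha> * k / m) = p * w' / \<alpha> - k * w' / m" using \<alpha> by (simp add: field_simps)
      then show ?thesis using \<alpha> by (simp add: algebra_simps diff_divide_distrib)
    qed
    moreover have "\<bar>w' / \<alpha> * (p - \<alpha> * k / m)\<bar> \<le> w / \<alpha> * (R / m)"
      unfolding abs_mult using w \<alpha> p R k by (intro mult_mono) (auto intro!: divide_right_mono)
    moreover have "\<bar>k * (w - w') / m\<bar> \<le> 2 * w / m"
      using w k by (simp add: abs_mult abs_divide divide_right_mono)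
    moreover have "\<bar>k * w * (c - 1 / m)\<bar> \<le> w * R / m"
    proof -
      have "\<bar>k * w * (c - 1 / m)\<bar> \<le> (m * w) * (R / 2 / m\<^sup>2)"
        unfolding abs_mult[of "k * w"] using w k c by (intro mult_mono) auto
      also have "\<dots> \<le> w * R / m" using w R k by (simp add: power2_eq_square field_simps)
      finally show ?thesis .
    qed
    ultimately have "\<bar>p * w' / \<alpha> - c * k * w\<bar> \<le> w / \<alpha> * (R / m) + 2 * w / m + w * R / m" by linarith
    also have "\<dots> = w * C1 / m" by (simp add: C1_def algebra_simps add_divide_distrib)
    finally show ?thesis .
  qed
  \<comment> \<open>Young's inequality: half of the decrease found in \<open>t1\<close> pays for the linear term\<close>
  have t2: "2 * s * (p * w' / \<alpha> - c * k * w) \<le> g / 4 / m * (s\<^sup>2 * w) + 4 * C1\<^sup>2 / g * w / m"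
  proof -
    have "2 * s * (p * w' / \<alpha> - c * k * w) \<le> 2 * (\<bar>s\<bar> * \<bar>p * w' / \<alpha> - c * k * w\<bar>)"
      using abs_ge_self[of "s * (p * w' / \<alpha> - c * k * w)"] unfolding abs_mult by linarith
    also have "\<dots> \<le> 2 * (\<bar>s\<bar> * (w * C1 / m))" using B by (intro mult_left_mono) auto
    also have "\<dots> = (w / m) * (2 * \<bar>s\<bar> * C1)" by simp
    also have "2 * \<bar>s\<bar> * C1 \<le> g / 4 * s\<^sup>2 + 4 * C1\<^sup>2 / g"
    proof -
      have "0 \<le> (g / 2 * \<bar>s\<bar> - 2 * C1)\<^sup>2 / g" using g by simp
      also have "\<dots> = g / 4 * s\<^sup>2 + 4 * C1\<^sup>2 / g - 2 * \<bar>s\<bar> * C1"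
        using g by (simp add: power2_diff power_mult_distrib power_divide diff_divide_distrib add_divide_distrib) (simp add: power2_eq_square)
      finally show ?thesis by simp
    qed
    then have "(w / m) * (2 * \<bar>s\<bar> * C1) \<le> (w / m) * (g / 4 * s\<^sup>2 + 4 * C1\<^sup>2 / g)"
      using w k by (intro mult_left_mono) auto
    finally show ?thesis by (simp add: algebra_simps add_divide_distrib)
  qed
  have t3: "p * w' / \<alpha>\<^sup>2 \<le> 2 * R / \<alpha>\<^sup>2 * (k * w) / m"
  proof -
    have "p * w' / \<alpha>\<^sup>2 \<le> (2 * R * k / m) * w / \<alpha>\<^sup>2"
      using p w R k by (intro divide_right_mono mult_mono) auto
    then show ?thesis by (simp add: mult_ac)
  qed
  have t4: "c * w * Q \<le> R / (1 - \<alpha>) * (k * w) / m"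
  proof -
    have "c * w * Q \<le> (R / m) * w * (k / (1 - \<alpha>))"
      using c w Q R k by (intro mult_mono) auto
    then show ?thesis by (simp add: mult_ac)
  qed
  have t5: "4 * C1\<^sup>2 / g * w / m \<le> 4 * C1\<^sup>2 / g * (k * w) / m"
    using k w g by (intro divide_right_mono mult_left_mono) auto
  have "partition_step \<alpha> \<mu> n (\<lambda>\<pi>. (score \<pi>)\<^sup>2 * h (card \<pi>)) \<pi>
    \<le> s\<^sup>2 * w - g / 2 / m * (s\<^sup>2 * w) + (g / 4 / m * (s\<^sup>2 * w) + 4 * C1\<^sup>2 / g * (k * w) / m)
      + (2 * R / \<alpha>\<^sup>2 * (k * w) / m + R / (1 - \<alpha>) * (k * w) / m)"
    unfolding eq using t1 t2 t3 t4 t5 by linarith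
  also have "\<dots> = (1 - g / 4 / m) * (s\<^sup>2 * w) + score_const * (k * w) / m"
    by (simp add: score_const_def C1_def R_def g_def algebra_simps add_divide_distrib)
  finally show ?thesis by (simp only: g_def m_def s_def w_def k_def)
qed

end

context gibbs_chain
begin

lemma expectation_linear:
  fixes F G :: "nat set set \<Rightarrow> real"
  assumes "1 \<le> n"
  shows "(LINT \<omega>|M. a * F (X n \<omega>) + b * G (X n \<omega>)) = a * (LINT \<omega>|M. F (X n \<omega>)) + b * (LINT \<omega>|M. G (X n \<omega>))"
  by (simp add: integrable_X[OF assms, of F] integrable_X[OF assms, of G])

lemma expectation_drift:
  fixes F E :: "nat set set \<Rightarrow> real"
  assumes n: "1 \<le> n"
    and step: "\<And>\<pi>. partition_on {1..n} \<pi> \<Longrightarrow>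
      partition_step \<alpha> \<mu> n F \<pi> \<le> (1 - a / real n) * F \<pi> + E \<pi> / real n"
  shows "(LINT \<omega>|M. F (X (Suc n) \<omega>)) \<le> (1 - a / real n) * (LINT \<omega>|M. F (X n \<omega>)) + (LINT \<omega>|M. E (X n \<omega>)) / real n"
proof -
  have "(LINT \<omega>|M. F (X (Suc n) \<omega>)) \<le> (LINT \<omega>|M. (1 - a / real n) * F (X n \<omega>) + (1 / real n) * E (X n \<omega>))"
    by (rule expectation_step_le[OF n]) (use step in simp)
  then show ?thesis unfolding expectation_linear[OF n] by simp
qed

lemma expectation_inverse_card: "(\<lambda>n. LINT \<omega>|M. 1 / real (card (X n \<omega>))) \<longlonglongrightarrow> 0"
proof (rule drift_tendsto_0[where a = "growth_const / 2" and e = "\<lambda>_. 0"])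
  have "(LINT \<omega>|M. 1 / real (card (X (Suc n) \<omega>)))
      \<le> (1 - growth_const / 2 / real n) * (LINT \<omega>|M. 1 / real (card (X n \<omega>))) + 0 / real n" if "1 \<le> n" for n
    using expectation_drift[OF that, where F = "\<lambda>\<pi>. 1 / real (card \<pi>)" and E = "\<lambda>_. 0" and a = "growth_const / 2"]
      partition_step_inverse_card[OF _ that] by simp
  then show "\<forall>\<^sub>F n in sequentially. (LINT \<omega>|M. 1 / real (card (X (Suc n) \<omega>)))
      \<le> (1 - growth_const / 2 / real n) * (LINT \<omega>|M. 1 / real (card (X n \<omega>))) + 0 / real n"
    unfolding eventually_sequentially by blast
qed (use growth_const_pos in simp_all)

lemma expectation_abs_le_sqrt:
  fixes F :: "nat set set \<Rightarrow> real"
  assumes "1 \<le> n"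
  shows "(LINT \<omega>|M. \<bar>F (X n \<omega>)\<bar>) \<le> sqrt (LINT \<omega>|M. (F (X n \<omega>))\<^sup>2)"
proof -
  have "0 \<le> variance (\<lambda>\<omega>. \<bar>F (X n \<omega>)\<bar>)" by (rule variance_positive)
  also have "\<dots> = (LINT \<omega>|M. \<bar>F (X n \<omega>)\<bar>\<^sup>2) - (LINT \<omega>|M. \<bar>F (X n \<omega>)\<bar>)\<^sup>2"
    by (rule variance_eq) (rule integrable_X[OF assms, of "\<lambda>\<pi>. \<bar>F \<pi>\<bar>"], rule integrable_X[OF assms, of "\<lambda>\<pi>. \<bar>F \<pi>\<bar>\<^sup>2"])
  finally have "(LINT \<omega>|M. \<bar>F (X n \<omega>)\<bar>)\<^sup>2 \<le> (LINT \<omega>|M. \<bar>F (X n \<omega>)\<bar>\<^sup>2)" by simp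
  then show ?thesis by (intro real_le_rsqrt) simp
qed

lemma expectation_abs_tendsto_0:
  fixes F :: "nat set set \<Rightarrow> real"
  assumes "(\<lambda>n. LINT \<omega>|M. (F (X n \<omega>))\<^sup>2) \<longlonglongrightarrow> 0"
  shows "(\<lambda>n. LINT \<omega>|M. \<bar>F (X n \<omega>)\<bar>) \<longlonglongrightarrow> 0"
proof (rule tendsto_sandwich[OF _ _ tendsto_const])
  show "\<forall>\<^sub>F n in sequentially. 0 \<le> (LINT \<omega>|M. \<bar>F (X n \<omega>)\<bar>)" by simp
  show "\<forall>\<^sub>F n in sequentially. (LINT \<omega>|M. \<bar>F (X n \<omega>)\<bar>) \<le> sqrt (LINT \<omega>|M. (F (X n \<omega>))\<^sup>2)"
    using eventually_ge_at_top[of 1] by eventually_elim (rule expectation_abs_le_sqrt)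
  show "(\<lambda>n. sqrt (LINT \<omega>|M. (F (X n \<omega>))\<^sup>2)) \<longlonglongrightarrow> 0"
    using tendsto_real_sqrt[OF assms] by simp
qed

text \<open>Induction on the size: the deviation at \<open>j\<close> is the vanishing error term in the recursion at \<open>j + 1\<close>.\<close>

lemma expectation_share_error: "(\<lambda>n. LINT \<omega>|M. (share_error j (X n \<omega>))\<^sup>2) \<longlonglongrightarrow> 0"
proof (induction j)
  case 0
  have "(LINT \<omega>|M. (share_error 0 (X n \<omega>))\<^sup>2) = 0" if "1 \<le> n" for n
    using share_0[OF X_partition[OF that]]
    by (intro integral_eq_zero_AE AE_I2) (simp add: share_error_def sibuya0_def)
  then show ?case by (intro tendsto_eventually) (auto simp: eventually_sequentially)
next
  case (Suc j)
  define e where "e n = 2 * real (Suc j) * (LINT \<omega>|M. \<bar>share_error j (X n \<omega>)\<bar>)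
    + share_const (Suc j) * (LINT \<omega>|M. 1 / real (card (X n \<omega>)))" for n
  have L1: "(\<lambda>n. LINT \<omega>|M. \<bar>share_error j (X n \<omega>)\<bar>) \<longlonglongrightarrow> 0"
    by (rule expectation_abs_tendsto_0[OF Suc])
  have "e \<longlonglongrightarrow> 2 * real (Suc j) * 0 + share_const (Suc j) * 0"
    unfolding e_def by (intro tendsto_add tendsto_mult tendsto_const L1 expectation_inverse_card)
  then have e: "e \<longlonglongrightarrow> 0" by simp
  have step: "(LINT \<omega>|M. (share_error (Suc j) (X (Suc n) \<omega>))\<^sup>2)
      \<le> (1 - 2 * real (Suc j) / real n) * (LINT \<omega>|M. (share_error (Suc j) (X n \<omega>))\<^sup>2) + e n / real n"
    if n: "1 \<le> n" for n
  proof -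
    have "e n = (LINT \<omega>|M. 2 * real (Suc j) * \<bar>share_error j (X n \<omega>)\<bar> + share_const (Suc j) * (1 / real (card (X n \<omega>))))"
      unfolding e_def by (rule expectation_linear[OF n, symmetric])
    then show ?thesis
      using expectation_drift[OF n partition_step_share_error[OF _ n]] by simp
  qed
  show ?case
    by (rule drift_tendsto_0[where a = "2 * real (Suc j)" and e = e])
       (use step e in \<open>auto simp: eventually_sequentially\<close>)
qed

text \<open>With weight \<open>1 / k\<^sup>2\<close> the variance of a step is of order \<open>1 / k\<close> on the scale \<open>1 / n\<close>, and the
expectation of \<open>1 / k\<close> vanishes.\<close>

lemma expectation_score_ratio: "(\<lambda>n. LINT \<omega>|M. (score (X n \<omega>))\<^sup>2 * (1 / (real (card (X n \<omega>)))\<^sup>2)) \<longlonglongrightarrow> 0"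
proof (rule drift_tendsto_0[where a = "growth_const / 4"])
  let ?h = "\<lambda>k. 1 / (real k)\<^sup>2"
  have h: "0 < ?h (k + 1)" "?h (k + 1) \<le> ?h k" "?h k / (2 * real k) \<le> ?h k - ?h (k + 1)"
      "real k * (?h k - ?h (k + 1)) \<le> 2 * ?h k" if "1 \<le> k" for k
  proof -
    define x where "x = real k"
    have x: "1 \<le> x" using that by (simp add: x_def)
    have "1 / x\<^sup>2 - 1 / (x + 1)\<^sup>2 = ((x + 1)\<^sup>2 - x\<^sup>2) / (x\<^sup>2 * (x + 1)\<^sup>2)"
      using x by (subst diff_frac_eq) auto
    also have "(x + 1)\<^sup>2 - x\<^sup>2 = 2 * x + 1" by (simp add: power2_eq_square algebra_simps)
    finally have e: "1 / x\<^sup>2 - 1 / (x + 1)\<^sup>2 = (2 * x + 1) / (x\<^sup>2 * (x + 1)\<^sup>2)" .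
    show "0 < ?h (k + 1)" "?h (k + 1) \<le> ?h k" using that by (auto intro!: divide_left_mono power_mono)
    have "(1 / x\<^sup>2) / (2 * x) = (x + 1)\<^sup>2 / (2 * x * x\<^sup>2 * (x + 1)\<^sup>2)" using x by simp
    also have "\<dots> \<le> (2 * x * (2 * x + 1)) / (2 * x * x\<^sup>2 * (x + 1)\<^sup>2)"
    proof (intro divide_right_mono)
      have "1 * 1 \<le> x * x" using x by (intro mult_mono) auto
      then have "(x + 1)\<^sup>2 \<le> (x + 1)\<^sup>2 + (3 * (x * x) - 1)" by simp
      also have "\<dots> = 2 * x * (2 * x + 1)" by (simp add: power2_eq_square algebra_simps)
      finally show "(x + 1)\<^sup>2 \<le> 2 * x * (2 * x + 1)" .
    qed (use x in simp)
    also have "\<dots> = (2 * x + 1) / (x\<^sup>2 * (x + 1)\<^sup>2)" using x by simp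
    finally show "?h k / (2 * real k) \<le> ?h k - ?h (k + 1)" using e by (simp add: x_def add.commute)
    have "x * ((2 * x + 1) / (x\<^sup>2 * (x + 1)\<^sup>2)) = x * (2 * x + 1) / (x + 1)\<^sup>2 * (1 / x\<^sup>2)" by simp
    also have "\<dots> \<le> 2 * (1 / x\<^sup>2)"
    proof (intro mult_right_mono)
      have "x * (2 * x + 1) \<le> 2 * (x + 1)\<^sup>2" using x by (simp add: power2_eq_square algebra_simps)
      moreover have "0 < (x + 1)\<^sup>2" using x by simp
      ultimately show "x * (2 * x + 1) / (x + 1)\<^sup>2 \<le> 2" by (simp only: pos_divide_le_eq)
    qed simp
    finally show "real k * (?h k - ?h (k + 1)) \<le> 2 * ?h k" using e by (simp add: x_def add.commute)
  qed
  have step: "(LINT \<omega>|M. (score (X (Suc n) \<omega>))\<^sup>2 * ?h (card (X (Suc n) \<omega>)))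
    \<le> (1 - growth_const / 4 / real n) * (LINT \<omega>|M. (score (X n \<omega>))\<^sup>2 * ?h (card (X n \<omega>)))
      + score_const * (LINT \<omega>|M. 1 / real (card (X n \<omega>))) / real n" if n: "1 \<le> n" for n
  proof -
    have "partition_step \<alpha> \<mu> n (\<lambda>\<pi>. (score \<pi>)\<^sup>2 * ?h (card \<pi>)) \<pi>
         \<le> (1 - growth_const / 4 / real n) * ((score \<pi>)\<^sup>2 * ?h (card \<pi>)) + score_const * (1 / real (card \<pi>)) / real n"
      if part: "partition_on {1..n} \<pi>" for \<pi>
    proof -
      have "real (card \<pi>) * ?h (card \<pi>) = 1 / real (card \<pi>)" by (simp add: power2_eq_square)
      then show ?thesis
        using partition_step_score[where h = ?h, OF part n h[OF partition_card_pos[OF part n]]] by simp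
    qed
    from expectation_drift[OF n this] show ?thesis unfolding integral_mult_right_zero .
  qed
  then show "\<forall>\<^sub>F n in sequentially. (LINT \<omega>|M. (score (X (Suc n) \<omega>))\<^sup>2 * ?h (card (X (Suc n) \<omega>)))
    \<le> (1 - growth_const / 4 / real n) * (LINT \<omega>|M. (score (X n \<omega>))\<^sup>2 * ?h (card (X n \<omega>)))
      + score_const * (LINT \<omega>|M. 1 / real (card (X n \<omega>))) / real n"
    unfolding eventually_sequentially by blast
  show "(\<lambda>n. score_const * (LINT \<omega>|M. 1 / real (card (X n \<omega>)))) \<longlonglongrightarrow> 0"
    using tendsto_mult[OF tendsto_const expectation_inverse_card] by simp
qed (use growth_const_pos in simp_all)

text \<open>With weight \<open>1 / k\<close> the variance of a step is bounded on the scale \<open>1 / n\<close>.\<close>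

lemma expectation_score_bounded:
  obtains B where "\<And>n. 1 \<le> n \<Longrightarrow> (LINT \<omega>|M. (score (X n \<omega>))\<^sup>2 * (1 / real (card (X n \<omega>)))) \<le> B"
proof (rule drift_bounded[where a = "growth_const / 4" and C = score_const and
      x = "\<lambda>n. LINT \<omega>|M. (score (X n \<omega>))\<^sup>2 * (1 / real (card (X n \<omega>)))"])
  let ?h = "\<lambda>k. 1 / real k"
  have h: "0 < ?h (k + 1)" "?h (k + 1) \<le> ?h k" "?h k / (2 * real k) \<le> ?h k - ?h (k + 1)"
      "real k * (?h k - ?h (k + 1)) \<le> 2 * ?h k" if "1 \<le> k" for k
  proof -
    define x where "x = real k"
    have x: "1 \<le> x" using that by (simp add: x_def)
    have e: "1 / x - 1 / (x + 1) = 1 / (x * (x + 1))" using x by (simp add: field_simps)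
    show "0 < ?h (k + 1)" "?h (k + 1) \<le> ?h k" using that by (auto intro!: divide_left_mono)
    have "(1 / x) / (2 * x) = 1 / (x * (x + x))" by simp
    also have "\<dots> \<le> 1 / (x * (x + 1))" using x by (intro divide_left_mono mult_left_mono mult_pos_pos) auto
    finally show "?h k / (2 * real k) \<le> ?h k - ?h (k + 1)" using e by (simp add: x_def add.commute)
    have "x * (1 / (x * (x + 1))) = 1 / (x + 1)" using x by simp
    also have "\<dots> \<le> 2 * (1 / x)" using x by (simp add: field_simps)
    finally show "real k * (?h k - ?h (k + 1)) \<le> 2 * ?h k" using e by (simp add: x_def add.commute)
  qed
  fix n :: nat assume n: "1 \<le> n"
  have "partition_step \<alpha> \<mu> n (\<lambda>\<pi>. (score \<pi>)\<^sup>2 * ?h (card \<pi>)) \<pi>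
       \<le> (1 - growth_const / 4 / real n) * ((score \<pi>)\<^sup>2 * ?h (card \<pi>)) + score_const / real n"
    if part: "partition_on {1..n} \<pi>" for \<pi>
  proof -
    have k: "1 \<le> card \<pi>" by (rule partition_card_pos[OF part n])
    then have "real (card \<pi>) * ?h (card \<pi>) = 1" by simp
    then show ?thesis
      using partition_step_score[where h = ?h, OF part n h[OF k]] by simp
  qed
  from expectation_drift[OF n this]
  show "(LINT \<omega>|M. (score (X (Suc n) \<omega>))\<^sup>2 * ?h (card (X (Suc n) \<omega>)))
    \<le> (1 - growth_const / 4 / real n) * (LINT \<omega>|M. (score (X n \<omega>))\<^sup>2 * ?h (card (X n \<omega>))) + score_const / real n"
    by (simp add: prob_space)
qed (use growth_const_pos that in auto)

end

context gibbs_mixture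
begin

text \<open>Sizes up to \<open>J\<close> are controlled by their proportions; for larger blocks \<open>f\<close> itself is small.\<close>

lemma block_average_error:
  fixes f :: "nat \<Rightarrow> real"
  assumes part: "partition_on {1..n} \<pi>" and n: "1 \<le> n"
    and small: "\<And>l. J < l \<Longrightarrow> \<bar>f l\<bar> \<le> \<epsilon>"
    and tail: "\<bar>(\<Sum>j\<le>J. sibuya0 j * f j) - s\<bar> \<le> \<epsilon>"
  shows "\<bar>block_sum f \<pi> / real (card \<pi>) - s\<bar> \<le> (\<Sum>j\<le>J. \<bar>f j\<bar> * \<bar>share_error j \<pi>\<bar>) + 2 * \<epsilon>"
proof -
  let ?k = "real (card \<pi>)"
  have k: "0 < ?k" using partition_card_pos[OF part n] by simp
  define g where "g l = (if l \<le> J then 0 else f l)" for l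
  have "f l = (\<Sum>j\<le>J. f j * of_bool (l = j)) + g l" for l
  proof -
    have "(\<Sum>j\<le>J. f j * of_bool (l = j)) = (\<Sum>j\<le>J. if l = j then f j else 0)" by (intro sum.cong) auto
    then show ?thesis by (simp add: g_def)
  qed
  then have "block_sum f \<pi> = (\<Sum>U\<in>\<pi>. (\<Sum>j\<le>J. f j * of_bool (card U = j)) + g (card U))"
    unfolding block_sum_def by (intro sum.cong refl) blast
  also have "\<dots> = (\<Sum>j\<le>J. f j * block_sum (\<lambda>l. of_bool (l = j)) \<pi>) + block_sum g \<pi>"
    unfolding sum.distrib block_sum_def sum_distrib_left by (subst sum.swap) (rule refl)
  finally have "block_sum f \<pi> / ?k = (\<Sum>j\<le>J. f j * share j \<pi>) + block_sum g \<pi> / ?k"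
    by (simp add: add_divide_distrib share_def sum_divide_distrib)
  also have "(\<Sum>j\<le>J. f j * share j \<pi>) = (\<Sum>j\<le>J. f j * share_error j \<pi>) + (\<Sum>j\<le>J. sibuya0 j * f j)"
    by (simp add: share_error_def algebra_simps sum_subtractf)
  finally have eq: "block_sum f \<pi> / ?k - s = (\<Sum>j\<le>J. f j * share_error j \<pi>) + ((\<Sum>j\<le>J. sibuya0 j * f j) - s)
    + block_sum g \<pi> / ?k" by simp
  have "\<bar>\<Sum>j\<le>J. f j * share_error j \<pi>\<bar> \<le> (\<Sum>j\<le>J. \<bar>f j\<bar> * \<bar>share_error j \<pi>\<bar>)"
    by (rule order_trans[OF sum_abs]) (simp add: abs_mult)
  moreover have "\<bar>block_sum g \<pi> / ?k\<bar> \<le> \<epsilon>"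
  proof -
    have "0 \<le> \<epsilon>" using tail by linarith
    then have "\<bar>g l\<bar> \<le> \<epsilon>" for l using small[of l] by (auto simp: g_def)
    then have "\<bar>block_sum g \<pi>\<bar> \<le> (\<Sum>U\<in>\<pi>. \<epsilon>)"
      unfolding block_sum_def by (intro order_trans[OF sum_abs] sum_mono)
    then show ?thesis using k by (simp add: abs_divide divide_le_eq mult.commute)
  qed
  ultimately show ?thesis unfolding eq using tail by linarith
qed

end

context gibbs_chain
begin

text \<open>A law of large numbers: averages over blocks converge to means under the Sibuya distribution. The
condition \<open>f \<longlonglongrightarrow> 0\<close> replaces a uniform control of large block sizes.\<close>

lemma expectation_block_average:
  fixes f :: "nat \<Rightarrow> real"
  assumes f: "f \<longlonglongrightarrow> 0" and s: "(\<lambda>j. sibuya_prob \<alpha> (Suc j) * f (Suc j)) sums s"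
  shows "(\<lambda>n. LINT \<omega>|M. \<bar>block_sum f (X n \<omega>) / real (card (X n \<omega>)) - s\<bar>) \<longlonglongrightarrow> 0"
proof (rule tendstoI)
  fix e :: real assume e: "0 < e"
  define \<epsilon> where "\<epsilon> = e / 4"
  have eps: "0 < \<epsilon>" using e by (simp add: \<epsilon>_def)
  have "(\<lambda>J. \<Sum>j<J. sibuya_prob \<alpha> (Suc j) * f (Suc j)) \<longlonglongrightarrow> s" using s by (simp add: sums_def)
  from tendstoD[OF this eps] obtain N1
    where N1: "\<And>J. N1 \<le> J \<Longrightarrow> dist (\<Sum>j<J. sibuya_prob \<alpha> (Suc j) * f (Suc j)) s < \<epsilon>"
    unfolding eventually_sequentially by blast
  from tendstoD[OF f eps] obtain N2 where N2: "\<And>l. N2 \<le> l \<Longrightarrow> dist (f l) 0 < \<epsilon>"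
    unfolding eventually_sequentially by blast
  define J where "J = max N1 N2"
  have J: "\<And>l. J \<le> l \<Longrightarrow> dist (f l) 0 < \<epsilon>"
    "dist (\<Sum>j<J. sibuya_prob \<alpha> (Suc j) * f (Suc j)) s < \<epsilon>"
    using N1 N2 by (simp_all add: J_def)
  have "(\<Sum>j\<le>J. sibuya0 j * f j) = (\<Sum>j<J. sibuya_prob \<alpha> (Suc j) * f (Suc j))"
    by (simp add: lessThan_Suc_atMost[symmetric] sum.lessThan_Suc_shift sibuya0_def del: sum.lessThan_Suc)
  then have tail: "\<bar>(\<Sum>j\<le>J. sibuya0 j * f j) - s\<bar> \<le> \<epsilon>" using J(2) by (simp add: dist_real_def)
  have small: "\<bar>f l\<bar> \<le> \<epsilon>" if "J < l" for l using J(1)[of l] that by (simp add: dist_real_def)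
  define B where "B n = (\<Sum>j\<le>J. \<bar>f j\<bar> * (LINT \<omega>|M. \<bar>share_error j (X n \<omega>)\<bar>)) + 2 * \<epsilon>" for n
  have L1: "(\<lambda>n. LINT \<omega>|M. \<bar>share_error j (X n \<omega>)\<bar>) \<longlonglongrightarrow> 0" for j
    by (rule expectation_abs_tendsto_0[OF expectation_share_error])
  have "B \<longlonglongrightarrow> (\<Sum>j\<le>J. \<bar>f j\<bar> * 0) + 2 * \<epsilon>"
    unfolding B_def by (intro tendsto_add tendsto_sum tendsto_mult tendsto_const L1)
  from order_tendstoD(2)[OF this, of e] have evB: "\<forall>\<^sub>F n in sequentially. B n < e"
    using eps by (simp add: \<epsilon>_def)
  have le: "(LINT \<omega>|M. \<bar>block_sum f (X n \<omega>) / real (card (X n \<omega>)) - s\<bar>) \<le> B n" if n: "1 \<le> n" for n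
  proof -
    have "(LINT \<omega>|M. \<bar>block_sum f (X n \<omega>) / real (card (X n \<omega>)) - s\<bar>)
      \<le> (LINT \<omega>|M. (\<Sum>j\<le>J. \<bar>f j\<bar> * \<bar>share_error j (X n \<omega>)\<bar>) + 2 * \<epsilon>)"
      using block_average_error[OF X_partition[OF n] n small tail]
        integrable_X[OF n, of "\<lambda>\<pi>. \<bar>block_sum f \<pi> / real (card \<pi>) - s\<bar>"]
        integrable_X[OF n, of "\<lambda>\<pi>. (\<Sum>j\<le>J. \<bar>f j\<bar> * \<bar>share_error j \<pi>\<bar>) + 2 * \<epsilon>"]
      by (intro integral_mono) auto
    also have "\<dots> = (\<Sum>j\<le>J. \<bar>f j\<bar> * (LINT \<omega>|M. \<bar>share_error j (X n \<omega>)\<bar>)) + 2 * \<epsilon>"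
    proof -
      have i: "integrable M (\<lambda>\<omega>. \<bar>f j\<bar> * \<bar>share_error j (X n \<omega>)\<bar>)" for j
        using integrable_X[OF n, of "\<lambda>\<pi>. \<bar>f j\<bar> * \<bar>share_error j \<pi>\<bar>"] .
      show ?thesis
        by (subst Bochner_Integration.integral_add)
           (auto intro!: Bochner_Integration.integrable_sum i simp: Bochner_Integration.integral_sum[OF i] prob_space)
    qed
    finally show ?thesis by (simp add: B_def)
  qed
  show "\<forall>\<^sub>F n in sequentially. dist (LINT \<omega>|M. \<bar>block_sum f (X n \<omega>) / real (card (X n \<omega>)) - s\<bar>) 0 < e"
    using evB eventually_ge_at_top[of 1]
  proof eventually_elim
    case (elim n)
    then have "(LINT \<omega>|M. \<bar>block_sum f (X n \<omega>) / real (card (X n \<omega>)) - s\<bar>) < e" using le[of n] by simp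
    then show ?case by simp
  qed
qed

lemma expectation_inverse_sizes:
  "(\<lambda>n. LINT \<omega>|M. \<bar>inverse_sizes (X n \<omega>) / real (card (X n \<omega>)) - sibuya_q \<alpha>\<bar>) \<longlonglongrightarrow> 0"
  unfolding inverse_sizes_def
proof (rule expectation_block_average)
  show "(\<lambda>j. 1 / (real j - \<alpha>)) \<longlonglongrightarrow> 0" by real_asymp
  show "(\<lambda>j. sibuya_prob \<alpha> (Suc j) * (1 / (real (Suc j) - \<alpha>))) sums sibuya_q \<alpha>"
    using sibuya_q_sums[OF \<alpha>] by simp
qed

end

section \<open>Central limit theorem for the score\<close>

text \<open>Second order Taylor expansion of \<open>x \<mapsto> exp (\<i> x)\<close> at \<open>a + b\<close>, with an error that uses two moments of
\<open>a\<close> only. Below, \<open>a\<close> is proportional to the current standardized score, whose third moment is not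
under control, and \<open>b\<close> is the bounded jump divided by \<open>sqrt k\<close>.\<close>

lemma iexp_quadratic_error:
  fixes a b :: real
  shows "cmod (iexp (a + b) - (1 + \<i> * of_real (a + b) - of_real ((a + b)\<^sup>2 / 2))) \<le> 4 * a\<^sup>2 + 2 * \<bar>b\<bar> ^ 3"
proof -
  define x where "x = a + b"
  have q: "(\<Sum>k\<le>2. (\<i> * of_real x) ^ k / fact k) = 1 + \<i> * of_real x - of_real (x\<^sup>2 / 2)"
    by (simp add: numeral_2_eq_2 power2_eq_square field_simps)
  have 1: "cmod (iexp x - (1 + \<i> * of_real x - of_real (x\<^sup>2 / 2))) \<le> \<bar>x\<bar> ^ 3 / 6"
    using iexp_approx1[of x 2] unfolding q by (simp add: eval_nat_numeral fact_numeral)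
  have 2: "cmod (iexp x - (1 + \<i> * of_real x - of_real (x\<^sup>2 / 2))) \<le> x\<^sup>2"
    using iexp_approx2[of x 2] unfolding q by (simp add: fact_numeral)
  show ?thesis
  proof (cases "\<bar>b\<bar> \<le> \<bar>a\<bar>")
    case True
    then have "\<bar>x\<bar>\<^sup>2 \<le> (2 * \<bar>a\<bar>)\<^sup>2" unfolding x_def by (intro power_mono) auto
    then have "x\<^sup>2 \<le> 4 * a\<^sup>2" by (simp add: power_mult_distrib)
    moreover have "0 \<le> \<bar>b\<bar> ^ 3" by simp
    ultimately show ?thesis using 2 unfolding x_def by linarith
  next
    case False
    then have "\<bar>x\<bar> ^ 3 \<le> (2 * \<bar>b\<bar>) ^ 3" unfolding x_def by (intro power_mono) auto
    then have "\<bar>x\<bar> ^ 3 \<le> 8 * \<bar>b\<bar> ^ 3" by (simp add: power_mult_distrib)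
    moreover have "0 \<le> \<bar>b\<bar> ^ 3" "0 \<le> a\<^sup>2" by simp_all
    ultimately show ?thesis using 1 unfolding x_def by linarith
  qed
qed

text \<open>When a block is opened, normalisation by \<open>sqrt (k + 1)\<close> replaces normalisation by \<open>sqrt k\<close>: a
contraction by \<open>1 - 1 / (2 k)\<close> up to \<open>1 / k\<^sup>2\<close>.\<close>

lemma sqrt_ratio_bounds:
  fixes k :: real
  assumes k: "1 \<le> k"
  defines "r \<equiv> sqrt k / sqrt (k + 1)"
  shows "0 < r" "r \<le> 1" "r\<^sup>2 = k / (k + 1)" "\<bar>r - 1\<bar> \<le> 1 / k" "\<bar>r - 1 + 1 / (2 * k)\<bar> \<le> 1 / k\<^sup>2"
proof -
  show pos: "0 < r" and le1: "r \<le> 1" using k by (auto simp: r_def)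
  show sq: "r\<^sup>2 = k / (k + 1)" using k by (simp add: r_def power_divide)
  have "r * r \<le> r * 1" using pos le1 by (intro mult_left_mono) auto
  then have ge: "k / (k + 1) \<le> r" using sq by (simp add: power2_eq_square)
  define x where "x = 1 - r"
  have x: "0 \<le> x" using le1 by (simp add: x_def)
  have "x * (1 + r) = 1 - r\<^sup>2" by (simp add: x_def power2_eq_square algebra_simps)
  also have "\<dots> = 1 / (k + 1)" using k sq by (simp add: field_simps)
  finally have xr: "x * (1 + r) = 1 / (k + 1)" .
  have up: "x \<le> 1 / (2 * k)"
  proof -
    have "x * (2 * k / (k + 1)) \<le> x * (1 + r)"
    proof (intro mult_left_mono x)
      have "2 * k / (k + 1) = k / (k + 1) + k / (k + 1)" by simp
      also have "\<dots> \<le> 1 + r" using ge k by (intro add_mono) auto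
      finally show "2 * k / (k + 1) \<le> 1 + r" .
    qed
    then have "x * (2 * k) / (k + 1) \<le> 1 / (k + 1)" using xr by simp
    then have "x * (2 * k) \<le> 1" using k by (simp add: divide_le_cancel)
    then show ?thesis using k by (simp add: field_simps)
  qed
  have low: "1 / (2 * (k + 1)) \<le> x"
  proof -
    have "1 / (k + 1) \<le> x * 2" unfolding xr[symmetric] using x le1 by (intro mult_left_mono) auto
    then have "1 / (k + 1) / 2 \<le> x * 2 / 2" by (rule divide_right_mono) simp
    then have "1 / ((k + 1) * 2) \<le> x" unfolding divide_divide_eq_left by simp
    then show ?thesis by (subst mult.commute)
  qed
  show "\<bar>r - 1\<bar> \<le> 1 / k"
  proof -
    have "1 / (2 * k) \<le> 1 / k" using k by (intro divide_left_mono) auto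
    then show ?thesis using up x by (simp add: x_def)
  qed
  have "1 / (2 * k) - 1 / (2 * (k + 1)) = 1 / (2 * k * (k + 1))" using k by (simp add: field_simps)
  also have "\<dots> \<le> 1 / k\<^sup>2"
    using k unfolding power2_eq_square by (intro divide_left_mono mult_mono mult_pos_pos) auto
  finally show "\<bar>r - 1 + 1 / (2 * k)\<bar> \<le> 1 / k\<^sup>2" using up low by (simp add: x_def)
qed

context gibbs_mixture
begin

definition z_score :: "nat set set \<Rightarrow> real" where
  "z_score \<pi> = score \<pi> / sqrt (real (card \<pi>))"

text \<open>Majorises, up to constants, all errors of the expansion of one step; its expectation vanishes.\<close>

definition step_error :: "nat set set \<Rightarrow> real" where
  "step_error \<pi> = (score \<pi>)\<^sup>2 * (1 / (real (card \<pi>))\<^sup>2) + \<bar>score \<pi> / real (card \<pi>)\<bar> + sqrt (1 / real (card \<pi>))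
     + \<bar>inverse_sizes \<pi> / real (card \<pi>) - sibuya_q \<alpha>\<bar>"

text \<open>This constant and the next two bound the errors in the mean, in the variance and in the third
absolute moment of the jumps, in units of \<open>step_error \<pi> / n\<close>.\<close>

definition drift_const :: real where
  "drift_const = 4 * rate_const + 3 * rate_const / \<alpha> + rate_const"

definition variance_const :: real where
  "variance_const = (8 * rate_const + 1) + 8 * rate_const / \<alpha> + rate_const + (rate_const + 1) / \<alpha>\<^sup>2 + rate_const / (1 - \<alpha>) + 1"

definition cubic_const :: real where
  "cubic_const = 2 * rate_const / \<alpha> ^ 3 + rate_const / (1 - \<alpha>)\<^sup>2"

text \<open>Collects the three constants and that of the quadratic Taylor error; the powers of \<open>T\<close> come from
extracting a single factor \<open>\<bar>t\<bar>\<close> from \<open>t\<^sup>2\<close> and \<open>\<bar>t\<bar>\<^sup>3\<close>.\<close>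

definition step_const :: "real \<Rightarrow> real" where
  "step_const T = drift_const + T * variance_const / 2 + 4 * T * (8 * rate_const + 1) + 2 * T\<^sup>2 * cubic_const"

text \<open>One step of an Ornstein--Uhlenbeck process. A new block, of probability about \<open>\<alpha> k / n\<close>, contracts
the standardized score \<open>z\<close> by \<open>1 - 1 / (2 k)\<close>, so the mean contraction is \<open>1 - \<alpha> / (2 n)\<close>. The jumps
\<open>1 / (\<alpha> sqrt k)\<close> for a new block and \<open>- 1 / ((card U - \<alpha>) sqrt k)\<close> for the growth of \<open>U\<close> have mean
zero to first order and variance \<open>1 / (\<alpha> n) + inverse_sizes \<pi> / (k n)\<close>, which is close to
\<open>\<alpha> fisher_info \<alpha> / n\<close>.\<close>

lemma partition_step_iexp:
  assumes part: "partition_on {1..n} \<pi>" and n: "1 \<le> n" and t: "\<bar>t\<bar> \<le> T"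
  shows "cmod (partition_step \<alpha> \<mu> n (\<lambda>\<pi>. iexp (t * z_score \<pi>)) \<pi>
      - of_real (1 - \<alpha> * fisher_info \<alpha> * t\<^sup>2 / (2 * real n)) * iexp (t * (1 - \<alpha> / (2 * real n)) * z_score \<pi>))
    \<le> \<bar>t\<bar> / real n * (step_const T * step_error \<pi>)"
proof -
  define k p c m where "k = real (card \<pi>)" and "p = new_prob n (card \<pi>)" and "c = join_rate n (card \<pi>)" and "m = real n"
  define \<zeta> Q R sk r where "\<zeta> = score \<pi> / k" and "Q = inverse_sizes \<pi>" and "R = rate_const" and "sk = sqrt k"
    and "r = sqrt k / sqrt (k + 1)"
  define z where "z = sk * \<zeta>"
  define q e where "q = sibuya_q \<alpha>" and "e = step_error \<pi>"
  have kn: "1 \<le> card \<pi>" "card \<pi> \<le> n" using partition_card_pos partition_card_le assms by auto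
  have k: "1 \<le> k" "k \<le> m" "0 < k" "0 < m" using kn by (auto simp: k_def m_def)
  have R: "1 \<le> R" using rate_const_ge by (simp add: R_def)
  have a: "0 < \<alpha>" "0 < 1 - \<alpha>" using \<alpha> by auto
  have p: "\<bar>p - \<alpha> * k / m\<bar> \<le> R / m" "p \<le> 2 * R * k / m" "0 \<le> p" "p \<le> 1"
    using new_prob_approx[OF kn] new_prob_le[OF kn] new_prob_nonneg new_prob_le_1[OF kn]
    by (simp_all add: p_def k_def m_def R_def)
  have c: "\<bar>c - 1 / m\<bar> \<le> R / 2 / m\<^sup>2" "0 < c" "c \<le> R / m"
    using join_rate_approx[OF n] join_rate_pos[OF n] join_rate_le[OF n] by (simp_all add: c_def m_def R_def)
  have Q: "0 \<le> Q" "Q \<le> k / (1 - \<alpha>)" using inverse_sizes_bounds[OF part] by (simp_all add: Q_def k_def)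
  have sk: "0 < sk" "sk * sk = k" "1 \<le> sk" using k by (simp_all add: sk_def)
  have skk: "sk \<le> k" using sk by (metis mult_left_mono mult.right_neutral less_imp_le)
  note r = sqrt_ratio_bounds[OF k(1), folded r_def]
  have zdef: "z_score \<pi> = z"
    using sk k by (simp add: z_score_def z_def \<zeta>_def k_def[symmetric] sk_def[symmetric] field_simps)
  have z2: "z\<^sup>2 = k * \<zeta>\<^sup>2" using sk by (simp add: z_def power_mult_distrib power2_eq_square)
  have absz: "\<bar>z\<bar> = sk * \<bar>\<zeta>\<bar>" using sk by (simp add: z_def abs_mult)
  have e: "\<zeta>\<^sup>2 \<le> e" "\<bar>\<zeta>\<bar> \<le> e" "1 / sk \<le> e" "\<bar>Q / k - q\<bar> \<le> e" "0 \<le> e"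
  proof -
    have "e = \<zeta>\<^sup>2 + \<bar>\<zeta>\<bar> + 1 / sk + \<bar>Q / k - q\<bar>"
      by (simp add: e_def step_error_def \<zeta>_def k_def sk_def Q_def q_def power_divide real_sqrt_divide)
    moreover have "0 \<le> \<zeta>\<^sup>2" "0 \<le> 1 / sk" using sk by simp_all
    ultimately show "\<zeta>\<^sup>2 \<le> e" "\<bar>\<zeta>\<bar> \<le> e" "1 / sk \<le> e" "\<bar>Q / k - q\<bar> \<le> e" "0 \<le> e" by linarith+
  qed
  define d where "d U = real (card U) - \<alpha>" for U :: "nat set"
  have d: "1 - \<alpha> \<le> d U" "0 < d U" if "U \<in> \<pi>" for U
    using block_size_minus_pos[OF part that] by (simp_all add: d_def)
  have cd: "(\<Sum>U\<in>\<pi>. c * d U) = 1 - p" using sum_join_prob[OF part n] by (simp add: d_def c_def p_def)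
  have inv: "(\<Sum>U\<in>\<pi>. 1 / d U) = Q" by (simp add: Q_def inverse_sizes_def block_sum_def d_def)
  have card: "(\<Sum>U\<in>\<pi>. x) = k * x" for x by (simp add: k_def)
  \<comment> \<open>Relative to the contracted value \<open>(1 - \<alpha> / (2 m)) z\<close>, the new value is displaced by \<open>a0 + b0\<close> when a
    block is opened and by \<open>a1 + b U\<close> when \<open>U\<close> grows. The parts \<open>a0\<close>, \<open>a1\<close> are multiples of \<open>z\<close>; \<open>b0\<close> and
    \<open>b\<close> are the jumps.\<close>
  define a0 a1 b0 where "a0 = z * (r - 1 + \<alpha> / (2 * m))" and "a1 = \<alpha> * z / (2 * m)" and "b0 = r / (\<alpha> * sk)"
  define b where "b U = - 1 / (d U * sk)" for U
  \<comment> \<open>first and second moment of the displacement, and the moments in the Taylor error\<close>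
  define E1 where "E1 = p * (a0 + b0) + (\<Sum>U\<in>\<pi>. c * d U * (a1 + b U))"
  define E2 where "E2 = p * (a0 + b0)\<^sup>2 + (\<Sum>U\<in>\<pi>. c * d U * (a1 + b U)\<^sup>2)"
  define A where "A = p * a0\<^sup>2 + (\<Sum>U\<in>\<pi>. c * d U * a1\<^sup>2)"
  define C where "C = p * \<bar>b0\<bar> ^ 3 + (\<Sum>U\<in>\<pi>. c * d U * \<bar>b U\<bar> ^ 3)"
  define y where "y = t * (1 - \<alpha> / (2 * m)) * z"
  have zn: "t * z_score (insert {n + 1} \<pi>) = y + t * (a0 + b0)"
  proof -
    have "z_score (insert {n + 1} \<pi>) = (k * \<zeta> + 1 / \<alpha>) / sqrt (k + 1)"
      unfolding z_score_def score_new_block[OF part] card_new_block[OF part] using k by (simp add: \<zeta>_def k_def add.commute)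
    also have "\<dots> = r * z + b0"
    proof -
      have "1 / sqrt (k + 1) = r / sk" using sk by (simp add: r_def sk_def)
      then have "(k * \<zeta> + 1 / \<alpha>) / sqrt (k + 1) = (k * \<zeta> + 1 / \<alpha>) * (r / sk)" by (metis times_divide_eq_right mult.right_neutral)
      also have "\<dots> = r * z + b0"
        unfolding z_def b0_def sk(2)[symmetric] using sk(1) a by (simp add: field_simps)
      finally show ?thesis .
    qed
    finally show ?thesis by (simp add: y_def a0_def algebra_simps)
  qed
  have zj: "t * z_score (join_block n \<pi> U) = y + t * (a1 + b U)" if "U \<in> \<pi>" for U
  proof -
    have "z_score (join_block n \<pi> U) = (k * \<zeta> - 1 / d U) / sk"
      unfolding z_score_def score_join_block[OF part that] card_join_block[OF part that] using k by (simp add: \<zeta>_def k_def d_def sk_def)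
    also have "\<dots> = z + b U"
      unfolding z_def b_def sk(2)[symmetric] using sk(1) d[OF that] by (simp add: field_simps)
    finally show ?thesis by (simp add: y_def a1_def algebra_simps)
  qed
  define h where "h x = iexp x - (1 + \<i> * of_real x - of_real (x\<^sup>2 / 2))" for x :: real
  have hb: "cmod (h (t * (a' + b'))) \<le> 4 * t\<^sup>2 * a'\<^sup>2 + 2 * \<bar>t\<bar> ^ 3 * \<bar>b'\<bar> ^ 3" for a' b'
    using iexp_quadratic_error[of "t * a'" "t * b'"]
    by (simp add: h_def distrib_left power_mult_distrib abs_mult)
  have ie: "iexp (y + t * x) = iexp y * (h (t * x) + 1 + \<i> * of_real (t * x) - of_real ((t * x)\<^sup>2 / 2))" for x
    by (simp add: h_def exp_add[symmetric] algebra_simps)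
  have "partition_step \<alpha> \<mu> n (\<lambda>\<pi>. iexp (t * z_score \<pi>)) \<pi>
     = of_real p * iexp (y + t * (a0 + b0)) + (\<Sum>U\<in>\<pi>. of_real (c * d U) * iexp (y + t * (a1 + b U)))"
    unfolding partition_step_eq[OF part] zn
    by (simp add: zj scaleR_conv_of_real p_def c_def d_def)
  also have "\<dots> = iexp y * (of_real p * h (t * (a0 + b0)) + (\<Sum>U\<in>\<pi>. of_real (c * d U) * h (t * (a1 + b U)))
      + of_real (p + (\<Sum>U\<in>\<pi>. c * d U)) + \<i> * of_real (t * E1) - of_real (t\<^sup>2 / 2 * E2))"
  proof -
    have "of_real w * iexp (y + t * x) = iexp y * (of_real w * h (t * x) + of_real w + \<i> * of_real (t * (w * x)) - of_real (t\<^sup>2 / 2 * (w * x\<^sup>2)))" for w x :: real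
      unfolding ie by (simp add: power_mult_distrib algebra_simps)
    then have "of_real p * iexp (y + t * (a0 + b0)) + (\<Sum>U\<in>\<pi>. of_real (c * d U) * iexp (y + t * (a1 + b U)))
      = iexp y * (of_real p * h (t * (a0 + b0)) + of_real p + \<i> * of_real (t * (p * (a0 + b0))) - of_real (t\<^sup>2 / 2 * (p * (a0 + b0)\<^sup>2)))
       + (\<Sum>U\<in>\<pi>. iexp y * (of_real (c * d U) * h (t * (a1 + b U)) + of_real (c * d U) + \<i> * of_real (t * (c * d U * (a1 + b U))) - of_real (t\<^sup>2 / 2 * (c * d U * (a1 + b U)\<^sup>2))))"
      by (simp only:)
    also have "(\<Sum>U\<in>\<pi>. iexp y * (of_real (c * d U) * h (t * (a1 + b U)) + of_real (c * d U) + \<i> * of_real (t * (c * d U * (a1 + b U))) - of_real (t\<^sup>2 / 2 * (c * d U * (a1 + b U)\<^sup>2))))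
      = iexp y * ((\<Sum>U\<in>\<pi>. of_real (c * d U) * h (t * (a1 + b U))) + of_real (\<Sum>U\<in>\<pi>. c * d U)
        + \<i> * of_real (t * (\<Sum>U\<in>\<pi>. c * d U * (a1 + b U))) - of_real (t\<^sup>2 / 2 * (\<Sum>U\<in>\<pi>. c * d U * (a1 + b U)\<^sup>2)))"
      by (simp only: of_real_sum sum_distrib_left sum.distrib[symmetric] sum_subtractf[symmetric])
    finally show ?thesis unfolding E1_def E2_def by (simp only: of_real_add distrib_left right_diff_distrib add_ac) (simp add: algebra_simps)
  qed
  also have "\<dots> = iexp y * (of_real p * h (t * (a0 + b0)) + (\<Sum>U\<in>\<pi>. of_real (c * d U) * h (t * (a1 + b U)))
      + 1 + \<i> * of_real (t * E1) - of_real (t\<^sup>2 / 2 * E2))"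
    by (simp add: cd)
  finally have stepeq: "partition_step \<alpha> \<mu> n (\<lambda>\<pi>. iexp (t * z_score \<pi>)) \<pi> = \<dots>" .
  define V where "V = 1 / \<alpha> + q"
  have aI: "\<alpha> * fisher_info \<alpha> = V"
    using a by (simp add: fisher_info_eq[OF \<alpha>] V_def q_def power2_eq_square field_simps)
  have diff: "partition_step \<alpha> \<mu> n (\<lambda>\<pi>. iexp (t * z_score \<pi>)) \<pi> - of_real (1 - V * t\<^sup>2 / (2 * m)) * iexp y
     = iexp y * (of_real p * h (t * (a0 + b0)) + (\<Sum>U\<in>\<pi>. of_real (c * d U) * h (t * (a1 + b U)))
      + \<i> * of_real (t * E1) - of_real (t\<^sup>2 / 2 * (E2 - V / m)))"
    unfolding stepeq by (simp add: algebra_simps diff_divide_distrib)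
  have "cmod (partition_step \<alpha> \<mu> n (\<lambda>\<pi>. iexp (t * z_score \<pi>)) \<pi> - of_real (1 - V * t\<^sup>2 / (2 * m)) * iexp y)
     = cmod (of_real p * h (t * (a0 + b0)) + (\<Sum>U\<in>\<pi>. of_real (c * d U) * h (t * (a1 + b U)))
      + \<i> * of_real (t * E1) - of_real (t\<^sup>2 / 2 * (E2 - V / m)))"
    unfolding diff norm_mult by simp
  also have "\<dots> \<le> cmod (of_real p * h (t * (a0 + b0))) + cmod (\<Sum>U\<in>\<pi>. of_real (c * d U) * h (t * (a1 + b U)))
      + cmod (\<i> * of_real (t * E1)) + cmod (of_real (t\<^sup>2 / 2 * (E2 - V / m)))"
    by (intro norm_triangle_le_diff norm_triangle_le add_mono order_refl)
  also have "\<dots> \<le> (p * (4 * t\<^sup>2 * a0\<^sup>2 + 2 * \<bar>t\<bar> ^ 3 * \<bar>b0\<bar> ^ 3))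
      + (\<Sum>U\<in>\<pi>. c * d U * (4 * t\<^sup>2 * a1\<^sup>2 + 2 * \<bar>t\<bar> ^ 3 * \<bar>b U\<bar> ^ 3))
      + \<bar>t\<bar> * \<bar>E1\<bar> + t\<^sup>2 / 2 * \<bar>E2 - V / m\<bar>"
  proof (intro add_mono)
    show "cmod (of_real p * h (t * (a0 + b0))) \<le> p * (4 * t\<^sup>2 * a0\<^sup>2 + 2 * \<bar>t\<bar> ^ 3 * \<bar>b0\<bar> ^ 3)"
      using hb[of a0 b0] p by (simp add: norm_mult mult_left_mono)
    show "cmod (\<Sum>U\<in>\<pi>. of_real (c * d U) * h (t * (a1 + b U))) \<le> (\<Sum>U\<in>\<pi>. c * d U * (4 * t\<^sup>2 * a1\<^sup>2 + 2 * \<bar>t\<bar> ^ 3 * \<bar>b U\<bar> ^ 3))"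
    proof (intro order_trans[OF norm_sum] sum_mono)
      fix U assume "U \<in> \<pi>"
      then have "0 < c * d U" using c d by simp
      then show "cmod (of_real (c * d U) * h (t * (a1 + b U))) \<le> c * d U * (4 * t\<^sup>2 * a1\<^sup>2 + 2 * \<bar>t\<bar> ^ 3 * \<bar>b U\<bar> ^ 3)"
        using hb[of a1 "b U"] by (simp only: norm_mult norm_of_real abs_of_pos) (rule mult_left_mono, simp_all)
    qed
    show "cmod (\<i> * of_real (t * E1)) \<le> \<bar>t\<bar> * \<bar>E1\<bar>" by (simp add: norm_mult abs_mult)
    show "cmod (of_real (t\<^sup>2 / 2 * (E2 - V / m))) \<le> t\<^sup>2 / 2 * \<bar>E2 - V / m\<bar>"
      by (simp only: norm_of_real abs_mult) simp
  qed
  also have "\<dots> = 4 * t\<^sup>2 * A + 2 * \<bar>t\<bar> ^ 3 * C + \<bar>t\<bar> * \<bar>E1\<bar> + t\<^sup>2 / 2 * \<bar>E2 - V / m\<bar>"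
    by (simp add: A_def C_def distrib_left sum.distrib sum_distrib_left mult_ac)
  finally have main: "cmod (partition_step \<alpha> \<mu> n (\<lambda>\<pi>. iexp (t * z_score \<pi>)) \<pi> - of_real (1 - V * t\<^sup>2 / (2 * m)) * iexp y)
    \<le> 4 * t\<^sup>2 * A + 2 * \<bar>t\<bar> ^ 3 * C + \<bar>t\<bar> * \<bar>E1\<bar> + t\<^sup>2 / 2 * \<bar>E2 - V / m\<bar>" .
  have am: "0 \<le> \<alpha> / (2 * m)" "\<alpha> / (2 * m) \<le> 1 / m" "1 / m \<le> 1 / k"
    using \<alpha> k by (auto simp: field_simps)
  have a0_le: "\<bar>a0\<bar> \<le> \<bar>z\<bar> * (2 / k)"
  proof -
    have "\<bar>r - 1 + \<alpha> / (2 * m)\<bar> \<le> 1 / k + 1 / k" using r(4) am by linarith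
    then show ?thesis unfolding a0_def abs_mult by (intro mult_left_mono) auto
  qed
  have pa0: "p * a0\<^sup>2 \<le> 8 * R * \<zeta>\<^sup>2 / m"
  proof -
    have "a0\<^sup>2 \<le> (\<bar>z\<bar> * (2 / k))\<^sup>2" using power_mono[OF a0_le, of 2] by simp
    also have "\<dots> = 4 * \<zeta>\<^sup>2 / k" using k z2 by (simp add: power_mult_distrib power_divide power2_eq_square)
    finally have "p * a0\<^sup>2 \<le> (2 * R * k / m) * (4 * \<zeta>\<^sup>2 / k)" using p by (intro mult_mono) auto
    then show ?thesis using k by simp
  qed
  have pa1: "(1 - p) * a1\<^sup>2 \<le> \<zeta>\<^sup>2 / m"
  proof -
    have "\<bar>a1\<bar> \<le> \<bar>z\<bar> / m"
    proof -
      have "\<bar>a1\<bar> = \<bar>z\<bar> * (\<alpha> / (2 * m))" using a k by (simp add: a1_def abs_mult)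
      also have "\<dots> \<le> \<bar>z\<bar> * (1 / m)" using am by (intro mult_left_mono) auto
      finally show ?thesis by simp
    qed
    then have "a1\<^sup>2 \<le> (\<bar>z\<bar> / m)\<^sup>2" using power_mono[of "\<bar>a1\<bar>" "\<bar>z\<bar> / m" 2] by simp
    also have "\<dots> = \<zeta>\<^sup>2 / m * (k / m)" using z2 by (simp add: power_divide power2_eq_square)
    also have "\<dots> \<le> \<zeta>\<^sup>2 / m * 1" using k by (intro mult_left_mono) auto
    finally have "(1 - p) * a1\<^sup>2 \<le> 1 * (\<zeta>\<^sup>2 / m)" using p by (intro mult_mono) auto
    then show ?thesis by simp
  qed
  have Aeq: "A = p * a0\<^sup>2 + (1 - p) * a1\<^sup>2" by (simp add: A_def cd[symmetric] sum_distrib_right)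
  have A: "A \<le> (8 * R + 1) * e / m" "0 \<le> A"
  proof -
    have "A \<le> (8 * R + 1) * \<zeta>\<^sup>2 / m" unfolding Aeq using pa0 pa1 by (simp add: add_divide_distrib distrib_right)
    also have "\<dots> \<le> (8 * R + 1) * e / m" using R k e by (intro divide_right_mono mult_left_mono) auto
    finally show "A \<le> (8 * R + 1) * e / m" .
    show "0 \<le> A" unfolding Aeq using p by simp
  qed
  have b0: "0 \<le> b0" "b0 \<le> 1 / (\<alpha> * sk)" using r a sk by (auto simp: b0_def divide_right_mono)
  have C: "C \<le> cubic_const * e / m"
  proof -
    have "\<bar>b0\<bar> ^ 3 \<le> (1 / (\<alpha> * sk)) ^ 3" using b0 by (intro power_mono) auto
    also have "\<dots> = 1 / (\<alpha> ^ 3 * (k * sk))" using sk(2) by (simp add: power_divide power_mult_distrib power3_eq_cube mult_ac)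
    finally have "p * \<bar>b0\<bar> ^ 3 \<le> (2 * R * k / m) * (1 / (\<alpha> ^ 3 * (k * sk)))"
      using p R k by (intro mult_mono) auto
    also have "\<dots> = 2 * R / \<alpha> ^ 3 * (1 / sk) / m" using k by simp
    finally have 1: "p * \<bar>b0\<bar> ^ 3 \<le> 2 * R / \<alpha> ^ 3 * (1 / sk) / m" .
    have "(\<Sum>U\<in>\<pi>. c * d U * \<bar>b U\<bar> ^ 3) \<le> (\<Sum>U\<in>\<pi>. R / m * (1 / (1 - \<alpha>)\<^sup>2) * (1 / (k * sk)))"
    proof (rule sum_mono)
      fix U assume U: "U \<in> \<pi>"
      have "\<bar>b U\<bar> ^ 3 = 1 / ((d U * (d U)\<^sup>2) * (k * sk))"
        using d[OF U] sk by (simp add: b_def abs_mult abs_divide power_divide power_mult_distrib power3_eq_cube power2_eq_square mult_ac)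
      then have "c * d U * \<bar>b U\<bar> ^ 3 = c * (1 / (d U)\<^sup>2) * (1 / (k * sk))" using d[OF U] by simp
      also have "\<dots> \<le> R / m * (1 / (1 - \<alpha>)\<^sup>2) * (1 / (k * sk))"
        using c R k sk d[OF U] a by (intro mult_right_mono mult_mono divide_left_mono power_mono mult_pos_pos zero_less_power) auto
      finally show "c * d U * \<bar>b U\<bar> ^ 3 \<le> R / m * (1 / (1 - \<alpha>)\<^sup>2) * (1 / (k * sk))" .
    qed
    also have "\<dots> = R / (1 - \<alpha>)\<^sup>2 * (1 / sk) / m" unfolding card using k by simp
    finally have 2: "(\<Sum>U\<in>\<pi>. c * d U * \<bar>b U\<bar> ^ 3) \<le> R / (1 - \<alpha>)\<^sup>2 * (1 / sk) / m" .
    have "C \<le> 2 * R / \<alpha> ^ 3 * (1 / sk) / m + R / (1 - \<alpha>)\<^sup>2 * (1 / sk) / m" unfolding C_def using 1 2 by linarith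
    also have "\<dots> = cubic_const * (1 / sk) / m" by (simp add: cubic_const_def R_def distrib_right add_divide_distrib)
    also have "\<dots> \<le> cubic_const * e / m"
      using e k R a by (intro divide_right_mono mult_left_mono) (auto simp: cubic_const_def R_def[symmetric])
    finally show ?thesis .
  qed
  have E1: "\<bar>E1\<bar> \<le> drift_const * e / m"
  proof -
    have "(\<Sum>U\<in>\<pi>. c * d U * (a1 + b U)) = (1 - p) * a1 - c * (k / sk)"
    proof -
      have "(\<Sum>U\<in>\<pi>. c * d U * (a1 + b U)) = (\<Sum>U\<in>\<pi>. c * d U * a1 - c / sk)"
      proof (intro sum.cong refl)
        fix U assume "U \<in> \<pi>"
        then have "d U \<noteq> 0" using d(2) by force
        then show "c * d U * (a1 + b U) = c * d U * a1 - c / sk" by (simp add: b_def algebra_simps)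
      qed
      then show ?thesis
        unfolding sum_subtractf card cd[symmetric] sum_distrib_right by simp
    qed
    also have "k / sk = sk" using sk(1) sk(2)[symmetric] by simp
    finally have "E1 = (p * a0 + (1 - p) * a1) + (p * b0 - c * sk)" unfolding E1_def by (simp add: algebra_simps)
    also have "p * a0 + (1 - p) * a1 = z * (p * (r - 1 + 1 / (2 * k)) - (p - \<alpha> * k / m) / (2 * k))"
    proof -
      have u: "(p - \<alpha> * k / m) / (2 * k) = p * (1 / (2 * k)) - \<alpha> / (2 * m)" using k by (simp add: diff_divide_distrib)
      have a1': "a1 = z * (\<alpha> / (2 * m))" by (simp add: a1_def)
      have "p * (z * (r - 1 + g)) + (1 - p) * (z * g) = z * (p * (r - 1 + u) - (p * u - g))" for g u
        by (simp add: algebra_simps)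
      then show ?thesis unfolding a0_def a1' u .
    qed
    also have "p * b0 - c * sk = 1 / sk * (p / \<alpha> * (r - 1) + 1 / \<alpha> * (p - \<alpha> * k / m) - k * (c - 1 / m))"
    proof -
      have u: "1 / \<alpha> * (p - \<alpha> * k / m) = p / \<alpha> - k / m" using a by (simp add: diff_divide_distrib right_diff_distrib)
      have "P * (r - 1) + (P - k / m) - k * (c - 1 / m) = P * r - k * c" for P
        by (simp add: algebra_simps)
      then have v: "p / \<alpha> * (r - 1) + 1 / \<alpha> * (p - \<alpha> * k / m) - k * (c - 1 / m) = p / \<alpha> * r - k * c"
        unfolding u .
      show ?thesis unfolding v unfolding b0_def sk(2)[symmetric] using sk(1) by (simp add: right_diff_distrib)
    qed
    \<comment> \<open>every summand contains one of the small quantities \<open>r - 1 + 1 / (2 k)\<close>, \<open>p - \<alpha> k / m\<close>, \<open>r - 1\<close> and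
      \<open>c - 1 / m\<close>: the first order terms have cancelled\<close>
    finally have E1eq: "E1 = z * (p * (r - 1 + 1 / (2 * k)) - (p - \<alpha> * k / m) / (2 * k))
      + 1 / sk * (p / \<alpha> * (r - 1) + 1 / \<alpha> * (p - \<alpha> * k / m) - k * (c - 1 / m))" .
    have i1: "\<bar>p * (r - 1 + 1 / (2 * k))\<bar> \<le> (2 * R * k / m) * (1 / k\<^sup>2)"
      unfolding abs_mult using p r R k by (intro mult_mono) auto
    have i2: "\<bar>(p - \<alpha> * k / m) / (2 * k)\<bar> \<le> (R / m) / (2 * k)"
      unfolding abs_divide using p k by (intro frac_le) auto
    have "\<bar>p * (r - 1 + 1 / (2 * k)) - (p - \<alpha> * k / m) / (2 * k)\<bar> \<le> (2 * R * k / m) * (1 / k\<^sup>2) + (R / m) / (2 * k)"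
      using i1 i2 by linarith
    also have "\<dots> \<le> 4 * R / m / k" using k R by (simp add: power2_eq_square field_simps)
    finally have "\<bar>z\<bar> * \<bar>p * (r - 1 + 1 / (2 * k)) - (p - \<alpha> * k / m) / (2 * k)\<bar> \<le> (k * \<bar>\<zeta>\<bar>) * (4 * R / m / k)"
      using skk absz k by (intro mult_mono) (auto simp: mult_right_mono)
    then have j1: "\<bar>z * (p * (r - 1 + 1 / (2 * k)) - (p - \<alpha> * k / m) / (2 * k))\<bar> \<le> 4 * R * \<bar>\<zeta>\<bar> / m"
      using k by (simp add: abs_mult mult_ac)
    have i3: "\<bar>p / \<alpha> * (r - 1)\<bar> \<le> (2 * R * k / m) / \<alpha> * (1 / k)"
    proof -
      have "\<bar>p / \<alpha>\<bar> \<le> (2 * R * k / m) / \<alpha>"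
        using divide_right_mono[OF p(2), of \<alpha>] p(3) a by (simp add: abs_divide)
      then show ?thesis unfolding abs_mult using r(4) R k a by (intro mult_mono) auto
    qed
    have i4: "\<bar>1 / \<alpha> * (p - \<alpha> * k / m)\<bar> \<le> 1 / \<alpha> * (R / m)"
      unfolding abs_mult using p a by (intro mult_mono) auto
    have i5: "\<bar>k * (c - 1 / m)\<bar> \<le> m * (R / m\<^sup>2)"
    proof -
      have "R / 2 / m\<^sup>2 \<le> R / m\<^sup>2" using R by (intro divide_right_mono) auto
      then show ?thesis unfolding abs_mult using c k by (intro mult_mono) auto
    qed
    have "\<bar>p / \<alpha> * (r - 1) + 1 / \<alpha> * (p - \<alpha> * k / m) - k * (c - 1 / m)\<bar>
       \<le> (2 * R * k / m) / \<alpha> * (1 / k) + 1 / \<alpha> * (R / m) + m * (R / m\<^sup>2)" using i3 i4 i5 by linarith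
    also have "\<dots> = (3 * R / \<alpha> + R) / m" using k a by (simp add: power2_eq_square add_divide_distrib)
    finally have j2: "\<bar>1 / sk * (p / \<alpha> * (r - 1) + 1 / \<alpha> * (p - \<alpha> * k / m) - k * (c - 1 / m))\<bar> \<le> 1 / sk * ((3 * R / \<alpha> + R) / m)"
      unfolding abs_mult using sk by (intro mult_mono) auto
    have "\<bar>E1\<bar> \<le> 4 * R * \<bar>\<zeta>\<bar> / m + 1 / sk * ((3 * R / \<alpha> + R) / m)" unfolding E1eq using j1 j2 by linarith
    also have "\<dots> \<le> 4 * R * e / m + e * ((3 * R / \<alpha> + R) / m)"
      using e R k a by (intro add_mono divide_right_mono mult_left_mono mult_right_mono) auto
    also have "\<dots> = drift_const * e / m" by (simp add: drift_const_def R_def add_divide_distrib algebra_simps)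
    finally show ?thesis .
  qed
  have E2: "\<bar>E2 - V / m\<bar> \<le> variance_const * e / m"
  proof -
    have "(\<Sum>U\<in>\<pi>. c * d U * (a1 + b U)\<^sup>2) = (1 - p) * a1\<^sup>2 - 2 * a1 * c * sk + c * Q / k"
    proof -
      have "(\<Sum>U\<in>\<pi>. c * d U * (a1 + b U)\<^sup>2) = (\<Sum>U\<in>\<pi>. c * d U * a1\<^sup>2 - 2 * a1 * c / sk + c / k * (1 / d U))"
      proof (intro sum.cong refl)
        fix U assume "U \<in> \<pi>"
        then have "d U \<noteq> 0" using d(2) by force
        then show "c * d U * (a1 + b U)\<^sup>2 = c * d U * a1\<^sup>2 - 2 * a1 * c / sk + c / k * (1 / d U)"
          unfolding b_def sk(2)[symmetric] using sk(1) by (simp add: power2_eq_square field_simps)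
      qed
      also have "\<dots> = (1 - p) * a1\<^sup>2 - k * (2 * a1 * c / sk) + c / k * Q"
        by (simp only: sum.distrib sum_subtractf card cd[symmetric] inv[symmetric] sum_distrib_right sum_distrib_left)
      also have "k * (2 * a1 * c / sk) = 2 * a1 * c * sk" using sk(1) sk(2)[symmetric] by simp
      finally show ?thesis by simp
    qed
    then have "E2 - V / m = (p * a0\<^sup>2 + (1 - p) * a1\<^sup>2) + 2 * p * a0 * b0 + (p * b0\<^sup>2 - 1 / (\<alpha> * m)) - 2 * a1 * c * sk + (c * Q / k - q / m)"
      unfolding E2_def V_def by (simp add: power2_sum algebra_simps add_divide_distrib)
    then have E2eq: "E2 - V / m = A + 2 * p * a0 * b0 + (p * b0\<^sup>2 - 1 / (\<alpha> * m)) - 2 * a1 * c * sk + (c * Q / k - q / m)"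
      unfolding Aeq .
    have j1: "\<bar>2 * p * a0 * b0\<bar> \<le> 8 * R / \<alpha> * e / m"
    proof -
      have "\<bar>2 * p * a0 * b0\<bar> = 2 * p * \<bar>a0\<bar> * b0" using p b0 by (simp add: abs_mult)
      also have "\<dots> \<le> 2 * (2 * R * k / m) * (\<bar>z\<bar> * (2 / k)) * (1 / (\<alpha> * sk))"
        using p a0_le b0 R k by (intro mult_mono) auto
      also have "\<dots> = 8 * R / \<alpha> * \<bar>\<zeta>\<bar> / m" using k sk by (simp add: absz mult_ac)
      also have "\<dots> \<le> 8 * R / \<alpha> * e / m" using e R k a by (intro divide_right_mono mult_left_mono) auto
      finally show ?thesis .
    qed
    have j2: "\<bar>p * b0\<^sup>2 - 1 / (\<alpha> * m)\<bar> \<le> (R + 1) / \<alpha>\<^sup>2 * e / m"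
    proof -
      have "b0\<^sup>2 = 1 / (\<alpha>\<^sup>2 * (k + 1))"
      proof -
        have sk2: "sk\<^sup>2 = k" using sk(2) by (simp add: power2_eq_square)
        have "b0\<^sup>2 = (k / (k + 1)) / (\<alpha>\<^sup>2 * k)"
          unfolding b0_def power_divide power_mult_distrib r(3) sk2 ..
        then show ?thesis using k by (simp add: mult.commute)
      qed
      then have "p * b0\<^sup>2 - 1 / (\<alpha> * m) = ((p - \<alpha> * k / m) - \<alpha> / m) / (\<alpha>\<^sup>2 * (k + 1))"
      proof -
        have "(p - \<alpha> * k / m) - \<alpha> / m = p - \<alpha> / m * (k + 1)" by (simp add: algebra_simps add_divide_distrib)
        then have "((p - \<alpha> * k / m) - \<alpha> / m) / (\<alpha>\<^sup>2 * (k + 1)) = p / (\<alpha>\<^sup>2 * (k + 1)) - \<alpha> / m * (k + 1) / (\<alpha>\<^sup>2 * (k + 1))"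
          by (simp only: diff_divide_distrib)
        also have "\<alpha> / m * (k + 1) / (\<alpha>\<^sup>2 * (k + 1)) = 1 / (\<alpha> * m)" using k a by (simp add: power2_eq_square)
        finally show ?thesis using \<open>b0\<^sup>2 = 1 / (\<alpha>\<^sup>2 * (k + 1))\<close> by simp
      qed
      then have "\<bar>p * b0\<^sup>2 - 1 / (\<alpha> * m)\<bar> = \<bar>(p - \<alpha> * k / m) - \<alpha> / m\<bar> / (\<alpha>\<^sup>2 * (k + 1))"
        using k by (simp add: abs_divide abs_mult)
      also have "\<dots> \<le> ((R + 1) / m) / (\<alpha>\<^sup>2 * sk)"
      proof (rule frac_le)
        have "\<bar>\<alpha> / m\<bar> \<le> 1 / m" using \<alpha> k by (simp add: abs_divide divide_right_mono)
        then show "\<bar>(p - \<alpha> * k / m) - \<alpha> / m\<bar> \<le> (R + 1) / m" using p(1) unfolding add_divide_distrib by linarith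
        show "\<alpha>\<^sup>2 * sk \<le> \<alpha>\<^sup>2 * (k + 1)" using skk by (intro mult_left_mono) auto
      qed (use R k sk a in auto)
      also have "\<dots> = (R + 1) / \<alpha>\<^sup>2 * (1 / sk) / m" by simp
      also have "\<dots> \<le> (R + 1) / \<alpha>\<^sup>2 * e / m" using e R k a by (intro divide_right_mono mult_left_mono) auto
      finally show ?thesis .
    qed
    have j3: "\<bar>2 * a1 * c * sk\<bar> \<le> R * e / m"
    proof -
      have "\<bar>2 * a1 * c * sk\<bar> = (\<alpha> / m * \<bar>z\<bar>) * c * sk" using a k c sk by (simp add: a1_def abs_mult)
      also have "\<dots> = (\<alpha> * (c * k)) * \<bar>\<zeta>\<bar> / m" using sk(2)[symmetric] by (simp add: absz)
      also have "\<dots> \<le> (1 * (R / m * m)) * e / m"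
        using \<alpha> c k R e by (intro divide_right_mono mult_mono) auto
      finally show ?thesis using k by simp
    qed
    have j4: "\<bar>c * Q / k - q / m\<bar> \<le> (R / (1 - \<alpha>) + 1) * e / m"
    proof -
      have eq: "c * Q / k - q / m = (c - 1 / m) * (Q / k) + (Q / k - q) / m"
        by (simp add: algebra_simps diff_divide_distrib)
      have b1: "\<bar>(c - 1 / m) * (Q / k)\<bar> \<le> R / m\<^sup>2 * (1 / (1 - \<alpha>))"
      proof -
        have "R / 2 / m\<^sup>2 \<le> R / m\<^sup>2" using R by (intro divide_right_mono) auto
        moreover have "Q / k \<le> 1 / (1 - \<alpha>)" using Q k by (simp add: pos_divide_le_eq)
        ultimately show ?thesis unfolding abs_mult using c Q k R by (intro mult_mono) auto
      qed
      have b2: "R / m\<^sup>2 * (1 / (1 - \<alpha>)) \<le> R / (1 - \<alpha>) * e / m"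
      proof -
        have "1 / m \<le> 1 / sk" using skk k sk by (intro divide_left_mono) auto
        then have "1 / m \<le> e" using e by linarith
        then have "R / (1 - \<alpha>) * (1 / m) / m \<le> R / (1 - \<alpha>) * e / m" using R k a by (intro divide_right_mono mult_left_mono) auto
        then show ?thesis by (simp add: power2_eq_square mult_ac)
      qed
      have b3: "\<bar>(Q / k - q) / m\<bar> \<le> e / m" using e k by (simp add: abs_divide divide_right_mono)
      have "\<bar>c * Q / k - q / m\<bar> \<le> R / (1 - \<alpha>) * e / m + e / m"
        unfolding eq by (rule order_trans[OF abs_triangle_ineq add_mono[OF order_trans[OF b1 b2] b3]])
      then show ?thesis by (simp add: distrib_right add_divide_distrib)
    qed
    have "\<bar>E2 - V / m\<bar> \<le> (8 * R + 1) * e / m + 8 * R / \<alpha> * e / m + (R + 1) / \<alpha>\<^sup>2 * e / m + R * e / m + (R / (1 - \<alpha>) + 1) * e / m"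
      unfolding E2eq using A j1 j2 j3 j4 by linarith
    also have "\<dots> = variance_const * e / m"
      by (simp only: variance_const_def R_def[symmetric] distrib_right add_divide_distrib)
    finally show ?thesis .
  qed
  have T: "0 \<le> T" using t by linarith
  have t2: "t\<^sup>2 \<le> T * \<bar>t\<bar>"
    using mult_right_mono[OF t, of "\<bar>t\<bar>"] by (simp add: power2_eq_square)
  have t3: "\<bar>t\<bar> ^ 3 \<le> T\<^sup>2 * \<bar>t\<bar>"
  proof -
    have "\<bar>t\<bar>\<^sup>2 * \<bar>t\<bar> \<le> T\<^sup>2 * \<bar>t\<bar>" using t by (intro mult_right_mono power_mono) auto
    then show ?thesis by (simp add: power3_eq_cube power2_eq_square)
  qed
  have cub: "0 \<le> cubic_const" "0 \<le> variance_const"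
    using a R by (auto simp: cubic_const_def variance_const_def R_def[symmetric] intro!: add_nonneg_nonneg)
  have "4 * t\<^sup>2 * A + 2 * \<bar>t\<bar> ^ 3 * C + \<bar>t\<bar> * \<bar>E1\<bar> + t\<^sup>2 / 2 * \<bar>E2 - V / m\<bar>
    \<le> 4 * (T * \<bar>t\<bar>) * ((8 * R + 1) * e / m) + 2 * (T\<^sup>2 * \<bar>t\<bar>) * (cubic_const * e / m) + \<bar>t\<bar> * (drift_const * e / m)
      + (T * \<bar>t\<bar>) / 2 * (variance_const * e / m)"
  proof (intro add_mono)
    show "4 * t\<^sup>2 * A \<le> 4 * (T * \<bar>t\<bar>) * ((8 * R + 1) * e / m)" using t2 A T by (intro mult_mono) auto
    have "2 * \<bar>t\<bar> ^ 3 * C \<le> 2 * \<bar>t\<bar> ^ 3 * (cubic_const * e / m)" using C by (intro mult_left_mono) auto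
    also have "\<dots> \<le> 2 * (T\<^sup>2 * \<bar>t\<bar>) * (cubic_const * e / m)" using t3 cub e k by (intro mult_right_mono) auto
    finally show "2 * \<bar>t\<bar> ^ 3 * C \<le> 2 * (T\<^sup>2 * \<bar>t\<bar>) * (cubic_const * e / m)" .
    show "\<bar>t\<bar> * \<bar>E1\<bar> \<le> \<bar>t\<bar> * (drift_const * e / m)" using E1 by (intro mult_left_mono) auto
    show "t\<^sup>2 / 2 * \<bar>E2 - V / m\<bar> \<le> (T * \<bar>t\<bar>) / 2 * (variance_const * e / m)"
      using t2 E2 T by (intro mult_mono) auto
  qed
  also have "\<dots> = \<bar>t\<bar> / m * (step_const T * e)"
    by (simp add: step_const_def R_def[symmetric] algebra_simps add_divide_distrib)
  finally have "cmod (partition_step \<alpha> \<mu> n (\<lambda>\<pi>. iexp (t * z_score \<pi>)) \<pi> - of_real (1 - V * t\<^sup>2 / (2 * m)) * iexp y)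
    \<le> \<bar>t\<bar> / m * (step_const T * e)" using main by linarith
  then show ?thesis by (simp only: aI y_def m_def e_def zdef)
qed

end

lemma norm_integral_le:
  fixes f :: "'a \<Rightarrow> 'b::{banach, second_countable_topology}"
  assumes "integrable M f" "integrable M g" "\<And>x. x \<in> space M \<Longrightarrow> norm (f x) \<le> g x"
  shows "norm (LINT x|M. f x) \<le> (LINT x|M. g x)"
  by (rule order_trans[OF integral_norm_bound integral_mono]) (use assms in auto)

text \<open>With \<open>u = \<sigma>\<^sup>2 t\<^sup>2 / 2\<close>: contracting a centred Gaussian of variance \<open>\<sigma>\<^sup>2\<close> by \<open>1 - d\<close> and adding variance
\<open>2 \<sigma>\<^sup>2 d\<close> restores it up to second order in \<open>d\<close>.\<close>

lemma gaussian_contraction_error: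
  fixes u d :: real
  assumes u: "0 \<le> u" and d: "0 \<le> d" "2 * u * d \<le> 1"
  shows "\<bar>(1 - 2 * u * d) * exp (- u * (1 - d)\<^sup>2) - exp (- u)\<bar> \<le> (4 * u\<^sup>2 + u) * d\<^sup>2"
proof -
  define v where "v = 2 * u * d"
  define x where "x = u * d\<^sup>2"
  have v: "0 \<le> v" "v \<le> 1" using u d by (auto simp: v_def)
  have x: "0 \<le> x" using u by (simp add: x_def)
  have "- u * (1 - d)\<^sup>2 = - u + (v - x)" by (simp add: v_def x_def power2_eq_square algebra_simps)
  then have e: "(1 - v) * exp (- u * (1 - d)\<^sup>2) - exp (- u) = exp (- u) * ((1 - v) * exp (v - x) - 1)"
    by (simp only: exp_add) (simp add: algebra_simps)
  have up: "(1 - v) * exp (v - x) \<le> 1"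
  proof -
    have "(1 - v) * exp (v - x) \<le> exp (- v) * exp (v - x)"
      using exp_ge_add_one_self[of "- v"] by (intro mult_right_mono) auto
    also have "\<dots> = exp (- x)" by (simp add: exp_add[symmetric])
    also have "\<dots> \<le> 1" using x by simp
    finally show ?thesis .
  qed
  have low: "1 - (v\<^sup>2 + x) \<le> (1 - v) * exp (v - x)"
  proof -
    have "0 \<le> v * x" using v x by simp
    then have "1 - (v\<^sup>2 + x) \<le> (1 - v) * (1 + (v - x))" by (simp add: power2_eq_square algebra_simps)
    also have "\<dots> \<le> (1 - v) * exp (v - x)"
      using exp_ge_add_one_self[of "v - x"] v by (intro mult_left_mono) auto
    finally show ?thesis .
  qed
  have "\<bar>(1 - v) * exp (- u * (1 - d)\<^sup>2) - exp (- u)\<bar> = exp (- u) * \<bar>(1 - v) * exp (v - x) - 1\<bar>"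
    unfolding e abs_mult by simp
  also have "\<dots> \<le> 1 * (v\<^sup>2 + x)"
    using up low u by (intro mult_mono) auto
  also have "\<dots> = (4 * u\<^sup>2 + u) * d\<^sup>2" by (simp add: v_def x_def power_mult_distrib algebra_simps)
  finally show ?thesis by (simp add: v_def)
qed

context gibbs_chain
begin

lemma expectation_step_error: "(\<lambda>n. LINT \<omega>|M. step_error (X n \<omega>)) \<longlonglongrightarrow> 0"
proof -
  have 1: "(\<lambda>n. LINT \<omega>|M. \<bar>score (X n \<omega>) / real (card (X n \<omega>))\<bar>) \<longlonglongrightarrow> 0"
    using expectation_score_ratio by (intro expectation_abs_tendsto_0) (simp add: power_divide)
  have 2: "(\<lambda>n. LINT \<omega>|M. \<bar>sqrt (1 / real (card (X n \<omega>)))\<bar>) \<longlonglongrightarrow> 0"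
    using expectation_inverse_card by (intro expectation_abs_tendsto_0[of "\<lambda>\<pi>. sqrt (1 / real (card \<pi>))"]) simp
  let ?S = "\<lambda>n. (LINT \<omega>|M. (score (X n \<omega>))\<^sup>2 * (1 / (real (card (X n \<omega>)))\<^sup>2)) + (LINT \<omega>|M. \<bar>score (X n \<omega>) / real (card (X n \<omega>))\<bar>)
    + (LINT \<omega>|M. \<bar>sqrt (1 / real (card (X n \<omega>)))\<bar>) + (LINT \<omega>|M. \<bar>inverse_sizes (X n \<omega>) / real (card (X n \<omega>)) - sibuya_q \<alpha>\<bar>)"
  have "?S \<longlonglongrightarrow> 0 + 0 + 0 + 0"
    by (intro tendsto_add expectation_score_ratio 1 2 expectation_inverse_sizes)
  then have S: "?S \<longlonglongrightarrow> 0" by simp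
  have eq: "?S n = (LINT \<omega>|M. step_error (X n \<omega>))" if n: "1 \<le> n" for n
  proof -
    have lin: "(LINT \<omega>|M. F (X n \<omega>) + G (X n \<omega>) + H (X n \<omega>) + K (X n \<omega>))
      = (LINT \<omega>|M. F (X n \<omega>)) + (LINT \<omega>|M. G (X n \<omega>)) + (LINT \<omega>|M. H (X n \<omega>)) + (LINT \<omega>|M. K (X n \<omega>))"
      for F G H K :: "nat set set \<Rightarrow> real"
      by (simp add: integrable_X[OF n, of F] integrable_X[OF n, of G] integrable_X[OF n, of H] integrable_X[OF n, of K])
    show ?thesis
      using lin[of "\<lambda>\<pi>. (score \<pi>)\<^sup>2 * (1 / (real (card \<pi>))\<^sup>2)" "\<lambda>\<pi>. \<bar>score \<pi> / real (card \<pi>)\<bar>"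
          "\<lambda>\<pi>. \<bar>sqrt (1 / real (card \<pi>))\<bar>" "\<lambda>\<pi>. \<bar>inverse_sizes \<pi> / real (card \<pi>) - sibuya_q \<alpha>\<bar>"]
      by (simp add: step_error_def)
  qed
  show ?thesis
    by (rule Lim_transform_eventually[OF S eventually_mono[OF eventually_ge_at_top[of 1]]]) (rule eq)
qed

text \<open>The distance \<open>D n s\<close> between the weighted characteristic function and its Gaussian limit satisfies
\<open>D (n + 1) s \<approx> (1 - O(1/n)) D n ((1 - \<alpha> / (2 n)) s)\<close>. A bound of the form \<open>C \<bar>s\<bar>\<close> inherits the
contraction from the argument, so \<open>C\<close> obeys a recursion to which \<open>drift_tendsto_0\<close> applies. The weight
\<open>g (X r)\<close> is a function of every later state and passes through the recursion unchanged.\<close>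

lemma z_score_char_tendsto:
  fixes g :: "nat set set \<Rightarrow> real"
  assumes r: "1 \<le> r" and g: "\<And>\<pi>. 0 \<le> g \<pi>" "\<And>\<pi>. g \<pi> \<le> 1"
  shows "(\<lambda>n. LINT \<omega>|M. g (X r \<omega>) *\<^sub>R iexp (t * z_score (X n \<omega>)))
    \<longlonglongrightarrow> of_real ((LINT \<omega>|M. g (X r \<omega>)) * exp (- (fisher_info \<alpha> * t\<^sup>2 / 2)))"
proof -
  define I where "I = fisher_info \<alpha>"
  have I: "0 < I" using fisher_info_pos[OF \<alpha>] by (simp add: I_def)
  define T where "T = \<bar>t\<bar>"
  have T: "0 \<le> T" by (simp add: T_def)
  define W where "W \<omega> = g (X r \<omega>)" for \<omega>
  define EW where "EW = (LINT \<omega>|M. W \<omega>)"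
  have W: "0 \<le> W \<omega>" "W \<omega> \<le> 1" for \<omega> using g by (simp_all add: W_def)
  have EW: "0 \<le> EW" "EW \<le> 1"
  proof -
    show "0 \<le> EW" unfolding EW_def using W by simp
    show "EW \<le> 1" unfolding EW_def W_def using integrable_X[OF r, of g] g by (intro integral_le_const) auto
  qed
  define \<phi> where "\<phi> n s = (LINT \<omega>|M. W \<omega> *\<^sub>R iexp (s * z_score (X n \<omega>)))" for n s
  define D where "D n s = \<phi> n s - of_real (EW * exp (- (I * s\<^sup>2 / 2)))" for n s
  \<comment> \<open>from \<open>N\<close> on, \<open>r\<close> lies in the past and all factors occurring for \<open>\<bar>s\<bar> \<le> T\<close> are in \<open>[0, 1]\<close>\<close>
  define N where "N = Max {1, r, nat \<lceil>\<alpha>\<rceil>, nat \<lceil>\<alpha> * I * T\<^sup>2\<rceil>}"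
  have N: "1 \<le> N" "r \<le> N" "\<alpha> \<le> real N" "\<alpha> * I * T\<^sup>2 \<le> real N"
  proof -
    have "nat \<lceil>\<alpha>\<rceil> \<le> N" "nat \<lceil>\<alpha> * I * T\<^sup>2\<rceil> \<le> N" unfolding N_def by (intro Max_ge; simp)+
    then show "\<alpha> \<le> real N" "\<alpha> * I * T\<^sup>2 \<le> real N" by (simp_all only: nat_ceiling_le_eq)
    show "1 \<le> N" "r \<le> N" by (simp_all add: N_def)
  qed
  define K where "K = (I * T / 2 + I\<^sup>2 * T ^ 3) * \<alpha>\<^sup>2 / 4"
  have K: "0 \<le> K" using I T by (simp add: K_def)
  define e where "e n = \<bar>step_const T\<bar> * (LINT \<omega>|M. step_error (X n \<omega>)) + K / real n" for n
  have e_lim: "e \<longlonglongrightarrow> 0"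
  proof -
    have "e \<longlonglongrightarrow> \<bar>step_const T\<bar> * 0 + 0"
      unfolding e_def by (intro tendsto_add tendsto_mult tendsto_const expectation_step_error lim_const_over_n)
    then show ?thesis by simp
  qed
  have se_nonneg: "0 \<le> step_error \<pi>" for \<pi> by (simp add: step_error_def)
  have e_nonneg: "0 \<le> e n" for n
    unfolding e_def using K se_nonneg by (intro add_nonneg_nonneg mult_nonneg_nonneg integral_nonneg_AE) auto
  define B0 where "B0 = (LINT \<omega>|M. \<bar>z_score (X N \<omega>)\<bar>) + I * T / 2"
  define C where "C = rec_nat B0 (\<lambda>j b. (1 - \<alpha> / 2 / real (N + j)) * b + e (N + j) / real (N + j))"
  have C_0: "C 0 = B0" and C_Suc: "C (Suc j) = (1 - \<alpha> / 2 / real (N + j)) * C j + e (N + j) / real (N + j)" for j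
    by (simp_all add: C_def)
  have contr: "0 \<le> 1 - \<alpha> / 2 / real n \<and> 1 - \<alpha> / 2 / real n \<le> 1" if "N \<le> n" for n
  proof -
    have "\<alpha> \<le> real n" "0 < real n" using that N by auto
    then show ?thesis using \<alpha> by (simp add: field_simps)
  qed
  have C_nonneg: "0 \<le> C j" for j
  proof (induction j)
    case 0
    show ?case unfolding C_0 B0_def using I T by (intro add_nonneg_nonneg) auto
  next
    case (Suc j)
    then show ?case unfolding C_Suc using contr[of "N + j"] e_nonneg by (intro add_nonneg_nonneg mult_nonneg_nonneg divide_nonneg_nonneg) auto
  qed
  \<comment> \<open>The argument \<open>s\<close> is generalised because the induction hypothesis is used at \<open>(1 - d) s\<close>. At the start
    the bound is linear in \<open>s\<close> because \<open>exp (\<i> s z)\<close> differs from 1 by at most \<open>\<bar>s z\<bar>\<close>.\<close>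
  have bound: "cmod (D (N + j) s) \<le> C j * \<bar>s\<bar>" if "\<bar>s\<bar> \<le> T" for j s
    using that
  proof (induction j arbitrary: s)
    case 0
    have i: "integrable M (\<lambda>\<omega>. W \<omega> *\<^sub>R iexp (s * z_score (X N \<omega>)))" "integrable M W"
    proof -
      obtain G where G: "\<And>\<omega>. \<omega> \<in> space M \<Longrightarrow> X r \<omega> = G (X N \<omega>)" using X_history[OF r N(2)] by blast
      have "integrable M (\<lambda>\<omega>. g (G (X N \<omega>)) *\<^sub>R iexp (s * z_score (X N \<omega>)))"
        by (rule integrable_X[OF N(1)])
      then show "integrable M (\<lambda>\<omega>. W \<omega> *\<^sub>R iexp (s * z_score (X N \<omega>)))"
        by (rule Bochner_Integration.integrable_cong[THEN iffD1, rotated -1]) (simp_all add: W_def G)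
      show "integrable M W" unfolding W_def by (rule integrable_X[OF r])
    qed
    have "\<phi> N s - of_real EW = (LINT \<omega>|M. W \<omega> *\<^sub>R (iexp (s * z_score (X N \<omega>)) - 1))"
      unfolding \<phi>_def EW_def using i
      by (simp add: scaleR_diff_right) (simp add: scaleR_conv_of_real)
    also have "cmod \<dots> \<le> (LINT \<omega>|M. \<bar>s\<bar> * \<bar>z_score (X N \<omega>)\<bar>)"
    proof (rule norm_integral_le)
      show "integrable M (\<lambda>\<omega>. W \<omega> *\<^sub>R (iexp (s * z_score (X N \<omega>)) - 1))"
        using i by (simp add: scaleR_diff_right)
      show "integrable M (\<lambda>\<omega>. \<bar>s\<bar> * \<bar>z_score (X N \<omega>)\<bar>)" by (rule integrable_X[OF N(1)])
      fix \<omega>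
      have "cmod (W \<omega> *\<^sub>R (iexp (s * z_score (X N \<omega>)) - 1)) \<le> 1 * \<bar>s * z_score (X N \<omega>)\<bar>"
        unfolding norm_scaleR using W iexp_approx1[of "s * z_score (X N \<omega>)" 0] by (intro mult_mono) auto
      then show "cmod (W \<omega> *\<^sub>R (iexp (s * z_score (X N \<omega>)) - 1)) \<le> \<bar>s\<bar> * \<bar>z_score (X N \<omega>)\<bar>"
        by (simp add: abs_mult)
    qed
    also have "\<dots> = \<bar>s\<bar> * (LINT \<omega>|M. \<bar>z_score (X N \<omega>)\<bar>)" by simp
    finally have 1: "cmod (\<phi> N s - of_real EW) \<le> \<bar>s\<bar> * (LINT \<omega>|M. \<bar>z_score (X N \<omega>)\<bar>)" .
    have "\<bar>EW - EW * exp (- (I * s\<^sup>2 / 2))\<bar> = EW * \<bar>1 - exp (- (I * s\<^sup>2 / 2))\<bar>"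
    proof -
      have "EW - EW * exp (- (I * s\<^sup>2 / 2)) = EW * (1 - exp (- (I * s\<^sup>2 / 2)))" by (simp add: right_diff_distrib)
      then show ?thesis using EW by (simp only: abs_mult abs_of_nonneg)
    qed
    also have "\<dots> \<le> 1 * (I * s\<^sup>2 / 2)"
    proof (intro mult_mono EW)
      have "exp (- (I * s\<^sup>2 / 2)) \<le> 1" using I by simp
      then show "\<bar>1 - exp (- (I * s\<^sup>2 / 2))\<bar> \<le> I * s\<^sup>2 / 2"
        using exp_ge_add_one_self[of "- (I * s\<^sup>2 / 2)"] by linarith
    qed auto
    also have "\<dots> \<le> \<bar>s\<bar> * (I * T / 2)"
    proof -
      have "\<bar>s\<bar> * \<bar>s\<bar> \<le> \<bar>s\<bar> * T" using 0 by (intro mult_left_mono) auto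
      then have "I * (\<bar>s\<bar> * \<bar>s\<bar>) \<le> I * (\<bar>s\<bar> * T)" by (rule mult_left_mono) (use I in simp)
      then have "I * (\<bar>s\<bar> * \<bar>s\<bar>) / 2 \<le> I * (\<bar>s\<bar> * T) / 2" by (rule divide_right_mono) simp
      then show ?thesis by (simp add: power2_eq_square mult_ac del: mult_le_cancel_left_pos)
    qed
    finally have 2: "\<bar>EW - EW * exp (- (I * s\<^sup>2 / 2))\<bar> \<le> \<bar>s\<bar> * (I * T / 2)" .
    have "D N s = (\<phi> N s - of_real EW) + of_real (EW - EW * exp (- (I * s\<^sup>2 / 2)))" by (simp add: D_def)
    also have "cmod \<dots> \<le> \<bar>s\<bar> * (LINT \<omega>|M. \<bar>z_score (X N \<omega>)\<bar>) + \<bar>s\<bar> * (I * T / 2)"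
      by (rule order_trans[OF norm_triangle_ineq add_mono[OF 1]]) (use 2 in \<open>simp only: norm_of_real\<close>)
    finally show ?case unfolding C_0 B0_def by (simp add: distrib_left mult.commute)
  next
    case (Suc j s)
    define n where "n = N + j"
    have n: "N \<le> n" "1 \<le> n" "r \<le> n" "0 < real n" using N by (auto simp: n_def)
    obtain G where G: "\<And>\<omega>. \<omega> \<in> space M \<Longrightarrow> X r \<omega> = G (X n \<omega>)" using X_history[OF r n(3)] by blast
    have WG: "W \<omega> = g (G (X n \<omega>))" if "\<omega> \<in> space M" for \<omega> by (simp add: W_def G[OF that])
    define d where "d = \<alpha> / (2 * real n)"
    define s' where "s' = s * (1 - d)"
    define lam where "lam = 1 - \<alpha> * I * s\<^sup>2 / (2 * real n)"
    have d: "0 \<le> d" "0 \<le> 1 - d" "1 - d \<le> 1" "1 - d = 1 - \<alpha> / 2 / real n" using contr[OF n(1)] \<alpha> by (simp_all add: d_def)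
    have s': "\<bar>s'\<bar> = \<bar>s\<bar> * (1 - d)" using d by (simp add: s'_def abs_mult)
    have s'T: "\<bar>s'\<bar> \<le> T" using Suc.prems d mult_left_mono[OF d(3), of "\<bar>s\<bar>"] unfolding s' by simp
    define u where "u = I * s\<^sup>2 / 2"
    have s2: "s\<^sup>2 \<le> T\<^sup>2" using Suc.prems T by (simp add: abs_le_square_iff[symmetric])
    have u: "0 \<le> u" "u \<le> I * T * \<bar>s\<bar> / 2" "u \<le> I * T\<^sup>2 / 2"
    proof -
      have "\<bar>s\<bar> * \<bar>s\<bar> \<le> T * \<bar>s\<bar>" using Suc.prems by (intro mult_right_mono) auto
      then have "I * (\<bar>s\<bar> * \<bar>s\<bar>) \<le> I * (T * \<bar>s\<bar>)" by (rule mult_left_mono) (use I in simp)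
      then have "I * (\<bar>s\<bar> * \<bar>s\<bar>) / 2 \<le> I * (T * \<bar>s\<bar>) / 2" by (rule divide_right_mono) simp
      then show "u \<le> I * T * \<bar>s\<bar> / 2" by (simp add: u_def power2_eq_square mult_ac)
      show "0 \<le> u" using I by (simp add: u_def)
      show "u \<le> I * T\<^sup>2 / 2" using I s2 by (simp add: u_def)
    qed
    have lamu: "lam = 1 - 2 * u * d" by (simp add: lam_def u_def d_def)
    have ud: "2 * u * d \<le> 1"
    proof -
      have "2 * u * d \<le> 2 * (I * T\<^sup>2 / 2) * d" using u d by (intro mult_right_mono mult_left_mono) auto
      also have "\<dots> = \<alpha> * I * T\<^sup>2 / (2 * real n)" by (simp add: d_def)
      also have "\<dots> \<le> 1"
      proof -
        have "\<alpha> * I * T\<^sup>2 \<le> real n" using N n by linarith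
        then show ?thesis using n by simp
      qed
      finally show ?thesis .
    qed
    have "0 \<le> 2 * u * d" using u(1) d(1) by (intro mult_nonneg_nonneg) auto
    then have lam: "0 \<le> lam" "lam \<le> 1" using ud unfolding lamu by simp_all
    define F where "F \<pi> = partition_step \<alpha> \<mu> n (\<lambda>\<pi>. iexp (s * z_score \<pi>)) \<pi> - of_real lam * iexp (s' * z_score \<pi>)" for \<pi>
    have F: "cmod (F \<pi>) \<le> \<bar>s\<bar> / real n * (step_const T * step_error \<pi>)" if "partition_on {1..n} \<pi>" for \<pi>
      using partition_step_iexp[OF that n(2) Suc.prems] by (simp add: F_def lam_def s'_def d_def I_def)
    have "\<phi> (Suc n) s = (LINT \<omega>|M. g (G (X n \<omega>)) *\<^sub>R iexp (s * z_score (X (Suc n) \<omega>)))"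
      unfolding \<phi>_def by (intro Bochner_Integration.integral_cong refl) (simp add: WG)
    also have "\<dots> = (LINT \<omega>|M. g (G (X n \<omega>)) *\<^sub>R partition_step \<alpha> \<mu> n (\<lambda>\<pi>. iexp (s * z_score \<pi>)) (X n \<omega>))"
      by (rule expectation_step[OF n(2), where G = "\<lambda>\<pi>. g (G \<pi>)"])
    also have "\<dots> = (LINT \<omega>|M. g (G (X n \<omega>)) *\<^sub>R F (X n \<omega>) + of_real lam * (g (G (X n \<omega>)) *\<^sub>R iexp (s' * z_score (X n \<omega>))))"
      by (intro Bochner_Integration.integral_cong refl) (simp add: F_def scaleR_conv_of_real algebra_simps)
    also have "\<dots> = (LINT \<omega>|M. g (G (X n \<omega>)) *\<^sub>R F (X n \<omega>)) + of_real lam * (LINT \<omega>|M. g (G (X n \<omega>)) *\<^sub>R iexp (s' * z_score (X n \<omega>)))"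
    proof -
      have lin: "(LINT \<omega>|M. f \<omega> + c * h \<omega>) = (LINT \<omega>|M. f \<omega>) + c * (LINT \<omega>|M. h \<omega>)"
        if "integrable M f" "integrable M h" for f h :: "'w \<Rightarrow> complex" and c
        using that by simp
      show ?thesis by (rule lin; rule integrable_X[OF n(2)])
    qed
    also have "(LINT \<omega>|M. g (G (X n \<omega>)) *\<^sub>R iexp (s' * z_score (X n \<omega>))) = \<phi> n s'"
      unfolding \<phi>_def by (intro Bochner_Integration.integral_cong refl) (simp add: WG)
    finally have \<phi>_Suc: "\<phi> (Suc n) s = (LINT \<omega>|M. g (G (X n \<omega>)) *\<^sub>R F (X n \<omega>)) + of_real lam * \<phi> n s'" .
    have 1: "cmod (LINT \<omega>|M. g (G (X n \<omega>)) *\<^sub>R F (X n \<omega>)) \<le> \<bar>s\<bar> / real n * (\<bar>step_const T\<bar> * (LINT \<omega>|M. step_error (X n \<omega>)))"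
    proof -
      have "cmod (LINT \<omega>|M. g (G (X n \<omega>)) *\<^sub>R F (X n \<omega>)) \<le> (LINT \<omega>|M. \<bar>s\<bar> / real n * (\<bar>step_const T\<bar> * step_error (X n \<omega>)))"
      proof (rule norm_integral_le)
        show "integrable M (\<lambda>\<omega>. g (G (X n \<omega>)) *\<^sub>R F (X n \<omega>))" by (rule integrable_X[OF n(2)])
        show "integrable M (\<lambda>\<omega>. \<bar>s\<bar> / real n * (\<bar>step_const T\<bar> * step_error (X n \<omega>)))" by (rule integrable_X[OF n(2)])
        fix \<omega> assume \<omega>: "\<omega> \<in> space M"
        have "cmod (g (G (X n \<omega>)) *\<^sub>R F (X n \<omega>)) \<le> 1 * (\<bar>s\<bar> / real n * (\<bar>step_const T\<bar> * step_error (X n \<omega>)))"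
          unfolding norm_scaleR
        proof (intro mult_mono)
          show "cmod (F (X n \<omega>)) \<le> \<bar>s\<bar> / real n * (\<bar>step_const T\<bar> * step_error (X n \<omega>))"
          proof (rule order_trans[OF F[OF X_partition[OF n(2) \<omega>]]])
            show "\<bar>s\<bar> / real n * (step_const T * step_error (X n \<omega>)) \<le> \<bar>s\<bar> / real n * (\<bar>step_const T\<bar> * step_error (X n \<omega>))"
              using se_nonneg by (intro mult_left_mono mult_right_mono) auto
          qed
        qed (use g in auto)
        then show "cmod (g (G (X n \<omega>)) *\<^sub>R F (X n \<omega>)) \<le> \<bar>s\<bar> / real n * (\<bar>step_const T\<bar> * step_error (X n \<omega>))" by simp
      qed
      then show ?thesis by simp
    qed
    have 2: "\<bar>lam * exp (- (I * s'\<^sup>2 / 2)) - exp (- (I * s\<^sup>2 / 2))\<bar> \<le> \<bar>s\<bar> / real n * (K / real n)"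
    proof -
      have s'u: "- (I * s'\<^sup>2 / 2) = - u * (1 - d)\<^sup>2" "- (I * s\<^sup>2 / 2) = - u"
        by (simp_all add: s'_def u_def power_mult_distrib)
      have "\<bar>lam * exp (- (I * s'\<^sup>2 / 2)) - exp (- (I * s\<^sup>2 / 2))\<bar> \<le> (4 * u\<^sup>2 + u) * d\<^sup>2"
        unfolding s'u lamu by (rule gaussian_contraction_error[OF u(1) d(1) ud])
      also have "\<dots> \<le> (4 * ((I * T * \<bar>s\<bar> / 2) * (I * T\<^sup>2 / 2)) + I * T * \<bar>s\<bar> / 2) * d\<^sup>2"
      proof (intro mult_right_mono add_mono mult_left_mono)
        show "u\<^sup>2 \<le> (I * T * \<bar>s\<bar> / 2) * (I * T\<^sup>2 / 2)"
          unfolding power2_eq_square[of u] using u I T by (intro mult_mono) auto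
      qed (use u in auto)
      also have "\<dots> = \<bar>s\<bar> / real n * (K / real n)"
        by (simp add: K_def d_def power2_eq_square power3_eq_cube algebra_simps add_divide_distrib)
      finally show ?thesis .
    qed
    have "D (Suc n) s = (LINT \<omega>|M. g (G (X n \<omega>)) *\<^sub>R F (X n \<omega>)) + of_real lam * D n s'
       + of_real (EW * (lam * exp (- (I * s'\<^sup>2 / 2)) - exp (- (I * s\<^sup>2 / 2))))"
      unfolding D_def \<phi>_Suc by (simp add: algebra_simps)
    also have "cmod \<dots> \<le> \<bar>s\<bar> / real n * (\<bar>step_const T\<bar> * (LINT \<omega>|M. step_error (X n \<omega>)))
        + 1 * (C j * \<bar>s'\<bar>) + 1 * (\<bar>s\<bar> / real n * (K / real n))"
    proof (intro norm_triangle_le add_mono 1)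
      show "cmod (of_real lam * D n s') \<le> 1 * (C j * \<bar>s'\<bar>)"
        unfolding norm_mult n_def using lam Suc.IH[OF s'T] by (intro mult_mono) auto
      show "cmod (of_real (EW * (lam * exp (- (I * s'\<^sup>2 / 2)) - exp (- (I * s\<^sup>2 / 2))))) \<le> 1 * (\<bar>s\<bar> / real n * (K / real n))"
        unfolding norm_of_real abs_mult[of EW] using EW 2 by (intro mult_mono) auto
    qed
    also have "\<dots> = C (Suc j) * \<bar>s\<bar>"
      unfolding C_Suc n_def[symmetric] e_def s' d(4) by (simp add: algebra_simps add_divide_distrib)
    finally show ?case by (simp add: n_def)
  qed
  have "(\<lambda>n. C (n - N)) \<longlonglongrightarrow> 0"
  proof (rule drift_tendsto_0[OF _ _ _ e_lim, where a = "\<alpha> / 2"])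
    show "\<forall>\<^sub>F n in sequentially. C (Suc n - N) \<le> (1 - \<alpha> / 2 / real n) * C (n - N) + e n / real n"
      using eventually_ge_at_top[of N]
    proof eventually_elim
      case (elim n)
      then show ?case using C_Suc[of "n - N"] by (simp add: Suc_diff_le)
    qed
  qed (use \<alpha> C_nonneg in auto)
  from tendsto_mult_left[OF this, of "\<bar>t\<bar>"] have lim: "(\<lambda>n. \<bar>t\<bar> * C (n - N)) \<longlonglongrightarrow> 0" by simp
  have "(\<lambda>n. D n t) \<longlonglongrightarrow> 0"
  proof (rule Lim_null_comparison[OF _ lim])
    show "\<forall>\<^sub>F n in sequentially. cmod (D n t) \<le> \<bar>t\<bar> * C (n - N)"
      using eventually_ge_at_top[of N]
    proof eventually_elim
      case (elim n)
      then show ?case using bound[of t "n - N"] by (simp add: T_def mult.commute)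
    qed
  qed
  then have "(\<lambda>n. D n t + of_real (EW * exp (- (I * t\<^sup>2 / 2)))) \<longlonglongrightarrow> 0 + of_real (EW * exp (- (I * t\<^sup>2 / 2)))"
    by (intro tendsto_add tendsto_const)
  then show ?thesis by (simp add: D_def \<phi>_def W_def EW_def I_def)
qed

end

section \<open>The quasi-maximum likelihood estimator and the total variation distance\<close>

definition likelihood_score :: "nat set set \<Rightarrow> real \<Rightarrow> real" where
  "likelihood_score \<pi> x = (real (card \<pi>) - 1) / x - block_sum (sibuya_harm x) \<pi>"

text \<open>Groups blocks by size; since \<open>h 1 = 0\<close>, singletons do not contribute and the sum may start at 2.\<close>

lemma sum_num_blocks_of_size:
  assumes part: "partition_on {1..n} \<pi>" and n: "1 \<le> n" and h: "h 1 = 0"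
  shows "(\<Sum>j=2..n. real (num_blocks_of_size \<pi> j) * h j) = block_sum h \<pi>"
proof -
  have size: "card U \<in> {1..n}" if "U \<in> \<pi>" for U
  proof -
    have "card U \<le> n" using card_mono[OF _ partition_block(3)[OF part that]] by simp
    then show ?thesis using partition_block(5)[OF part that] by simp
  qed
  have "block_sum h \<pi> = (\<Sum>j\<in>{1..n}. \<Sum>U\<in>{U \<in> \<pi>. card U = j}. h (card U))"
    unfolding block_sum_def by (rule sum.group[symmetric]) (use size partition_finite[OF part] in auto)
  also have "\<dots> = (\<Sum>j\<in>{1..n}. real (num_blocks_of_size \<pi> j) * h j)"
    by (intro sum.cong refl) (simp add: num_blocks_of_size_def)
  also have "{1..n} = insert 1 {2..n}" using n by auto
  also have "(\<Sum>j\<in>insert 1 {2..n}. real (num_blocks_of_size \<pi> j) * h j) = (\<Sum>j=2..n. real (num_blocks_of_size \<pi> j) * h j)"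
    using h by simp
  finally show ?thesis ..
qed

lemma sibuya_harm_mono:
  assumes "x \<le> y" "y < 1"
  shows "sibuya_harm x j \<le> sibuya_harm y j"
  unfolding sibuya_harm_def using assms by (intro sum_mono frac_le) auto

lemma likelihood_score_strict_decreasing:
  assumes "0 < x" "x < y" "y < 1" "1 < card \<pi>"
  shows "likelihood_score \<pi> y < likelihood_score \<pi> x"
proof -
  have "(real (card \<pi>) - 1) / y < (real (card \<pi>) - 1) / x"
    using assms by (intro divide_strict_left_mono) auto
  moreover have "block_sum (sibuya_harm x) \<pi> \<le> block_sum (sibuya_harm y) \<pi>"
    unfolding block_sum_def using assms by (intro sum_mono sibuya_harm_mono) auto
  ultimately show ?thesis by (simp add: likelihood_score_def)
qed

text \<open>A change of sign is impossible for \<open>card \<pi> = 1\<close>, where the score is never positive, and for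
\<open>card \<pi> = n\<close>, where it is never negative. In the remaining case the estimator is the unique zero of a
continuous decreasing function.\<close>

lemma qmle_between:
  assumes part: "partition_on {1..n} \<pi>" and n: "1 \<le> n"
    and ab: "0 < a" "a < b" "b < 1"
    and sign: "0 < likelihood_score \<pi> a" "likelihood_score \<pi> b < 0"
  shows "a < qmle n \<pi> \<and> qmle n \<pi> < b"
proof -
  have k: "1 \<le> card \<pi>" "card \<pi> \<le> n" using partition_card_pos partition_card_le part n by auto
  have harm: "0 \<le> block_sum (sibuya_harm x) \<pi>" if "0 < x" "x < 1" for x
    unfolding block_sum_def using sibuya_harm_nonneg[OF that] by (intro sum_nonneg) auto
  have k1: "1 < card \<pi>"
  proof (rule ccontr)
    assume "\<not> 1 < card \<pi>"
    then have "card \<pi> = 1" using k by simp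
    then show False using sign(1) harm[of a] ab by (simp add: likelihood_score_def)
  qed
  have kn: "card \<pi> \<noteq> n"
  proof
    assume eq: "card \<pi> = n"
    have "(\<Sum>U\<in>\<pi>. card U) = (\<Sum>U\<in>\<pi>. 1)" using partition_sum_card[OF part] eq by simp
    then have "\<forall>U\<in>\<pi>. 1 = card U"
      using partition_block(5)[OF part] partition_finite[OF part]
      by (intro sum_mono_inv[of "\<lambda>_. 1" \<pi> card, THEN ballI[rotated]]) auto
    then have "sibuya_harm b (card U) = 0" if "U \<in> \<pi>" for U
      using that sibuya_harm_1[of b] by (metis One_nat_def)
    then have "block_sum (sibuya_harm b) \<pi> = 0" unfolding block_sum_def by (intro sum.neutral) blast
    moreover have "0 \<le> (real (card \<pi>) - 1) / b" using k1 ab by simp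
    ultimately show False using sign(2) by (simp add: likelihood_score_def)
  qed
  have eq: "(real (card \<pi>) - 1) / x - (\<Sum>j=2..n. real (num_blocks_of_size \<pi> j) * (\<Sum>i=1..<j. 1 / (real i - x)))
      = likelihood_score \<pi> x" for x
    unfolding likelihood_score_def sum_num_blocks_of_size[OF part n, of "sibuya_harm x", symmetric, simplified]
    by (simp add: sibuya_harm_def)
  have "continuous_on {a..b} (likelihood_score \<pi>)"
    unfolding likelihood_score_def block_sum_def sibuya_harm_def using ab by (intro continuous_intros) auto
  then obtain x where x: "a \<le> x" "x \<le> b" "likelihood_score \<pi> x = 0"
    using IVT2'[of "likelihood_score \<pi>" b 0 a] sign ab by auto
  have xab: "a < x" "x < b" using x sign by (auto simp: order.order_iff_strict)
  have "qmle n \<pi> = (THE x. 0 < x \<and> x < 1 \<and> likelihood_score \<pi> x = 0)"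
    unfolding qmle_def eq using k1 kn by simp
  also have "\<dots> = x"
  proof (rule the_equality)
    show "0 < x \<and> x < 1 \<and> likelihood_score \<pi> x = 0" using x ab by auto
    fix y assume y: "0 < y \<and> y < 1 \<and> likelihood_score \<pi> y = 0"
    show "y = x"
    proof (rule ccontr)
      assume "y \<noteq> x"
      then consider "y < x" | "x < y" by linarith
      then show False
        using likelihood_score_strict_decreasing[of y x \<pi>] likelihood_score_strict_decreasing[of x y \<pi>] x y ab k1
        by cases auto
    qed
  qed
  finally show ?thesis using xab by simp
qed

context gibbs_mixture
begin

text \<open>The derivative of \<open>sibuya_harm\<close> at \<open>\<alpha>\<close>: what a block of size \<open>j\<close> contributes to the observed
information.\<close>

definition info_harm :: "nat \<Rightarrow> real" where
  "info_harm j = (\<Sum>i=1..<j. 1 / (real i - \<alpha>)\<^sup>2)"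

definition info_limit :: real where
  "info_limit = (\<Sum>i. 1 / (real (Suc i) - \<alpha>)\<^sup>2)"

definition observed_info :: "nat set set \<Rightarrow> real" where
  "observed_info \<pi> = (real (card \<pi>) - 1) / \<alpha>\<^sup>2 + block_sum info_harm \<pi>"

lemma summable_info: "summable (\<lambda>i. 1 / (real (Suc i) - \<alpha>)\<^sup>2)"
proof (rule summable_comparison_test[OF _ summable_inverse_Suc_squares[of "1 / (1 - \<alpha>)\<^sup>2"]], intro exI allI impI)
  fix i :: nat
  have "\<alpha> * 1 \<le> \<alpha> * real (Suc i)" using \<alpha> by (intro mult_left_mono) auto
  then have "(1 - \<alpha>) * real (Suc i) \<le> real (Suc i) - \<alpha>" by (simp add: algebra_simps)
  then have "((1 - \<alpha>) * real (Suc i))\<^sup>2 \<le> (real (Suc i) - \<alpha>)\<^sup>2" using \<alpha> by (intro power_mono) auto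
  moreover have "0 < ((1 - \<alpha>) * real (Suc i))\<^sup>2" using \<alpha> by (simp del: of_nat_Suc)
  ultimately have "1 / (real (Suc i) - \<alpha>)\<^sup>2 \<le> 1 / ((1 - \<alpha>) * real (Suc i))\<^sup>2" by (intro frac_le) auto
  then show "norm (1 / (real (Suc i) - \<alpha>)\<^sup>2) \<le> 1 / (1 - \<alpha>)\<^sup>2 * (1 / (real (Suc i))\<^sup>2)"
    by (simp add: power_mult_distrib del: of_nat_Suc)
qed

lemma info_harm_Suc_eq: "info_harm (Suc j) = (\<Sum>i<j. 1 / (real (Suc i) - \<alpha>)\<^sup>2)"
proof -
  have "{1..<Suc j} = Suc ` {..<j}" by (auto simp: image_iff Suc_le_eq gr0_conv_Suc)
  then show ?thesis unfolding info_harm_def by (simp add: sum.reindex del: of_nat_Suc)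
qed

lemma info_harm_bounds: "0 \<le> info_harm j" "info_harm j \<le> info_limit"
proof -
  show "0 \<le> info_harm j" unfolding info_harm_def by (intro sum_nonneg) auto
  show "info_harm j \<le> info_limit"
  proof (cases j)
    case 0
    then show ?thesis unfolding info_limit_def info_harm_def by (simp add: suminf_nonneg summable_info del: of_nat_Suc)
  next
    case (Suc i)
    show ?thesis unfolding Suc info_harm_Suc_eq info_limit_def
      by (intro sum_le_suminf summable_info) auto
  qed
qed

lemma info_harm_tendsto: "info_harm \<longlonglongrightarrow> info_limit"
proof -
  have "(\<lambda>j. info_harm (Suc j)) \<longlonglongrightarrow> info_limit"
    unfolding info_harm_Suc_eq info_limit_def by (rule summable_LIMSEQ[OF summable_info])
  then show ?thesis by (rule LIMSEQ_imp_Suc)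
qed

definition remainder_const :: real where
  "remainder_const = 2 / \<alpha> ^ 3 + 2 * info_limit / (1 - \<alpha>)"

text \<open>Summing the exact identity \<open>1 / v = 1 / w + (w - v) / w\<^sup>2 + (w - v)\<^sup>2 / (v w\<^sup>2)\<close> gives a second order
expansion. The sums of \<open>1 / (i - \<alpha>)\<^sup>2\<close> stay bounded, so each block contributes a bounded multiple of
\<open>(x - \<alpha>)\<^sup>2\<close> to the remainder.\<close>

lemma likelihood_score_expansion:
  assumes x: "\<alpha> / 2 \<le> x" "x \<le> (1 + \<alpha>) / 2" and k: "1 \<le> card \<pi>"
  shows "\<bar>likelihood_score \<pi> x - (score \<pi> - observed_info \<pi> * (x - \<alpha>))\<bar> \<le> remainder_const * real (card \<pi>) * (x - \<alpha>)\<^sup>2"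
proof -
  let ?k = "real (card \<pi>)"
  have x0: "0 < x" "x < 1" using x \<alpha> by auto
  define \<rho> where "\<rho> j = (\<Sum>i=1..<j. 1 / ((real i - x) * (real i - \<alpha>)\<^sup>2))" for j
  have harm: "sibuya_harm x j = sibuya_harm \<alpha> j + (x - \<alpha>) * info_harm j + (x - \<alpha>)\<^sup>2 * \<rho> j" for j
    unfolding sibuya_harm_def info_harm_def \<rho>_def sum_distrib_left sum.distrib[symmetric]
  proof (intro sum.cong refl)
    fix i assume "i \<in> {1..<j}"
    then have "1 \<le> real i" by simp
    then have nz: "real i - x \<noteq> 0" "real i - \<alpha> \<noteq> 0" using x0 \<alpha> by auto
    have "1 / v = 1 / w + (w - v) * (1 / w\<^sup>2) + (w - v)\<^sup>2 * (1 / (v * w\<^sup>2))" if "v \<noteq> 0" "w \<noteq> 0" for v w :: real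
    proof -
      have "1 / w + (w - v) * (1 / w\<^sup>2) + (w - v)\<^sup>2 * (1 / (v * w\<^sup>2)) = (v * w + (w - v) * v + (w - v)\<^sup>2) / (v * w\<^sup>2)"
        using that by (simp add: add_divide_distrib power2_eq_square)
      also have "v * w + (w - v) * v + (w - v)\<^sup>2 = w\<^sup>2" by (simp add: power2_eq_square algebra_simps)
      finally show ?thesis using that by simp
    qed
    from this[OF nz] show "1 / (real i - x) = 1 / (real i - \<alpha>) + (x - \<alpha>) * (1 / (real i - \<alpha>)\<^sup>2) + (x - \<alpha>)\<^sup>2 * (1 / ((real i - x) * (real i - \<alpha>)\<^sup>2))"
      by simp
  qed
  have rho: "0 \<le> \<rho> j" "\<rho> j \<le> 2 / (1 - \<alpha>) * info_limit" for j
  proof -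
    have pos: "(1 - \<alpha>) / 2 \<le> real i - x" "0 < real i - x" "0 < real i - \<alpha>" if "i \<in> {1..<j}" for i
    proof -
      have "1 \<le> real i" using that by simp
      then show "(1 - \<alpha>) / 2 \<le> real i - x" "0 < real i - x" "0 < real i - \<alpha>" using x x0 \<alpha> by argo+
    qed
    show "0 \<le> \<rho> j" unfolding \<rho>_def using pos by (intro sum_nonneg) (simp add: less_imp_le)
    have "\<rho> j \<le> (\<Sum>i=1..<j. 2 / (1 - \<alpha>) * (1 / (real i - \<alpha>)\<^sup>2))"
      unfolding \<rho>_def
    proof (rule sum_mono)
      fix i assume i: "i \<in> {1..<j}"
      have "1 / ((real i - x) * (real i - \<alpha>)\<^sup>2) \<le> 1 / ((1 - \<alpha>) / 2 * (real i - \<alpha>)\<^sup>2)"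
        using pos[OF i] \<alpha> by (intro divide_left_mono mult_right_mono mult_pos_pos) auto
      then show "1 / ((real i - x) * (real i - \<alpha>)\<^sup>2) \<le> 2 / (1 - \<alpha>) * (1 / (real i - \<alpha>)\<^sup>2)" by simp
    qed
    also have "\<dots> = 2 / (1 - \<alpha>) * info_harm j" by (simp add: info_harm_def sum_distrib_left)
    also have "\<dots> \<le> 2 / (1 - \<alpha>) * info_limit" using info_harm_bounds \<alpha> by (intro mult_left_mono) auto
    finally show "\<rho> j \<le> 2 / (1 - \<alpha>) * info_limit" .
  qed
  have inv: "1 / x = 1 / \<alpha> - (x - \<alpha>) / \<alpha>\<^sup>2 + (x - \<alpha>)\<^sup>2 / (x * \<alpha>\<^sup>2)"
  proof -
    have "1 / \<alpha> - (x - \<alpha>) / \<alpha>\<^sup>2 + (x - \<alpha>)\<^sup>2 / (x * \<alpha>\<^sup>2) = (x * \<alpha> - (x - \<alpha>) * x + (x - \<alpha>)\<^sup>2) / (x * \<alpha>\<^sup>2)"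
      using x0 \<alpha> by (simp add: add_divide_distrib diff_divide_distrib power2_eq_square)
    also have "x * \<alpha> - (x - \<alpha>) * x + (x - \<alpha>)\<^sup>2 = \<alpha>\<^sup>2" by (simp add: power2_eq_square algebra_simps)
    finally show ?thesis using x0 \<alpha> by simp
  qed
  have bs: "block_sum (sibuya_harm x) \<pi> = block_sum (sibuya_harm \<alpha>) \<pi> + (x - \<alpha>) * block_sum info_harm \<pi> + (x - \<alpha>)\<^sup>2 * block_sum \<rho> \<pi>"
    unfolding block_sum_def harm sum.distrib sum_distrib_left ..
  have "(?k - 1) / x = (?k - 1) * (1 / x)" by simp
  also have "\<dots> = (?k - 1) / \<alpha> - (?k - 1) / \<alpha>\<^sup>2 * (x - \<alpha>) + (x - \<alpha>)\<^sup>2 * ((?k - 1) / (x * \<alpha>\<^sup>2))"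
  proof -
    have "K * (1 / u - y / v + q / w) = K / u - K / v * y + q * (K / w)" for K u y v q w :: real
      by (simp add: algebra_simps)
    then show ?thesis unfolding inv .
  qed
  finally have kx: "(?k - 1) / x = (?k - 1) / \<alpha> - (?k - 1) / \<alpha>\<^sup>2 * (x - \<alpha>) + (x - \<alpha>)\<^sup>2 * ((?k - 1) / (x * \<alpha>\<^sup>2))" .
  have "likelihood_score \<pi> x - (score \<pi> - observed_info \<pi> * (x - \<alpha>)) = (x - \<alpha>)\<^sup>2 * ((?k - 1) / (x * \<alpha>\<^sup>2) - block_sum \<rho> \<pi>)"
    unfolding likelihood_score_def kx bs score_def observed_info_def by (simp only: algebra_simps)
  then have "\<bar>likelihood_score \<pi> x - (score \<pi> - observed_info \<pi> * (x - \<alpha>))\<bar> = (x - \<alpha>)\<^sup>2 * \<bar>(?k - 1) / (x * \<alpha>\<^sup>2) - block_sum \<rho> \<pi>\<bar>"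
    by (simp add: abs_mult)
  also have "\<dots> \<le> (x - \<alpha>)\<^sup>2 * (remainder_const * ?k)"
  proof (intro mult_left_mono)
    have a: "0 \<le> (?k - 1) / (x * \<alpha>\<^sup>2)" using k x0 by simp
    have b: "(?k - 1) / (x * \<alpha>\<^sup>2) \<le> ?k * (2 / \<alpha> ^ 3)"
    proof -
      have "(?k - 1) / (x * \<alpha>\<^sup>2) \<le> ?k / (\<alpha> / 2 * \<alpha>\<^sup>2)"
        using x x0 \<alpha> k by (intro frac_le mult_right_mono mult_pos_pos) auto
      then show ?thesis by (simp add: power3_eq_cube power2_eq_square mult_ac)
    qed
    have c: "0 \<le> block_sum \<rho> \<pi>" unfolding block_sum_def using rho by (intro sum_nonneg)
    have "block_sum \<rho> \<pi> \<le> (\<Sum>U\<in>\<pi>. 2 / (1 - \<alpha>) * info_limit)" unfolding block_sum_def using rho by (intro sum_mono)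
    then have d: "block_sum \<rho> \<pi> \<le> ?k * (2 * info_limit / (1 - \<alpha>))" by simp
    have "0 \<le> 2 / \<alpha> ^ 3" using \<alpha> by simp
    show "\<bar>(?k - 1) / (x * \<alpha>\<^sup>2) - block_sum \<rho> \<pi>\<bar> \<le> remainder_const * ?k"
      unfolding remainder_const_def mult.commute[of _ ?k] distrib_left[of ?k] using a b c d by linarith
  qed simp
  finally show ?thesis by (simp add: mult_ac)
qed

text \<open>On the scale \<open>x = \<alpha> + w / sqrt k\<close> the likelihood score divided by \<open>sqrt k\<close> is nearly \<open>z - fisher_info \<alpha> * w\<close>,
so it changes sign within \<open>\<epsilon>\<close> of \<open>w = z / fisher_info \<alpha>\<close>. The three conditions on \<open>\<eta>\<close> keep the
information positive, the points \<open>x\<close> inside \<open>[\<alpha> / 2, (1 + \<alpha>) / 2]\<close>, and the total error below the value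
\<open>\<epsilon> * fisher_info \<alpha> / 2\<close> gained by moving \<open>w\<close> by \<open>\<epsilon>\<close>.\<close>

lemma qmle_close:
  assumes part: "partition_on {1..n} \<pi>" and n: "1 \<le> n"
    and eps: "0 < \<epsilon>" "\<epsilon> \<le> 1" and L: "\<bar>z_score \<pi>\<bar> \<le> L"
    and info: "\<bar>observed_info \<pi> / real (card \<pi>) - fisher_info \<alpha>\<bar> \<le> \<eta>" and kinv: "1 / real (card \<pi>) \<le> \<eta>"
    and eta: "\<eta> \<le> fisher_info \<alpha> / 2" "(L / fisher_info \<alpha> + 1) * sqrt \<eta> \<le> min \<alpha> (1 - \<alpha>) / 2"
      "L * \<eta> / fisher_info \<alpha> + remainder_const * (L / fisher_info \<alpha> + 1)\<^sup>2 * sqrt \<eta> < \<epsilon> * (fisher_info \<alpha> / 2)"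
  shows "\<bar>sqrt (real (card \<pi>)) * (qmle n \<pi> - \<alpha>) - z_score \<pi> / fisher_info \<alpha>\<bar> < \<epsilon>"
proof -
  define I k sk z J where "I = fisher_info \<alpha>" and "k = real (card \<pi>)" and "sk = sqrt k" and "z = z_score \<pi>"
    and "J = observed_info \<pi> / k"
  have I: "0 < I" using fisher_info_pos[OF \<alpha>] by (simp add: I_def)
  have c1: "1 \<le> card \<pi>" by (rule partition_card_pos[OF part n])
  have k: "1 \<le> k" "0 < k" using c1 by (auto simp: k_def)
  have sk: "0 < sk" "sk * sk = k" using k by (simp_all add: sk_def)
  have sc: "score \<pi> = z * sk" using sk by (simp add: z_def z_score_def k_def[symmetric] sk_def[symmetric])
  have L0: "0 \<le> L" using L by linarith
  have eta0: "0 < \<eta>" using kinv k by (smt (verit) k_def zero_less_divide_iff)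
  have "1 / sk = sqrt (1 / k)" by (simp add: sk_def real_sqrt_divide)
  also have "\<dots> \<le> sqrt \<eta>" using kinv by (simp add: k_def)
  finally have isk: "1 / sk \<le> sqrt \<eta>" .
  define D where "D = L / I + 1"
  have D: "1 \<le> D" using L0 I by (simp add: D_def)
  have K: "0 \<le> remainder_const"
    unfolding remainder_const_def using \<alpha> info_harm_bounds[of 0] by (intro add_nonneg_nonneg) auto
  have J: "\<bar>J - I\<bar> \<le> \<eta>" "I / 2 \<le> J" using info eta(1) by (auto simp: J_def k_def I_def abs_le_iff)
  have main: "\<alpha> / 2 \<le> \<alpha> + w / sk" "\<alpha> + w / sk \<le> (1 + \<alpha>) / 2"
    "\<bar>likelihood_score \<pi> (\<alpha> + w / sk) / sk - (z - J * w)\<bar> \<le> remainder_const * D\<^sup>2 * sqrt \<eta>"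
    if w: "\<bar>w\<bar> \<le> D" for w
  proof -
    have "\<bar>w / sk\<bar> = \<bar>w\<bar> * (1 / sk)" using sk by (simp add: abs_divide)
    also have "\<dots> \<le> D * sqrt \<eta>" using w isk sk D by (intro mult_mono) auto
    also have "\<dots> \<le> min \<alpha> (1 - \<alpha>) / 2" using eta(2) by (simp add: D_def I_def)
    finally have ws: "\<bar>w / sk\<bar> \<le> min \<alpha> (1 - \<alpha>) / 2" .
    moreover have "min \<alpha> (1 - \<alpha>) / 2 \<le> \<alpha> / 2" "min \<alpha> (1 - \<alpha>) / 2 \<le> (1 - \<alpha>) / 2" by simp_all
    ultimately have "- (\<alpha> / 2) \<le> w / sk" "w / sk \<le> (1 - \<alpha>) / 2" by linarith+
    then show x: "\<alpha> / 2 \<le> \<alpha> + w / sk" "\<alpha> + w / sk \<le> (1 + \<alpha>) / 2" by (auto simp: field_simps)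
    have "observed_info \<pi> * (w / sk) / sk = J * w" using k unfolding J_def sk(2)[symmetric] by simp
    then have e: "likelihood_score \<pi> (\<alpha> + w / sk) / sk - (z - J * w)
        = (likelihood_score \<pi> (\<alpha> + w / sk) - (score \<pi> - observed_info \<pi> * (\<alpha> + w / sk - \<alpha>))) / sk"
      using sk by (simp add: sc diff_divide_distrib)
    have "\<bar>likelihood_score \<pi> (\<alpha> + w / sk) / sk - (z - J * w)\<bar> \<le> (remainder_const * k * (w / sk)\<^sup>2) / sk"
      unfolding e abs_divide using likelihood_score_expansion[OF x c1] sk by (simp add: k_def divide_right_mono)
    also have "\<dots> = remainder_const * (w\<^sup>2 * (1 / sk))" unfolding sk(2)[symmetric] using sk(1) by (simp add: power2_eq_square)
    also have "\<dots> \<le> remainder_const * (D\<^sup>2 * sqrt \<eta>)"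
    proof (intro mult_left_mono[OF _ K] mult_mono isk)
      show "w\<^sup>2 \<le> D\<^sup>2" using power_mono[OF w, of 2] by simp
    qed (use sk in auto)
    finally show "\<bar>likelihood_score \<pi> (\<alpha> + w / sk) / sk - (z - J * w)\<bar> \<le> remainder_const * D\<^sup>2 * sqrt \<eta>" by (simp add: mult_ac)
  qed
  have zI: "\<bar>z / I\<bar> \<le> L / I" using L I by (simp add: z_def abs_divide divide_right_mono)
  have z_small: "\<bar>z - J * (z / I)\<bar> \<le> L * \<eta> / I"
  proof -
    have "z - J * (z / I) = (z / I) * (I - J)" using I by (simp add: right_diff_distrib)
    moreover have "\<bar>z / I\<bar> * \<bar>I - J\<bar> \<le> (L / I) * \<eta>"
    proof (rule mult_mono[OF zI])
      show "\<bar>I - J\<bar> \<le> \<eta>" using J(1) by (simp only: abs_minus_commute)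
      show "0 \<le> L / I" using L0 I by simp
    qed simp
    ultimately have "\<bar>z - J * (z / I)\<bar> \<le> (L / I) * \<eta>" by (simp only: abs_mult)
    then show ?thesis by simp
  qed
  have crit: "L * \<eta> / I + remainder_const * D\<^sup>2 * sqrt \<eta> < \<epsilon> * (I / 2)" using eta(3) by (simp add: I_def D_def)
  have Je: "\<epsilon> * (I / 2) \<le> J * \<epsilon>" using mult_left_mono[OF J(2), of \<epsilon>] eps by (simp add: mult.commute)
  define w1 w2 where "w1 = z / I - \<epsilon>" and "w2 = z / I + \<epsilon>"
  have w: "\<bar>w1\<bar> \<le> D" "\<bar>w2\<bar> \<le> D" using zI eps unfolding w1_def w2_def D_def by linarith+
  have s1: "0 < likelihood_score \<pi> (\<alpha> + w1 / sk) / sk"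
  proof -
    have "z - J * w1 = (z - J * (z / I)) + J * \<epsilon>" by (simp add: w1_def right_diff_distrib)
    then show ?thesis using main(3)[OF w(1)] z_small crit Je by linarith
  qed
  have s2: "likelihood_score \<pi> (\<alpha> + w2 / sk) / sk < 0"
  proof -
    have "z - J * w2 = (z - J * (z / I)) - J * \<epsilon>" by (simp add: w2_def distrib_left)
    then show ?thesis using main(3)[OF w(2)] z_small crit Je by linarith
  qed
  have "\<alpha> + w1 / sk < qmle n \<pi> \<and> qmle n \<pi> < \<alpha> + w2 / sk"
  proof (rule qmle_between[OF part n])
    show "0 < \<alpha> + w1 / sk" using main(1)[OF w(1)] \<alpha> by linarith
    show "\<alpha> + w2 / sk < 1" using main(2)[OF w(2)] \<alpha> by argo
    show "\<alpha> + w1 / sk < \<alpha> + w2 / sk" using eps sk by (simp add: w1_def w2_def divide_strict_right_mono)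
    show "0 < likelihood_score \<pi> (\<alpha> + w1 / sk)" using s1 sk by (simp add: zero_less_divide_iff)
    show "likelihood_score \<pi> (\<alpha> + w2 / sk) < 0" using s2 sk by (simp add: divide_less_0_iff)
  qed
  then have "w1 / sk < qmle n \<pi> - \<alpha>" "qmle n \<pi> - \<alpha> < w2 / sk" by linarith+
  then have "w1 < sk * (qmle n \<pi> - \<alpha>)" "sk * (qmle n \<pi> - \<alpha>) < w2"
    using sk by (simp_all add: pos_divide_less_eq pos_less_divide_eq mult.commute)
  then show ?thesis unfolding w1_def w2_def k_def[symmetric] sk_def[symmetric] z_def[symmetric] I_def[symmetric] by linarith
qed

text \<open>The new block coordinate contributes \<open>k \<bar>qmle - \<alpha>\<bar> / n\<close> and so do the \<open>k\<close> other coordinates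
together; the factor \<open>1 / 2\<close> in the total variation distance averages the two. The errors of the block
coordinates are proportional to \<open>card U - \<alpha>\<close> and sum to \<open>O(1/n)\<close>.\<close>

lemma tv_dist_approx:
  assumes part: "partition_on {1..n} \<pi>" and n: "1 \<le> n"
  shows "\<bar>tv_dist (card \<pi>) (predictive_est n \<pi>) (predictive \<alpha> \<mu> n \<pi>) - real (card \<pi>) * \<bar>qmle n \<pi> - \<alpha>\<bar> / real n\<bar> \<le> rate_const / real n"
proof -
  define k m a' c p R where "k = real (card \<pi>)" and "m = real n" and "a' = qmle n \<pi>" and "c = join_rate n (card \<pi>)"
    and "p = new_prob n (card \<pi>)" and "R = rate_const"
  have kn: "1 \<le> card \<pi>" "card \<pi> \<le> n" using partition_card_pos partition_card_le assms by auto
  have k: "1 \<le> k" "k \<le> m" "0 < m" using kn by (auto simp: k_def m_def)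
  define D where "D = \<bar>a' - \<alpha>\<bar> / m"
  have t0: "\<bar>\<bar>predictive_est n \<pi> 0 - predictive \<alpha> \<mu> n \<pi> 0\<bar> - k * D\<bar> \<le> R / m"
  proof -
    define u v where "u = k / m * a'" and "v = \<alpha> * k / m"
    have "u - v = k / m * (a' - \<alpha>)" by (simp add: u_def v_def right_diff_distrib)
    then have "\<bar>u - v\<bar> = k * D" using k by (simp add: abs_mult D_def)
    moreover have "\<bar>p - v\<bar> \<le> R / m" using new_prob_approx[OF kn] by (simp add: p_def k_def m_def R_def v_def)
    ultimately have "\<bar>\<bar>u - p\<bar> - k * D\<bar> \<le> R / m" by linarith
    then have "\<bar>\<bar>k / m * a' - p\<bar> - k * D\<bar> \<le> R / m" by (simp only: u_def)
    then show ?thesis by (simp add: predictive_est_def predictive_eq k_def m_def a'_def p_def)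
  qed
  define f where "f U = \<bar>(real (card U) - a') / m - c * (real (card U) - \<alpha>)\<bar>" for U :: "nat set"
  have rest: "(\<Sum>i=1..card \<pi>. \<bar>predictive_est n \<pi> i - predictive \<alpha> \<mu> n \<pi> i\<bar>) = (\<Sum>U\<in>\<pi>. f U)"
  proof -
    have "(\<Sum>i=1..card \<pi>. \<bar>predictive_est n \<pi> i - predictive \<alpha> \<mu> n \<pi> i\<bar>) = (\<Sum>i=1..card \<pi>. f (block \<pi> i))"
      by (intro sum.cong refl) (auto simp: predictive_est_def predictive_eq f_def a'_def m_def c_def)
    then show ?thesis using sum_blocks[OF part, of f] by simp
  qed
  have fU: "\<bar>f U - D\<bar> \<le> R / 2 / m\<^sup>2 * (real (card U) - \<alpha>)" if "U \<in> \<pi>" for U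
  proof -
    have d: "0 < real (card U) - \<alpha>" using block_size_minus_pos[OF part that] by simp
    have "(real (card U) - a') / m - c * (real (card U) - \<alpha>) = - ((a' - \<alpha>) / m) - (c - 1 / m) * (real (card U) - \<alpha>)"
      by (simp add: algebra_simps diff_divide_distrib)
    moreover have "\<bar>- ((a' - \<alpha>) / m)\<bar> = D" using k by (simp add: D_def abs_divide)
    ultimately have "\<bar>f U - D\<bar> \<le> \<bar>(c - 1 / m) * (real (card U) - \<alpha>)\<bar>" unfolding f_def by linarith
    also have "\<dots> \<le> R / 2 / m\<^sup>2 * (real (card U) - \<alpha>)"
    proof -
      have "\<bar>c - 1 / m\<bar> \<le> R / 2 / m\<^sup>2" unfolding c_def m_def R_def by (rule join_rate_approx[OF n])
      then have "\<bar>c - 1 / m\<bar> * \<bar>real (card U) - \<alpha>\<bar> \<le> R / 2 / m\<^sup>2 * \<bar>real (card U) - \<alpha>\<bar>"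
        by (rule mult_right_mono) simp
      then show ?thesis unfolding abs_mult using d by (simp only: abs_of_pos)
    qed
    finally show ?thesis .
  qed
  have "(\<Sum>U\<in>\<pi>. f U) - k * D = (\<Sum>U\<in>\<pi>. f U - D)" by (simp add: sum_subtractf k_def)
  then have "\<bar>(\<Sum>U\<in>\<pi>. f U) - k * D\<bar> \<le> (\<Sum>U\<in>\<pi>. R / 2 / m\<^sup>2 * (real (card U) - \<alpha>))"
    using fU by (simp only:) (intro order_trans[OF sum_abs] sum_mono)
  also have "\<dots> = R / 2 / m\<^sup>2 * (m - k * \<alpha>)"
    using block_sum_size_minus[OF part, of \<alpha>] by (simp only: block_sum_def sum_distrib_left[symmetric] m_def k_def)
  also have "\<dots> \<le> R / 2 / m\<^sup>2 * (2 * m)"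
  proof (rule mult_left_mono)
    have "0 \<le> k * \<alpha>" using k \<alpha> by simp
    then show "m - k * \<alpha> \<le> 2 * m" using k by linarith
    show "0 \<le> R / 2 / m\<^sup>2" using rate_const_ge by (simp add: R_def)
  qed
  also have "\<dots> = R / m" using k by (simp add: power2_eq_square)
  finally have t1: "\<bar>(\<Sum>U\<in>\<pi>. f U) - k * D\<bar> \<le> R / m" .
  have "tv_dist (card \<pi>) (predictive_est n \<pi>) (predictive \<alpha> \<mu> n \<pi>)
      = (\<bar>predictive_est n \<pi> 0 - predictive \<alpha> \<mu> n \<pi> 0\<bar> + (\<Sum>U\<in>\<pi>. f U)) / 2"
    unfolding tv_dist_def rest[symmetric] by (simp add: sum.atLeast_Suc_atMost)
  moreover have "\<bar>(u + v) / 2 - x\<bar> \<le> \<epsilon>" if "\<bar>u - x\<bar> \<le> \<epsilon>" "\<bar>v - x\<bar> \<le> \<epsilon>" for u v x \<epsilon> :: real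
  proof -
    have "(u + v) / 2 - x = ((u - x) + (v - x)) / 2" by (simp add: field_simps)
    then have "\<bar>(u + v) / 2 - x\<bar> = \<bar>(u - x) + (v - x)\<bar> / 2" by (simp only: abs_divide abs_numeral)
    also have "\<bar>(u - x) + (v - x)\<bar> \<le> \<epsilon> + \<epsilon>" using abs_triangle_ineq add_mono[OF that] by (rule order_trans)
    finally show ?thesis by simp
  qed
  ultimately have "\<bar>tv_dist (card \<pi>) (predictive_est n \<pi>) (predictive \<alpha> \<mu> n \<pi>) - k * D\<bar> \<le> R / m"
    using t0 t1 by simp
  then show ?thesis by (simp add: D_def k_def m_def a'_def R_def)
qed

lemma sum_predictive_eq:
  assumes part: "partition_on {1..n} \<pi>" and n: "1 \<le> n"
  shows "(\<Sum>i=0..card \<pi>. predictive \<alpha> \<mu> n \<pi> i) = 1" "(\<Sum>i=0..card \<pi>. predictive_est n \<pi> i) = 1"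
proof -
  have "(\<Sum>i=1..card \<pi>. predictive \<alpha> \<mu> n \<pi> i) = (\<Sum>i=1..card \<pi>. join_rate n (card \<pi>) * (real (card (block \<pi> i)) - \<alpha>))"
    by (intro sum.cong refl) (auto simp: predictive_eq)
  also have "\<dots> = 1 - new_prob n (card \<pi>)"
    using sum_blocks[OF part, of "\<lambda>U. join_rate n (card \<pi>) * (real (card U) - \<alpha>)"] sum_join_prob[OF part n] by simp
  finally show "(\<Sum>i=0..card \<pi>. predictive \<alpha> \<mu> n \<pi> i) = 1"
    by (simp add: sum.atLeast_Suc_atMost predictive_eq)
  have "(\<Sum>i=1..card \<pi>. predictive_est n \<pi> i) = (\<Sum>i=1..card \<pi>. (real (card (block \<pi> i)) - qmle n \<pi>) / real n)"
    by (intro sum.cong refl) (auto simp: predictive_est_def)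
  also have "\<dots> = (\<Sum>U\<in>\<pi>. (real (card U) - qmle n \<pi>) / real n)"
    by (rule sum_blocks[OF part, of "\<lambda>U. (real (card U) - qmle n \<pi>) / real n"])
  also have "\<dots> = (real n - real (card \<pi>) * qmle n \<pi>) / real n"
    using block_sum_size_minus[OF part, of "qmle n \<pi>"] by (simp only: block_sum_def sum_divide_distrib[symmetric])
  finally show "(\<Sum>i=0..card \<pi>. predictive_est n \<pi> i) = 1"
    using n by (simp add: sum.atLeast_Suc_atMost predictive_est_def diff_divide_distrib)
qed

end

text \<open>The deviation is largest on the set where \<open>p \<ge> q\<close>, and there it equals the total variation distance
because positive and negative parts of \<open>p - q\<close> have the same mass.\<close>

lemma forall_subset_le_iff_tv_dist_le:
  fixes p q :: "nat \<Rightarrow> real"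
  assumes eq: "(\<Sum>i=0..k. p i) = (\<Sum>i=0..k. q i)"
  shows "(\<forall>I. I \<subseteq> {0..k} \<longrightarrow> \<bar>(\<Sum>i\<in>I. p i) - (\<Sum>i\<in>I. q i)\<bar> \<le> B) \<longleftrightarrow> tv_dist k q p \<le> B"
proof -
  define d where "d i = p i - q i" for i
  define P N where "P = {i \<in> {0..k}. 0 \<le> d i}" and "N = {i \<in> {0..k}. d i < 0}"
  have fin: "finite P" "finite N" by (simp_all add: P_def N_def)
  have un: "{0..k} = P \<union> N" "P \<inter> N = {}" by (auto simp: P_def N_def)
  have dsum: "(\<Sum>i\<in>I. p i) - (\<Sum>i\<in>I. q i) = (\<Sum>i\<in>I. d i)" for I by (simp add: d_def sum_subtractf)
  have zero: "(\<Sum>i\<in>P. d i) + (\<Sum>i\<in>N. d i) = 0"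
    using dsum[of "{0..k}"] eq unfolding un(1) by (simp add: sum.union_disjoint[OF fin un(2)])
  have "(\<Sum>i=0..k. \<bar>q i - p i\<bar>) = (\<Sum>i\<in>P. \<bar>d i\<bar>) + (\<Sum>i\<in>N. \<bar>d i\<bar>)"
    unfolding un(1) sum.union_disjoint[OF fin un(2)] by (simp add: d_def abs_minus_commute)
  also have "(\<Sum>i\<in>P. \<bar>d i\<bar>) = (\<Sum>i\<in>P. d i)" by (intro sum.cong) (auto simp: P_def)
  also have "(\<Sum>i\<in>N. \<bar>d i\<bar>) = (\<Sum>i\<in>N. - d i)" by (intro sum.cong) (auto simp: N_def)
  finally have tv: "tv_dist k q p = (\<Sum>i\<in>P. d i)" using zero by (simp add: tv_dist_def sum_negf)
  have bd: "\<bar>\<Sum>i\<in>I. d i\<bar> \<le> (\<Sum>i\<in>P. d i)" if I: "I \<subseteq> {0..k}" for I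
  proof -
    have finI: "finite I" using I finite_subset by blast
    have split: "(\<Sum>i\<in>I. d i) = (\<Sum>i\<in>I \<inter> P. d i) + (\<Sum>i\<in>I \<inter> N. d i)"
    proof -
      have "I = (I \<inter> P) \<union> (I \<inter> N)" using I un by blast
      then show ?thesis using sum.union_disjoint[of "I \<inter> P" "I \<inter> N" d] finI un(2) by auto
    qed
    have "(\<Sum>i\<in>I \<inter> P. d i) \<le> (\<Sum>i\<in>P. d i)" by (rule sum_mono2[OF fin(1)]) (auto simp: P_def)
    moreover have "(\<Sum>i\<in>I \<inter> N. - d i) \<le> (\<Sum>i\<in>N. - d i)" by (rule sum_mono2[OF fin(2)]) (auto simp: N_def)
    moreover have "0 \<le> (\<Sum>i\<in>I \<inter> P. d i)" by (rule sum_nonneg) (auto simp: P_def)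
    moreover have "0 \<le> (\<Sum>i\<in>I \<inter> N. - d i)" by (rule sum_nonneg) (auto simp: N_def)
    ultimately show ?thesis unfolding split using zero by (simp add: sum_negf abs_le_iff)
  qed
  have "P \<subseteq> {0..k}" by (auto simp: P_def)
  show ?thesis unfolding dsum tv
  proof (intro iffI allI impI)
    assume "\<forall>I. I \<subseteq> {0..k} \<longrightarrow> \<bar>\<Sum>i\<in>I. d i\<bar> \<le> B"
    then show "(\<Sum>i\<in>P. d i) \<le> B" using \<open>P \<subseteq> {0..k}\<close> abs_ge_self order_trans by blast
  next
    fix I assume "(\<Sum>i\<in>P. d i) \<le> B" "I \<subseteq> {0..k}"
    then show "\<bar>\<Sum>i\<in>I. d i\<bar> \<le> B" using bd[of I] by linarith
  qed
qed

section \<open>Convergence in distribution and linearization of the estimator\<close>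

context prob_space
begin

lemma prob_tendsto_0_mono:
  assumes "\<And>n. A n \<in> events" "\<And>n. B n \<in> events" "\<forall>\<^sub>F n in sequentially. A n \<subseteq> B n" "(\<lambda>n. prob (B n)) \<longlonglongrightarrow> 0"
  shows "(\<lambda>n. prob (A n)) \<longlonglongrightarrow> 0"
proof (rule tendsto_sandwich[OF _ _ tendsto_const assms(4)])
  show "\<forall>\<^sub>F n in sequentially. prob (A n) \<le> prob (B n)"
    using assms(3) by eventually_elim (rule finite_measure_mono[OF _ assms(2)])
qed simp

text \<open>Characteristic functions are Lipschitz in the variable, apart from an event of vanishing probability.
This is Slutsky's theorem at the level of characteristic functions.\<close>

lemma char_tendsto_of_prob_diff:
  fixes Y Z :: "nat \<Rightarrow> 'a \<Rightarrow> real"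
  assumes [measurable]: "\<And>n. Y n \<in> borel_measurable M" "\<And>n. Z n \<in> borel_measurable M"
    and diff: "\<And>\<epsilon>. 0 < \<epsilon> \<Longrightarrow> (\<lambda>n. prob {\<omega> \<in> space M. \<epsilon> \<le> \<bar>Z n \<omega> - Y n \<omega>\<bar>}) \<longlonglongrightarrow> 0"
    and Y: "(\<lambda>n. char (distr M borel (Y n)) t) \<longlonglongrightarrow> c"
  shows "(\<lambda>n. char (distr M borel (Z n)) t) \<longlonglongrightarrow> c"
proof -
  have char: "char (distr M borel (W n)) t = (LINT \<omega>|M. iexp (t * W n \<omega>))" if [measurable]: "\<And>n. W n \<in> borel_measurable M" for W n
    unfolding char_def by (subst integral_distr) auto
  have int: "integrable M (\<lambda>\<omega>. iexp (t * W n \<omega>))" if [measurable]: "\<And>n. W n \<in> borel_measurable M" for W n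
    by (rule integrable_const_bound[where B = 1]) auto
  have key: "cmod (char (distr M borel (Z n)) t - char (distr M borel (Y n)) t)
      \<le> \<bar>t\<bar> * \<epsilon> + 2 * prob {\<omega> \<in> space M. \<epsilon> \<le> \<bar>Z n \<omega> - Y n \<omega>\<bar>}" if "0 < \<epsilon>" for n \<epsilon>
  proof -
    let ?B = "{\<omega> \<in> space M. \<epsilon> \<le> \<bar>Z n \<omega> - Y n \<omega>\<bar>}"
    have B: "?B \<in> events" by measurable
    have "char (distr M borel (Z n)) t - char (distr M borel (Y n)) t = (LINT \<omega>|M. iexp (t * Z n \<omega>) - iexp (t * Y n \<omega>))"
      unfolding char[of Z, OF assms(2)] char[of Y, OF assms(1)]
      by (rule Bochner_Integration.integral_diff[symmetric]; rule int; rule assms)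
    also have "cmod \<dots> \<le> (LINT \<omega>|M. \<bar>t\<bar> * \<epsilon> + 2 * indicator ?B \<omega>)"
    proof (rule norm_integral_le)
      show "integrable M (\<lambda>\<omega>. iexp (t * Z n \<omega>) - iexp (t * Y n \<omega>))" by (intro Bochner_Integration.integrable_diff int) auto
      show "integrable M (\<lambda>\<omega>. \<bar>t\<bar> * \<epsilon> + 2 * indicator ?B \<omega> :: real)"
        using B by (intro Bochner_Integration.integrable_add integrable_mult_right integrable_real_indicator) (auto simp: emeasure_eq_measure)
      fix \<omega> assume \<omega>: "\<omega> \<in> space M"
      show "cmod (iexp (t * Z n \<omega>) - iexp (t * Y n \<omega>)) \<le> \<bar>t\<bar> * \<epsilon> + 2 * indicator ?B \<omega>"
      proof (cases "\<omega> \<in> ?B")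
        case True
        have "cmod (iexp (t * Z n \<omega>) - iexp (t * Y n \<omega>)) \<le> 1 + 1"
          by (rule order_trans[OF norm_triangle_ineq4]) simp
        moreover have "0 \<le> \<bar>t\<bar> * \<epsilon>" using that by simp
        ultimately show ?thesis using True by simp
      next
        case False
        define u where "u = t * (Z n \<omega> - Y n \<omega>)"
        have "iexp (t * Z n \<omega>) - iexp (t * Y n \<omega>) = iexp (t * Y n \<omega>) * (iexp u - 1)"
          by (simp add: u_def algebra_simps exp_diff)
        then have "cmod (iexp (t * Z n \<omega>) - iexp (t * Y n \<omega>)) = cmod (iexp u - 1)" by (simp add: norm_mult)
        also have "\<dots> \<le> \<bar>u\<bar>" using iexp_approx1[of u 0] by simp
        also have "\<dots> \<le> \<bar>t\<bar> * \<epsilon>" using False \<omega> by (auto simp: u_def abs_mult intro!: mult_left_mono)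
        finally show ?thesis using False by simp
      qed
    qed
    also have "\<dots> = \<bar>t\<bar> * \<epsilon> + 2 * prob ?B"
      using B by (subst Bochner_Integration.integral_add) (auto simp: prob_space emeasure_eq_measure)
    finally show ?thesis .
  qed
  have "(\<lambda>n. char (distr M borel (Z n)) t - char (distr M borel (Y n)) t) \<longlonglongrightarrow> 0"
  proof (rule tendstoI)
    fix \<delta> :: real assume \<delta>: "0 < \<delta>"
    define \<epsilon> where "\<epsilon> = \<delta> / (2 * (\<bar>t\<bar> + 1))"
    have \<epsilon>: "0 < \<epsilon>" using \<delta> by (simp add: \<epsilon>_def)
    have "\<bar>t\<bar> * \<epsilon> \<le> (\<bar>t\<bar> + 1) * \<epsilon>" using \<epsilon> by (intro mult_right_mono) auto
    also have "\<dots> = \<delta> / 2"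
    proof -
      have "\<bar>t\<bar> + 1 \<noteq> 0" by linarith
      then show ?thesis unfolding \<epsilon>_def by (metis mult.commute times_divide_eq_right nonzero_mult_divide_mult_cancel_left)
    qed
    finally have t\<epsilon>: "\<bar>t\<bar> * \<epsilon> \<le> \<delta> / 2" .
    have "\<forall>\<^sub>F n in sequentially. prob {\<omega> \<in> space M. \<epsilon> \<le> \<bar>Z n \<omega> - Y n \<omega>\<bar>} < \<delta> / 4"
      using order_tendstoD(2)[OF diff[OF \<epsilon>], of "\<delta> / 4"] \<delta> by simp
    then show "\<forall>\<^sub>F n in sequentially. dist (char (distr M borel (Z n)) t - char (distr M borel (Y n)) t) 0 < \<delta>"
    proof eventually_elim
      case (elim n)
      then show ?case using key[OF \<epsilon>, of n] t\<epsilon> unfolding dist_norm diff_zero by linarith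
    qed
  qed
  from tendsto_add[OF this Y] show ?thesis by simp
qed

lemma weak_conv_of_prob_diff:
  fixes Y Z :: "nat \<Rightarrow> 'a \<Rightarrow> real"
  assumes [measurable]: "\<And>n. Y n \<in> borel_measurable M" "\<And>n. Z n \<in> borel_measurable M"
    and diff: "\<And>\<epsilon>. 0 < \<epsilon> \<Longrightarrow> (\<lambda>n. prob {\<omega> \<in> space M. \<epsilon> \<le> \<bar>Z n \<omega> - Y n \<omega>\<bar>}) \<longlonglongrightarrow> 0"
    and \<nu>: "real_distribution \<nu>" and Y: "weak_conv_m (\<lambda>n. distr M borel (Y n)) \<nu>"
  shows "weak_conv_m (\<lambda>n. distr M borel (Z n)) \<nu>"
proof (rule levy_continuity)
  show "real_distribution (distr M borel (Z n))" for n by (rule real_distribution_distr) simp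
  have Yd: "real_distribution (distr M borel (Y n))" for n by (rule real_distribution_distr) simp
  show "(\<lambda>n. char (distr M borel (Z n)) t) \<longlonglongrightarrow> char \<nu> t" for t
    by (rule char_tendsto_of_prob_diff[OF assms(1,2) diff]) (auto intro: levy_continuity1[OF Yd \<nu> Y])
qed (rule \<nu>)

end

lemma weak_conv_abs:
  fixes \<mu> :: "nat \<Rightarrow> real measure"
  assumes \<mu>: "\<And>n. real_distribution (\<mu> n)" and \<nu>: "real_distribution \<nu>" and w: "weak_conv_m \<mu> \<nu>"
  shows "weak_conv_m (\<lambda>n. distr (\<mu> n) borel abs) (distr \<nu> borel abs)"
proof (rule levy_continuity)
  have d: "real_distribution (distr \<rho> borel abs)" if "real_distribution \<rho>" for \<rho>
  proof -
    interpret real_distribution \<rho> by fact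
    show ?thesis by (rule real_distribution_distr) simp
  qed
  show "real_distribution (distr (\<mu> n) borel abs)" for n by (rule d[OF \<mu>])
  show "real_distribution (distr \<nu> borel abs)" by (rule d[OF \<nu>])
  have c: "char (distr \<rho> borel abs) t = (LINT x|\<rho>. iexp (t * \<bar>x\<bar>))" if "real_distribution \<rho>" for \<rho> t
  proof -
    interpret real_distribution \<rho> by fact
    show ?thesis unfolding char_def by (subst integral_distr) auto
  qed
  show "(\<lambda>n. char (distr (\<mu> n) borel abs) t) \<longlonglongrightarrow> char (distr \<nu> borel abs) t" for t
    unfolding c[OF \<mu>] c[OF \<nu>]
    by (rule weak_conv_imp_integral_bdd_continuous_conv[OF \<mu> \<nu> w, where B = 1]) (auto intro!: continuous_intros)
qed

lemma integral_uniform_measure: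
  fixes f :: "'a \<Rightarrow> 'b::{banach, second_countable_topology}"
  assumes "prob_space M" and A: "A \<in> sets M" "0 < measure M A" and f: "f \<in> borel_measurable M"
  shows "(LINT x|uniform_measure M A. f x) = (1 / measure M A) *\<^sub>R (LINT x|M. indicator A x *\<^sub>R f x)"
proof -
  interpret prob_space M by fact
  have "uniform_measure M A = density M (\<lambda>x. ennreal (indicator A x / measure M A))"
    unfolding uniform_measure_def
    using A by (intro arg_cong[where f = "density M"] ext) (auto simp: emeasure_eq_measure divide_ennreal indicator_def ennreal_1[symmetric] simp del: ennreal_1)
  then have "(LINT x|uniform_measure M A. f x) = (LINT x|M. (indicator A x / measure M A) *\<^sub>R f x)"
    using A f by (simp only:) (intro integral_density, auto)
  also have "\<dots> = (LINT x|M. (1 / measure M A) *\<^sub>R (indicator A x *\<^sub>R f x))"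
    by (intro Bochner_Integration.integral_cong refl) simp
  also have "\<dots> = (1 / measure M A) *\<^sub>R (LINT x|M. indicator A x *\<^sub>R f x)" by (rule integral_scaleR_right)
  finally show ?thesis .
qed

context gibbs_chain
begin

text \<open>Markov's inequality. The index is \<open>Suc n\<close> because nothing is known about \<open>X 0\<close>, not even
measurability.\<close>

lemma prob_X_tendsto_0:
  fixes F :: "nat set set \<Rightarrow> real"
  assumes F: "\<And>\<pi>. 0 \<le> F \<pi>" and lim: "(\<lambda>n. LINT \<omega>|M. F (X n \<omega>)) \<longlonglongrightarrow> 0" and e: "0 < e"
  shows "(\<lambda>n. prob {\<omega> \<in> space M. e \<le> F (X (Suc n) \<omega>)}) \<longlonglongrightarrow> 0"
proof (rule tendsto_sandwich[OF _ _ tendsto_const])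
  show "(\<lambda>n. (LINT \<omega>|M. F (X (Suc n) \<omega>)) / e) \<longlonglongrightarrow> 0"
    using tendsto_divide[OF LIMSEQ_Suc[OF lim] tendsto_const, of e] e by simp
  show "\<forall>\<^sub>F n in sequentially. prob {\<omega> \<in> space M. e \<le> F (X (Suc n) \<omega>)} \<le> (LINT \<omega>|M. F (X (Suc n) \<omega>)) / e"
    using F e by (intro always_eventually allI integral_Markov_inequality_measure[where A = "{}"] integrable_X) auto
qed simp

text \<open>The law of large numbers for \<open>info_harm\<close>, combined with the information identity.\<close>

lemma expectation_observed_info:
  "(\<lambda>n. LINT \<omega>|M. \<bar>observed_info (X n \<omega>) / real (card (X n \<omega>)) - fisher_info \<alpha>\<bar>) \<longlonglongrightarrow> 0"
proof -
  \<comment> \<open>the law of large numbers for block averages concerns functions that vanish at infinity, so it is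
    applied to the distance of \<open>info_harm\<close> from its limit\<close>
  define f where "f j = info_limit - info_harm j" for j
  define s where "s = info_limit - sibuya_q \<alpha> / \<alpha>"
  have f0: "f \<longlonglongrightarrow> 0" unfolding f_def using tendsto_diff[OF tendsto_const info_harm_tendsto, of info_limit] by simp
  have "(\<lambda>j. sibuya_prob \<alpha> (Suc j) * info_limit - sibuya_prob \<alpha> (Suc j) * info_harm (Suc j)) sums (1 * info_limit - sibuya_q \<alpha> / \<alpha>)"
    using sibuya_mean_observed_info[OF \<alpha>] unfolding info_harm_def
    by (intro sums_diff sums_mult2 sibuya_prob_sums_1[OF \<alpha>])
  then have s: "(\<lambda>j. sibuya_prob \<alpha> (Suc j) * f (Suc j)) sums s"
    by (simp add: f_def s_def right_diff_distrib)
  have le: "(LINT \<omega>|M. \<bar>observed_info (X n \<omega>) / real (card (X n \<omega>)) - fisher_info \<alpha>\<bar>)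
      \<le> 1 / \<alpha>\<^sup>2 * (LINT \<omega>|M. 1 / real (card (X n \<omega>))) + 1 * (LINT \<omega>|M. \<bar>block_sum f (X n \<omega>) / real (card (X n \<omega>)) - s\<bar>)"
    if n: "1 \<le> n" for n
  proof -
    have "(LINT \<omega>|M. \<bar>observed_info (X n \<omega>) / real (card (X n \<omega>)) - fisher_info \<alpha>\<bar>)
      \<le> (LINT \<omega>|M. 1 / \<alpha>\<^sup>2 * (1 / real (card (X n \<omega>))) + 1 * \<bar>block_sum f (X n \<omega>) / real (card (X n \<omega>)) - s\<bar>)"
  proof (intro integral_mono)
    show "integrable M (\<lambda>\<omega>. \<bar>observed_info (X n \<omega>) / real (card (X n \<omega>)) - fisher_info \<alpha>\<bar>)" by (rule integrable_X[OF n])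
    show "integrable M (\<lambda>\<omega>. 1 / \<alpha>\<^sup>2 * (1 / real (card (X n \<omega>))) + 1 * \<bar>block_sum f (X n \<omega>) / real (card (X n \<omega>)) - s\<bar>)"
      by (rule integrable_X[OF n])
    fix \<omega> assume \<omega>: "\<omega> \<in> space M"
    define k where "k = real (card (X n \<omega>))"
    have k: "1 \<le> k" using card_X[OF n \<omega>] by (simp add: k_def)
    have "block_sum f (X n \<omega>) = k * info_limit - block_sum info_harm (X n \<omega>)"
      by (simp add: block_sum_def f_def sum_subtractf k_def)
    then have b: "block_sum f (X n \<omega>) / k = info_limit - block_sum info_harm (X n \<omega>) / k"
      using k by (simp add: diff_divide_distrib)
    have "observed_info (X n \<omega>) / k = 1 / \<alpha>\<^sup>2 - 1 / \<alpha>\<^sup>2 * (1 / k) + block_sum info_harm (X n \<omega>) / k"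
      unfolding observed_info_def k_def[symmetric] using k by (simp add: add_divide_distrib diff_divide_distrib)
    then have "observed_info (X n \<omega>) / k - fisher_info \<alpha> = - (1 / \<alpha>\<^sup>2 * (1 / k)) - (block_sum f (X n \<omega>) / k - s)"
      unfolding fisher_info_eq[OF \<alpha>] b s_def by simp
    also have "\<bar>\<dots>\<bar> \<le> \<bar>1 / \<alpha>\<^sup>2 * (1 / k)\<bar> + \<bar>block_sum f (X n \<omega>) / k - s\<bar>"
      by (rule order_trans[OF abs_triangle_ineq4]) simp
    also have "\<bar>1 / \<alpha>\<^sup>2 * (1 / k)\<bar> = 1 / \<alpha>\<^sup>2 * (1 / k)" using k by simp
    finally show "\<bar>observed_info (X n \<omega>) / real (card (X n \<omega>)) - fisher_info \<alpha>\<bar>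
        \<le> 1 / \<alpha>\<^sup>2 * (1 / real (card (X n \<omega>))) + 1 * \<bar>block_sum f (X n \<omega>) / real (card (X n \<omega>)) - s\<bar>"
      by (simp add: k_def)
  qed
  also have "\<dots> = 1 / \<alpha>\<^sup>2 * (LINT \<omega>|M. 1 / real (card (X n \<omega>))) + 1 * (LINT \<omega>|M. \<bar>block_sum f (X n \<omega>) / real (card (X n \<omega>)) - s\<bar>)"
    by (rule expectation_linear[OF n])
  finally show ?thesis .
  qed
  show ?thesis
  proof (rule tendsto_sandwich[OF _ _ tendsto_const])
    show "\<forall>\<^sub>F n in sequentially. (LINT \<omega>|M. \<bar>observed_info (X n \<omega>) / real (card (X n \<omega>)) - fisher_info \<alpha>\<bar>)
      \<le> 1 / \<alpha>\<^sup>2 * (LINT \<omega>|M. 1 / real (card (X n \<omega>))) + 1 * (LINT \<omega>|M. \<bar>block_sum f (X n \<omega>) / real (card (X n \<omega>)) - s\<bar>)"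
      using eventually_ge_at_top[of 1] by eventually_elim (rule le)
    have "(\<lambda>n. 1 / \<alpha>\<^sup>2 * (LINT \<omega>|M. 1 / real (card (X n \<omega>))) + 1 * (LINT \<omega>|M. \<bar>block_sum f (X n \<omega>) / real (card (X n \<omega>)) - s\<bar>))
       \<longlonglongrightarrow> 1 / \<alpha>\<^sup>2 * 0 + 1 * 0"
      by (intro tendsto_add tendsto_mult tendsto_const expectation_inverse_card expectation_block_average f0 s)
    then show "(\<lambda>n. 1 / \<alpha>\<^sup>2 * (LINT \<omega>|M. 1 / real (card (X n \<omega>))) + 1 * (LINT \<omega>|M. \<bar>block_sum f (X n \<omega>) / real (card (X n \<omega>)) - s\<bar>)) \<longlonglongrightarrow> 0"
      by simp
  qed simp
qed

text \<open>Chebyshev's inequality first fixes a level \<open>L\<close> that the standardized score exceeds with probability at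
most \<open>\<delta> / 2\<close>; then \<open>\<eta>\<close> is chosen so small that \<open>qmle_close\<close> applies outside events of vanishing
probability.\<close>

lemma qmle_linearization:
  assumes \<epsilon>: "0 < \<epsilon>"
  shows "(\<lambda>n. prob {\<omega> \<in> space M. \<epsilon> \<le> \<bar>sqrt (real (card (X (Suc n) \<omega>))) * (qmle (Suc n) (X (Suc n) \<omega>) - \<alpha>)
        - z_score (X (Suc n) \<omega>) / fisher_info \<alpha>\<bar> \<or> \<epsilon> \<le> \<bar>qmle (Suc n) (X (Suc n) \<omega>) - \<alpha>\<bar>}) \<longlonglongrightarrow> 0"
    (is "(\<lambda>n. prob (?bad n)) \<longlonglongrightarrow> 0")
proof (rule tendstoI)
  fix \<delta> :: real assume \<delta>: "0 < \<delta>"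
  define e where "e = min \<epsilon> 1"
  have e: "0 < e" "e \<le> 1" "e \<le> \<epsilon>" using \<epsilon> by (auto simp: e_def)
  define I where "I = fisher_info \<alpha>"
  have I: "0 < I" using fisher_info_pos[OF \<alpha>] by (simp add: I_def)
  obtain B where B: "\<And>n. 1 \<le> n \<Longrightarrow> (LINT \<omega>|M. (score (X n \<omega>))\<^sup>2 * (1 / real (card (X n \<omega>)))) \<le> B"
    using expectation_score_bounded by blast
  define L where "L = sqrt (2 * (\<bar>B\<bar> + 1) / \<delta>)"
  have L: "0 < L" "L\<^sup>2 = 2 * (\<bar>B\<bar> + 1) / \<delta>" using \<delta> by (auto simp: L_def)
  have "((\<lambda>\<eta>. (L / I + 1) * sqrt \<eta>) \<longlongrightarrow> (L / I + 1) * sqrt 0) (at_right 0)"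
    "((\<lambda>\<eta>. L * \<eta> / I + remainder_const * (L / I + 1)\<^sup>2 * sqrt \<eta>) \<longlongrightarrow> L * 0 / I + remainder_const * (L / I + 1)\<^sup>2 * sqrt 0) (at_right 0)"
    by (intro tendsto_intros; use I in simp)+
  then have lims: "((\<lambda>\<eta>. (L / I + 1) * sqrt \<eta>) \<longlongrightarrow> 0) (at_right 0)"
    "((\<lambda>\<eta>. L * \<eta> / I + remainder_const * (L / I + 1)\<^sup>2 * sqrt \<eta>) \<longlongrightarrow> 0) (at_right 0)" by simp_all
  have "\<forall>\<^sub>F \<eta> in at_right 0. 0 < \<eta> \<and> \<eta> \<le> I / 2 \<and> (L / I + 1) * sqrt \<eta> < min (min \<alpha> (1 - \<alpha>) / 2) e
      \<and> L * \<eta> / I + remainder_const * (L / I + 1)\<^sup>2 * sqrt \<eta> < e * (I / 2)"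
  proof (intro eventually_conj)
    show "\<forall>\<^sub>F \<eta> in at_right 0. (0::real) < \<eta>" by (rule eventually_at_right_less)
    show "\<forall>\<^sub>F \<eta> in at_right 0. \<eta> \<le> I / 2" using I by (auto simp: eventually_at_right_field intro!: exI[of _ "I / 2"])
    show "\<forall>\<^sub>F \<eta> in at_right 0. (L / I + 1) * sqrt \<eta> < min (min \<alpha> (1 - \<alpha>) / 2) e"
      using lims(1) by (rule order_tendstoD(2)) (use \<alpha> e in auto)
    show "\<forall>\<^sub>F \<eta> in at_right 0. L * \<eta> / I + remainder_const * (L / I + 1)\<^sup>2 * sqrt \<eta> < e * (I / 2)"
      using lims(2) by (rule order_tendstoD(2)) (use I e in simp)
  qed
  then obtain \<eta> where \<eta>: "0 < \<eta>" "\<eta> \<le> I / 2" "(L / I + 1) * sqrt \<eta> < min (min \<alpha> (1 - \<alpha>) / 2) e"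
      "L * \<eta> / I + remainder_const * (L / I + 1)\<^sup>2 * sqrt \<eta> < e * (I / 2)"
    by (metis (mono_tags, lifting) eventually_happens' trivial_limit_at_right_real)
  let ?E1 = "\<lambda>n. {\<omega> \<in> space M. L\<^sup>2 \<le> (score (X (Suc n) \<omega>))\<^sup>2 * (1 / real (card (X (Suc n) \<omega>)))}"
  let ?E2 = "\<lambda>n. {\<omega> \<in> space M. \<eta> \<le> \<bar>observed_info (X (Suc n) \<omega>) / real (card (X (Suc n) \<omega>)) - fisher_info \<alpha>\<bar>}"
  let ?E3 = "\<lambda>n. {\<omega> \<in> space M. \<eta> \<le> 1 / real (card (X (Suc n) \<omega>))}"
  have ev: "?E1 n \<in> events" "?E2 n \<in> events" "?E3 n \<in> events" "?bad n \<in> events" for n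
    by (rule X_event; simp)+
  have sub: "?bad n \<subseteq> ?E1 n \<union> (?E2 n \<union> ?E3 n)" for n
  proof (rule subsetI, rule ccontr)
    fix \<omega> assume bad: "\<omega> \<in> ?bad n" and no: "\<omega> \<notin> ?E1 n \<union> (?E2 n \<union> ?E3 n)"
    have \<omega>: "\<omega> \<in> space M" using bad by simp
    define \<pi> where "\<pi> = X (Suc n) \<omega>"
    have part: "partition_on {1..Suc n} \<pi>" unfolding \<pi>_def by (rule X_partition) (use \<omega> in auto)
    have c1: "1 \<le> card \<pi>" by (rule partition_card_pos[OF part]) simp
    have "(z_score \<pi>)\<^sup>2 \<le> L\<^sup>2"
      using no \<omega> by (simp add: \<pi>_def[symmetric] z_score_def power_divide)
    then have zL: "\<bar>z_score \<pi>\<bar> \<le> L" using L(1) by (simp add: abs_le_square_iff[symmetric])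
    have o: "\<bar>observed_info \<pi> / real (card \<pi>) - fisher_info \<alpha>\<bar> \<le> \<eta>" and k: "1 / real (card \<pi>) \<le> \<eta>"
      using no \<omega> by (simp_all add: \<pi>_def[symmetric])
    define q where "q = qmle (Suc n) \<pi> - \<alpha>"
    have close: "\<bar>sqrt (real (card \<pi>)) * q - z_score \<pi> / I\<bar> < e"
      unfolding q_def I_def
      by (rule qmle_close[OF part _ e(1,2) zL o k]) (use \<eta> in \<open>auto simp: I_def[symmetric]\<close>)
    have "\<bar>z_score \<pi> / I\<bar> \<le> L / I" using zL I by (simp add: abs_divide divide_right_mono)
    then have "\<bar>sqrt (real (card \<pi>)) * q\<bar> \<le> L / I + 1" using close e by linarith
    then have "sqrt (real (card \<pi>)) * \<bar>q\<bar> \<le> L / I + 1" by (simp add: abs_mult)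
    then have "\<bar>q\<bar> \<le> (L / I + 1) * (1 / sqrt (real (card \<pi>)))" using c1 by (simp add: pos_le_divide_eq mult.commute)
    also have "\<dots> \<le> (L / I + 1) * sqrt \<eta>"
    proof (rule mult_left_mono)
      have "1 / sqrt (real (card \<pi>)) = sqrt (1 / real (card \<pi>))" by (simp add: real_sqrt_divide)
      then show "1 / sqrt (real (card \<pi>)) \<le> sqrt \<eta>" using k by simp
    qed (use L I in simp)
    also have "\<dots> < e" using \<eta>(3) by simp
    finally show False using bad close e(3) by (auto simp: \<pi>_def[symmetric] q_def I_def)
  qed
  have E1: "prob (?E1 n) \<le> \<delta> / 2" for n
  proof -
    have "prob (?E1 n) \<le> (LINT \<omega>|M. (score (X (Suc n) \<omega>))\<^sup>2 * (1 / real (card (X (Suc n) \<omega>)))) / L\<^sup>2"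
      using zero_less_power[OF L(1), of 2] by (intro integral_Markov_inequality_measure[where A = "{}"] integrable_X[of "Suc n" "\<lambda>\<pi>. (score \<pi>)\<^sup>2 * (1 / real (card \<pi>))"]) auto
    also have "\<dots> \<le> (\<bar>B\<bar> + 1) / L\<^sup>2" using B[of "Suc n"] by (intro divide_right_mono) auto
    also have "\<dots> = \<delta> / 2"
    proof -
      have half: "b / (2 * b / \<delta>) = \<delta> / 2" if "0 < b" for b using that \<delta> by simp
      show ?thesis unfolding L(2) by (rule half) simp
    qed
    finally show ?thesis .
  qed
  have E2: "(\<lambda>n. prob (?E2 n)) \<longlonglongrightarrow> 0"
    by (rule prob_X_tendsto_0[OF _ expectation_observed_info \<eta>(1)]) simp
  have E3: "(\<lambda>n. prob (?E3 n)) \<longlonglongrightarrow> 0"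
    by (rule prob_X_tendsto_0[OF _ expectation_inverse_card \<eta>(1)]) simp
  have "\<forall>\<^sub>F n in sequentially. prob (?E2 n) < \<delta> / 4" "\<forall>\<^sub>F n in sequentially. prob (?E3 n) < \<delta> / 4"
    using order_tendstoD(2)[OF E2, of "\<delta> / 4"] order_tendstoD(2)[OF E3, of "\<delta> / 4"] \<delta> by simp_all
  then show "\<forall>\<^sub>F n in sequentially. dist (prob (?bad n)) 0 < \<delta>"
  proof eventually_elim
    case (elim n)
    have "prob (?bad n) \<le> prob (?E1 n \<union> (?E2 n \<union> ?E3 n))" using ev by (intro finite_measure_mono sub) auto
    also have "\<dots> \<le> prob (?E1 n) + prob (?E2 n \<union> ?E3 n)" using ev by (intro measure_Un_le) auto
    also have "\<dots> \<le> prob (?E1 n) + (prob (?E2 n) + prob (?E3 n))" using ev by (intro add_left_mono measure_Un_le) auto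
    finally show ?case using elim E1[of n] by simp
  qed
qed

end

section \<open>Mixing convergence and standard normal quantiles\<close>

lemma integrable_mult_bounded:
  fixes u Y :: "'a \<Rightarrow> real"
  assumes u: "integrable M u" and Y: "Y \<in> borel_measurable M" "\<And>x. \<bar>Y x\<bar> \<le> K"
  shows "integrable M (\<lambda>x. u x * Y x)"
proof (rule Bochner_Integration.integrable_bound[where f = "\<lambda>x. K * u x"])
  show "(\<lambda>x. u x * Y x) \<in> borel_measurable M" using u Y(1) by auto
  show "AE x in M. norm (u x * Y x) \<le> norm (K * u x)"
  proof (rule AE_I2)
    fix x
    have "\<bar>u x\<bar> * \<bar>Y x\<bar> \<le> \<bar>u x\<bar> * \<bar>K\<bar>" using Y(2)[of x] by (intro mult_left_mono) auto
    then show "norm (u x * Y x) \<le> norm (K * u x)" by (simp add: abs_mult mult.commute)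
  qed
qed (use u in simp)

lemma (in prob_space) real_cond_exp_indep:
  fixes N :: "'a \<Rightarrow> real" and h :: "real \<Rightarrow> real"
  assumes sub: "subalgebra M G" and N: "N \<in> borel_measurable M"
    and h: "h \<in> borel_measurable borel" and int: "integrable M (\<lambda>\<omega>. h (N \<omega>))"
    and ind: "indep_set {N -` A \<inter> space M | A. A \<in> sets borel} (sets G)"
  shows "AE \<omega> in M. real_cond_exp M G (\<lambda>\<omega>. h (N \<omega>)) \<omega> = (LINT \<omega>|M. h (N \<omega>))"
proof -
  interpret finite_measure_subalgebra M G
    using sub by unfold_locales
  show ?thesis
  proof (rule real_cond_exp_charact[OF _ int])
    fix A assume A: "A \<in> sets G"
    then have AM: "A \<in> events" using sub by (auto simp: subalgebra_def)
    have stable: "Int_stable {g -` B \<inter> space M | B. B \<in> sets borel}" for g :: "'a \<Rightarrow> real"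
    proof (rule Int_stableI)
      fix a b assume "a \<in> {g -` B \<inter> space M | B. B \<in> sets borel}" "b \<in> {g -` B \<inter> space M | B. B \<in> sets borel}"
      then obtain B C where BC: "a = g -` B \<inter> space M" "b = g -` C \<inter> space M" "B \<in> sets borel" "C \<in> sets borel" by blast
      then have "a \<inter> b = g -` (B \<inter> C) \<inter> space M" "B \<inter> C \<in> sets borel" by auto
      then show "a \<inter> b \<in> {g -` B \<inter> space M | B. B \<in> sets borel}" by blast
    qed
    have "indep_var borel N borel (indicator A :: 'a \<Rightarrow> real)"
      unfolding indep_var_eq
    proof (intro conjI indep_set_sigma_sets)
      show "indep_set {N -` B \<inter> space M | B. B \<in> sets borel} {(indicator A :: 'a \<Rightarrow> real) -` B \<inter> space M | B. B \<in> sets borel}"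
      proof (rule indep_setI)
        show "{N -` B \<inter> space M | B. B \<in> sets borel} \<subseteq> events" using N by auto
        show "{(indicator A :: 'a \<Rightarrow> real) -` B \<inter> space M | B. B \<in> sets borel} \<subseteq> events"
          using AM by (auto intro!: measurable_sets[of _ M borel])
        fix a b assume a: "a \<in> {N -` B \<inter> space M | B. B \<in> sets borel}"
          and b: "b \<in> {(indicator A :: 'a \<Rightarrow> real) -` B \<inter> space M | B. B \<in> sets borel}"
        have "(indicator A :: 'a \<Rightarrow> real) \<in> borel_measurable G" using A by simp
        moreover have "space G = space M" using sub by (simp add: subalgebra_def)
        ultimately have "b \<in> sets G" using b measurable_sets[of "indicator A :: 'a \<Rightarrow> real" G borel] by auto
        then show "prob (a \<inter> b) = prob a * prob b" using indep_setD[OF ind a] by simp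
      qed
      show "Int_stable {N -` B \<inter> space M | B. B \<in> sets borel}"
        "Int_stable {(indicator A :: 'a \<Rightarrow> real) -` B \<inter> space M | B. B \<in> sets borel}"
        by (rule stable)+
    qed (use N AM in auto)
    from indep_var_compose[OF this h measurable_ident]
    have iv: "indep_var borel (\<lambda>\<omega>. h (N \<omega>)) borel (indicator A :: 'a \<Rightarrow> real)"
      by (simp add: comp_def)
    have "(LINT \<omega>|M. h (N \<omega>) * indicator A \<omega>) = (LINT \<omega>|M. h (N \<omega>)) * (LINT \<omega>|M. indicator A \<omega>)"
      by (rule indep_var_lebesgue_integral[OF iv int]) (use AM in \<open>simp add: emeasure_eq_measure\<close>)
    then show "(\<integral>\<omega>\<in>A. h (N \<omega>) \<partial>M) = (\<integral>\<omega>\<in>A. (LINT \<omega>|M. h (N \<omega>)) \<partial>M)"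
      using AM by (simp add: set_lebesgue_integral_def mult.commute)
  qed auto
qed

context prob_space
begin

text \<open>\<open>Y\<close> decouples from the weight \<open>f\<close> in the limit. For \<open>Y n = h (Z n)\<close> with bounded continuous \<open>h\<close> and all
weights measurable for a sub-\<open>\<sigma>\<close>-algebra, this is stable convergence of \<open>Z\<close> to a limit independent
of that \<open>\<sigma>\<close>-algebra.\<close>

definition mixes :: "(nat \<Rightarrow> 'a \<Rightarrow> real) \<Rightarrow> real \<Rightarrow> ('a \<Rightarrow> real) \<Rightarrow> bool" where
  "mixes Y c f \<longleftrightarrow> (\<lambda>n. LINT \<omega>|M. f \<omega> * Y n \<omega>) \<longlonglongrightarrow> (LINT \<omega>|M. f \<omega>) * c"

text \<open>Since \<open>Y\<close> is uniformly bounded, the integrals depend on the weight continuously in mean, uniformly in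
\<open>n\<close>.\<close>

lemma mixes_approx:
  assumes Y: "\<And>n. Y n \<in> borel_measurable M" "\<And>n \<omega>. \<bar>Y n \<omega>\<bar> \<le> K" "\<bar>c\<bar> \<le> K"
    and f: "integrable M f"
    and approx: "\<And>\<epsilon>. 0 < \<epsilon> \<Longrightarrow> \<exists>g. integrable M g \<and> mixes Y c g \<and> (LINT \<omega>|M. \<bar>f \<omega> - g \<omega>\<bar>) \<le> \<epsilon>"
  shows "mixes Y c f"
  unfolding mixes_def
proof (rule tendstoI)
  fix e :: real assume e: "0 < e"
  have K: "0 \<le> K" using assms(3) by linarith
  define \<epsilon> where "\<epsilon> = e / (4 * (K + 1))"
  have \<epsilon>: "0 < \<epsilon>" using e K by (simp add: \<epsilon>_def)
  have K\<epsilon>: "K * \<epsilon> \<le> e / 4"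
  proof -
    have "K * \<epsilon> \<le> (K + 1) * \<epsilon>" using \<epsilon> by (intro mult_right_mono) auto
    also have "\<dots> = e / 4"
    proof -
      have "b * (e / (4 * b)) = e / 4" if "0 < b" for b using that by simp
      then show ?thesis unfolding \<epsilon>_def using K by (simp only: add_nonneg_pos zero_less_one)
    qed
    finally show ?thesis .
  qed
  obtain g where g: "integrable M g" "mixes Y c g" "(LINT \<omega>|M. \<bar>f \<omega> - g \<omega>\<bar>) \<le> \<epsilon>" using approx[OF \<epsilon>] by blast
  have intY: "integrable M (\<lambda>\<omega>. u \<omega> * Y n \<omega>)" if "integrable M u" for u n
    using that Y(1,2) by (rule integrable_mult_bounded)
  have d1: "\<bar>(LINT \<omega>|M. f \<omega> * Y n \<omega>) - (LINT \<omega>|M. g \<omega> * Y n \<omega>)\<bar> \<le> e / 4" for n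
  proof -
    have "(LINT \<omega>|M. f \<omega> * Y n \<omega>) - (LINT \<omega>|M. g \<omega> * Y n \<omega>) = (LINT \<omega>|M. (f \<omega> - g \<omega>) * Y n \<omega>)"
      using intY[OF f] intY[OF g(1)] by (simp add: left_diff_distrib)
    also have "norm \<dots> \<le> (LINT \<omega>|M. K * \<bar>f \<omega> - g \<omega>\<bar>)"
    proof (rule norm_integral_le)
      show "integrable M (\<lambda>\<omega>. (f \<omega> - g \<omega>) * Y n \<omega>)" using f g by (intro intY) auto
      show "integrable M (\<lambda>\<omega>. K * \<bar>f \<omega> - g \<omega>\<bar>)" using f g by auto
      show "norm ((f \<omega> - g \<omega>) * Y n \<omega>) \<le> K * \<bar>f \<omega> - g \<omega>\<bar>" for \<omega>
        using mult_right_mono[OF Y(2)[of n \<omega>], of "\<bar>f \<omega> - g \<omega>\<bar>"] by (simp add: abs_mult mult.commute)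
    qed
    also have "\<dots> \<le> K * \<epsilon>" using g(3) K by (simp add: mult_left_mono)
    finally show ?thesis using K\<epsilon> by simp
  qed
  have d2: "\<bar>(LINT \<omega>|M. f \<omega>) * c - (LINT \<omega>|M. g \<omega>) * c\<bar> \<le> e / 4"
  proof -
    have "\<bar>(LINT \<omega>|M. f \<omega>) - (LINT \<omega>|M. g \<omega>)\<bar> = \<bar>LINT \<omega>|M. f \<omega> - g \<omega>\<bar>" using f g by simp
    also have "\<dots> \<le> (LINT \<omega>|M. \<bar>f \<omega> - g \<omega>\<bar>)" by (rule integral_abs_bound)
    finally have "\<bar>(LINT \<omega>|M. f \<omega>) - (LINT \<omega>|M. g \<omega>)\<bar> * \<bar>c\<bar> \<le> \<epsilon> * K"
      using g(3) assms(3) K \<epsilon> by (intro mult_mono) auto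
    moreover have "\<bar>(LINT \<omega>|M. f \<omega>) * c - (LINT \<omega>|M. g \<omega>) * c\<bar> = \<bar>(LINT \<omega>|M. f \<omega>) - (LINT \<omega>|M. g \<omega>)\<bar> * \<bar>c\<bar>"
      by (simp only: abs_mult[symmetric] left_diff_distrib)
    ultimately show ?thesis using K\<epsilon> mult.commute[of \<epsilon> K] by linarith
  qed
  have "\<forall>\<^sub>F n in sequentially. dist (LINT \<omega>|M. g \<omega> * Y n \<omega>) ((LINT \<omega>|M. g \<omega>) * c) < e / 4"
    using g(2) e unfolding mixes_def by (intro tendstoD) auto
  then show "\<forall>\<^sub>F n in sequentially. dist (LINT \<omega>|M. f \<omega> * Y n \<omega>) ((LINT \<omega>|M. f \<omega>) * c) < e"
  proof eventually_elim
    case (elim n)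
    then show ?case using d1[of n] d2 e unfolding dist_real_def by linarith
  qed
qed

text \<open>From a generating \<open>\<pi>\<close>-system to indicators by Dynkin's theorem, and from indicators to integrable
functions by linearity and approximation in mean.\<close>

lemma mixes_generated:
  assumes sub: "subalgebra M G" and gen: "sets G = sigma_sets (space M) \<E>"
    and \<E>: "Int_stable \<E>" "\<E> \<subseteq> Pow (space M)" "space M \<in> \<E>"
    and Y: "\<And>n. Y n \<in> borel_measurable M" "\<And>n \<omega>. \<bar>Y n \<omega>\<bar> \<le> K" "\<bar>c\<bar> \<le> K"
    and base: "\<And>A. A \<in> \<E> \<Longrightarrow> mixes Y c (indicator A)"
    and f: "integrable M f" "f \<in> borel_measurable G"
  shows "mixes Y c f"
proof -
  have Gev: "A \<in> events" if "A \<in> sets G" for A using that sub by (auto simp: subalgebra_def)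
  have int_ind: "integrable M (indicator A :: 'a \<Rightarrow> real)" if "A \<in> sets G" for A
    using Gev[OF that] by (simp add: emeasure_eq_measure)
  have intY: "integrable M (\<lambda>\<omega>. u \<omega> * Y n \<omega>)" if "integrable M u" for u n
    using that Y(1,2) by (rule integrable_mult_bounded)
  have mixes_add: "mixes Y c (\<lambda>\<omega>. u \<omega> + v \<omega>)" if "integrable M u" "integrable M v" "mixes Y c u" "mixes Y c v" for u v
    using tendsto_add[OF that(3,4)[unfolded mixes_def]] that(1,2) intY
    unfolding mixes_def by (simp add: distrib_right)
  have scale: "mixes Y c (\<lambda>\<omega>. a * u \<omega>)" if "mixes Y c u" for u a
    using tendsto_mult_left[OF that[unfolded mixes_def], of a] unfolding mixes_def by (simp add: mult.assoc)
  have ind: "mixes Y c (indicator A)" if "A \<in> sigma_sets (space M) \<E>" for A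
    using \<E>(1,2) that
  proof (induction rule: sigma_sets_induct_disjoint)
    case (basic A)
    then show ?case by (rule base)
  next
    case empty
    show ?case by (simp add: mixes_def)
  next
    case (compl A)
    have A: "A \<in> sets G" using compl by (simp add: gen)
    have \<Omega>: "space M \<in> sets G" unfolding gen using \<E>(3) by (rule sigma_sets.Basic)
    have "mixes Y c (\<lambda>\<omega>. indicator (space M) \<omega> + (- 1) * indicator A \<omega>)"
      using int_ind[OF A] int_ind[OF \<Omega>] compl base[OF \<E>(3)] by (intro mixes_add scale) auto
    moreover have "indicator (space M) \<omega> + (- 1) * indicator A \<omega> = (indicator (space M - A) \<omega> :: real)" for \<omega>
      using sets.sets_into_space[OF Gev[OF A]] by (auto simp: indicator_def)
    ultimately show ?case by simp
  next
    case (union A)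
    have A: "A i \<in> sets G" for i using union(2) by (auto simp: gen)
    then have UA: "(\<Union>i. A i) \<in> sets G" by auto
    show ?case
    proof (rule mixes_approx[OF Y int_ind[OF UA]])
      fix \<epsilon> :: real assume \<epsilon>: "0 < \<epsilon>"
      have "(\<lambda>i. prob (A i)) sums prob (\<Union>i. A i)"
        by (rule finite_measure_UNION[OF _ union(1)]) (use A Gev in auto)
      then have "(\<lambda>N. \<Sum>i<N. prob (A i)) \<longlonglongrightarrow> prob (\<Union>i. A i)" by (simp add: sums_def)
      from tendstoD[OF this \<epsilon>] obtain N where N: "\<bar>(\<Sum>i<N. prob (A i)) - prob (\<Union>i. A i)\<bar> < \<epsilon>"
        unfolding eventually_sequentially dist_real_def by blast
      define g where "g \<omega> = (\<Sum>i<N. indicator (A i) \<omega> :: real)" for \<omega>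
      have g_eq: "g = indicator (\<Union>i<N. A i)"
        unfolding g_def using union(1) by (intro ext) (simp add: indicator_UN_disjoint disjoint_family_on_def)
      have g_int: "integrable M g" unfolding g_def by (intro Bochner_Integration.integrable_sum int_ind A)
      have g_mix: "mixes Y c g"
        unfolding g_def
      proof (induction N)
        case 0
        show ?case by (simp add: mixes_def)
      next
        case (Suc N)
        have "mixes Y c (\<lambda>\<omega>. (\<Sum>i<N. indicator (A i) \<omega>) + indicator (A N) \<omega>)"
          by (intro mixes_add Suc union(3) int_ind A Bochner_Integration.integrable_sum)
        then show ?case by simp
      qed
      have "\<bar>indicator (\<Union>i. A i) \<omega> - g \<omega>\<bar> = indicator (\<Union>i. A i) \<omega> - g \<omega>" for \<omega>
        unfolding g_eq by (auto simp: indicator_def)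
      then have "(LINT \<omega>|M. \<bar>indicator (\<Union>i. A i) \<omega> - g \<omega>\<bar>) = (LINT \<omega>|M. indicator (\<Union>i. A i) \<omega> - g \<omega>)" by simp
      also have "\<dots> = (LINT \<omega>|M. indicator (\<Union>i. A i) \<omega>) - (LINT \<omega>|M. g \<omega>)"
        by (rule Bochner_Integration.integral_diff[OF int_ind[OF UA] g_int])
      also have "(LINT \<omega>|M. g \<omega>) = (\<Sum>i<N. LINT \<omega>|M. indicator (A i) \<omega>)"
        unfolding g_def by (intro Bochner_Integration.integral_sum int_ind A)
      also have "(LINT \<omega>|M. indicator (\<Union>i. A i) \<omega>) - (\<Sum>i<N. LINT \<omega>|M. indicator (A i) \<omega>) = prob (\<Union>i. A i) - (\<Sum>i<N. prob (A i))"
        using Gev[OF A] Gev[OF UA] by (simp del: sets.countable_UN add: Int_absorb2 sets.sets_into_space)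
      finally have "(LINT \<omega>|M. \<bar>indicator (\<Union>i. A i) \<omega> - g \<omega>\<bar>) \<le> \<epsilon>" using N by linarith
      then show "\<exists>g. integrable M g \<and> mixes Y c g \<and> (LINT \<omega>|M. \<bar>indicator (\<Union>i. A i) \<omega> - g \<omega>\<bar>) \<le> \<epsilon>"
        using g_int g_mix by blast
    qed
  qed
  have "integrable (restr_to_subalg M G) f" using integrable_in_subalg[OF sub f(2,1)] .
  then show ?thesis
  proof (induction rule: integrable_induct)
    case (base A a)
    then have "A \<in> sets G" using sub by (simp add: sets_restr_to_subalg)
    then have "mixes Y c (\<lambda>\<omega>. a * indicator A \<omega>)" by (intro scale ind) (simp add: gen)
    then show ?case by (simp add: mult.commute)
  next
    case (add u v)
    then show ?case
      by (intro mixes_add integrable_from_subalg[OF sub add.hyps(1)] integrable_from_subalg[OF sub add.hyps(2)] add.IH)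
  next
    case (lim u s)
    have sp: "space (restr_to_subalg M G) = space M" by (simp add: space_restr_to_subalg)
    have u: "integrable M u" by (rule integrable_from_subalg[OF sub lim.hyps(4)])
    have s: "integrable M (s i)" for i by (rule integrable_from_subalg[OF sub lim.hyps(1)])
    show ?case
    proof (rule mixes_approx[OF Y u])
      fix \<epsilon> :: real assume \<epsilon>: "0 < \<epsilon>"
      have "(\<lambda>i. LINT \<omega>|M. \<bar>u \<omega> - s i \<omega>\<bar>) \<longlonglongrightarrow> (LINT \<omega>|M. 0)"
      proof (rule integral_dominated_convergence[where w = "\<lambda>\<omega>. 3 * \<bar>u \<omega>\<bar>"])
        show "AE \<omega> in M. (\<lambda>i. \<bar>u \<omega> - s i \<omega>\<bar>) \<longlonglongrightarrow> 0"
        proof (rule AE_I2)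
          fix \<omega> assume "\<omega> \<in> space M"
          then have "(\<lambda>i. s i \<omega>) \<longlonglongrightarrow> u \<omega>" using lim.hyps(2) sp by simp
          from tendsto_rabs[OF tendsto_diff[OF tendsto_const this, of "u \<omega>"]]
          show "(\<lambda>i. \<bar>u \<omega> - s i \<omega>\<bar>) \<longlonglongrightarrow> 0" by simp
        qed
        show "AE \<omega> in M. norm \<bar>u \<omega> - s i \<omega>\<bar> \<le> 3 * \<bar>u \<omega>\<bar>" for i
        proof (rule AE_I2)
          fix \<omega> assume "\<omega> \<in> space M"
          then have "\<bar>s i \<omega>\<bar> \<le> 2 * \<bar>u \<omega>\<bar>" using lim.hyps(3)[of \<omega> i] sp by simp
          then show "norm \<bar>u \<omega> - s i \<omega>\<bar> \<le> 3 * \<bar>u \<omega>\<bar>" by simp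
        qed
      qed (use u s in auto)
      then have "(\<lambda>i. LINT \<omega>|M. \<bar>u \<omega> - s i \<omega>\<bar>) \<longlonglongrightarrow> 0" by simp
      from order_tendstoD(2)[OF this \<epsilon>] obtain i where "(LINT \<omega>|M. \<bar>u \<omega> - s i \<omega>\<bar>) < \<epsilon>"
        unfolding eventually_sequentially by blast
      then show "\<exists>g. integrable M g \<and> mixes Y c g \<and> (LINT \<omega>|M. \<bar>u \<omega> - g \<omega>\<bar>) \<le> \<epsilon>"
        using s lim.IH less_imp_le by blast
    qed
  qed
qed

end

lemma std_normal_symmetric: "distr std_normal_distribution borel uminus = std_normal_distribution"
proof (rule Levy_uniqueness)
  interpret real_distribution std_normal_distribution by (rule real_dist_normal_dist)
  show "real_distribution (distr std_normal_distribution borel uminus)" by (rule real_distribution_distr) simp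
  show "real_distribution std_normal_distribution" by (rule real_dist_normal_dist)
  show "char (distr std_normal_distribution borel uminus) = char std_normal_distribution"
  proof
    fix t
    have "char (distr std_normal_distribution borel uminus) t = char std_normal_distribution (- t)"
      unfolding char_def by (subst integral_distr) auto
    then show "char (distr std_normal_distribution borel uminus) t = char std_normal_distribution t"
      by (simp add: char_std_normal_distribution)
  qed
qed

lemma std_normal_singleton: "measure std_normal_distribution {x} = 0"
proof -
  have "emeasure std_normal_distribution {x} = 0"
    by (subst emeasure_density) (auto simp: nn_integral_0_iff_AE intro!: AE_mp[OF AE_lborel_singleton[of x]])
  then show ?thesis by (simp add: measure_def)
qed

lemma isCont_cdf_std_normal: "isCont (cdf std_normal_distribution) x"
proof -
  interpret real_distribution std_normal_distribution by (rule real_dist_normal_dist)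
  show ?thesis by (simp add: isCont_cdf std_normal_singleton)
qed

text \<open>The distribution function is continuous and takes all values in \<open>(0, 1)\<close>.\<close>

lemma cdf_quantile_std_normal:
  assumes p: "0 < p" "p < 1"
  shows "cdf std_normal_distribution (quantile std_normal_distribution p) = p"
proof -
  interpret real_distribution std_normal_distribution by (rule real_dist_normal_dist)
  let ?F = "cdf std_normal_distribution"
  have cont: "continuous_on UNIV ?F" by (simp add: continuous_on_eq_continuous_at isCont_cdf_std_normal)
  obtain a where a: "?F a < p"
    using order_tendstoD(2)[OF cdf_lim_at_bot p(1)] by (auto simp: eventually_at_bot_linorder)
  obtain b where b: "p < ?F b"
    using order_tendstoD(1)[OF cdf_lim_at_top_prob p(2)] by (auto simp: eventually_at_top_linorder)
  have ab: "a \<le> b" using a b cdf_nondecreasing[of b a] by linarith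
  obtain x where x: "?F x = p"
    using IVT'[of ?F a p b] a b ab continuous_on_subset[OF cont] by auto
  define S where "S = {x. p \<le> ?F x}"
  have closed: "closed S" unfolding S_def using cont by (intro closed_Collect_le continuous_on_const) auto
  have bdd: "bdd_below S"
  proof (rule bdd_belowI)
    fix y assume "y \<in> S"
    then show "a \<le> y" using a cdf_nondecreasing[of y a] by (auto simp: S_def intro: leI)
  qed
  have xS: "x \<in> S" by (simp add: S_def x)
  have "Inf S \<in> S" using closed bdd xS by (intro closed_contains_Inf) auto
  then have "p \<le> ?F (Inf S)" by (simp add: S_def)
  moreover have "?F (Inf S) \<le> p" using cdf_nondecreasing[OF cInf_lower[OF xS bdd]] x by simp
  ultimately show ?thesis by (simp add: quantile_def S_def)
qed

lemma abs_std_normal_quantile: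
  assumes \<epsilon>: "0 < \<epsilon>" "\<epsilon> < 1"
  defines "\<tau> \<equiv> quantile std_normal_distribution (1 - \<epsilon> / 2)"
  shows "measure std_normal_distribution {x. \<bar>x\<bar> \<le> \<tau>} = 1 - \<epsilon>"
proof -
  interpret real_distribution std_normal_distribution by (rule real_dist_normal_dist)
  let ?m = "measure std_normal_distribution"
  have F: "?m {..\<tau>} = 1 - \<epsilon> / 2"
    using cdf_quantile_std_normal[of "1 - \<epsilon> / 2"] \<epsilon> by (simp add: \<tau>_def cdf_def)
  have sym: "?m {- \<tau>..} = 1 - \<epsilon> / 2"
  proof -
    have "?m {..\<tau>} = measure (distr std_normal_distribution borel uminus) {..\<tau>}" by (simp add: std_normal_symmetric)
    also have "\<dots> = ?m (uminus -` {..\<tau>} \<inter> space std_normal_distribution)" by (subst measure_distr) auto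
    also have "uminus -` {..\<tau>} \<inter> space std_normal_distribution = {- \<tau>..}" by auto
    finally show ?thesis using F by simp
  qed
  have \<tau>: "- \<tau> \<le> \<tau>"
  proof (rule ccontr)
    assume "\<not> - \<tau> \<le> \<tau>"
    then have "?m ({..\<tau>} \<union> {- \<tau>..}) = ?m {..\<tau>} + ?m {- \<tau>..}" by (intro finite_measure_Union) auto
    then show False using F sym prob_le_1[of "{..\<tau>} \<union> {- \<tau>..}"] \<epsilon> by simp
  qed
  have "?m {..<- \<tau>} = 1 - ?m {- \<tau>..}"
  proof -
    have "space std_normal_distribution - {- \<tau>..} = {..<- \<tau>}" by auto
    then show ?thesis using prob_compl[of "{- \<tau>..}"] by simp
  qed
  then have low: "?m {..<- \<tau>} = \<epsilon> / 2" using sym by simp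
  have sub: "{..<- \<tau>} \<subseteq> {..\<tau>}"
  proof
    fix x assume "x \<in> {..<- \<tau>}"
    then have "x < - \<tau>" by simp
    then have "x \<le> \<tau>" using \<tau> by linarith
    then show "x \<in> {..\<tau>}" by simp
  qed
  have "{x. \<bar>x\<bar> \<le> \<tau>} = {..\<tau>} - {..<- \<tau>}" by auto
  moreover have "?m ({..\<tau>} - {..<- \<tau>}) = ?m {..\<tau>} - ?m {..<- \<tau>}"
    by (rule finite_measure_Diff[OF _ _ sub]) simp_all
  ultimately show ?thesis unfolding F low by simp
qed

section \<open>Stable convergence and coverage\<close>

context gibbs_chain
begin

definition tv_stat :: "nat \<Rightarrow> nat set set \<Rightarrow> real" where
  "tv_stat n \<pi> = real n * sqrt (fisher_info \<alpha> / real (card \<pi>))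
     * tv_dist (card \<pi>) (predictive_est n \<pi>) (predictive \<alpha> \<mu> n \<pi>)"

definition std_score :: "nat set set \<Rightarrow> real" where
  "std_score \<pi> = z_score \<pi> / sqrt (fisher_info \<alpha>)"

lemma tv_stat_approx:
  assumes part: "partition_on {1..n} \<pi>" and n: "1 \<le> n"
  shows "\<bar>tv_stat n \<pi> - \<bar>std_score \<pi>\<bar>\<bar> \<le> sqrt (fisher_info \<alpha>) * rate_const * sqrt (1 / real (card \<pi>))
     + sqrt (fisher_info \<alpha>) * \<bar>sqrt (real (card \<pi>)) * (qmle n \<pi> - \<alpha>) - z_score \<pi> / fisher_info \<alpha>\<bar>"
proof -
  define I k sI sk q z tv R where "I = fisher_info \<alpha>" and "k = real (card \<pi>)" and "sI = sqrt I" and "sk = sqrt k"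
    and "q = qmle n \<pi> - \<alpha>" and "z = z_score \<pi>"
    and "tv = tv_dist (card \<pi>) (predictive_est n \<pi>) (predictive \<alpha> \<mu> n \<pi>)" and "R = rate_const"
  have I: "0 < I" using fisher_info_pos[OF \<alpha>] by (simp add: I_def)
  have sI: "0 < sI" "sI * sI = I" using I by (simp_all add: sI_def)
  have k: "1 \<le> k" using partition_card_pos[OF part n] by (simp add: k_def)
  have sk: "0 < sk" "sk * sk = k" using k by (simp_all add: sk_def)
  have n0: "0 < real n" using n by simp
  have ts: "tv_stat n \<pi> = real n * (sI / sk) * tv"
    by (simp add: tv_stat_def I_def[symmetric] k_def[symmetric] sI_def sk_def tv_def real_sqrt_divide)
  have "\<bar>tv - k * \<bar>q\<bar> / real n\<bar> \<le> R / real n"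
    using tv_dist_approx[OF part n] by (simp add: tv_def k_def q_def R_def)
  then have "(real n * (sI / sk)) * \<bar>tv - k * \<bar>q\<bar> / real n\<bar> \<le> (real n * (sI / sk)) * (R / real n)"
    using sI sk by (intro mult_left_mono) auto
  moreover have "(real n * (sI / sk)) * (R / real n) = sI * R * (1 / sk)" using n0 by simp
  moreover have "(real n * (sI / sk)) * \<bar>tv - k * \<bar>q\<bar> / real n\<bar> = \<bar>tv_stat n \<pi> - sI * \<bar>sk * q\<bar>\<bar>"
  proof -
    have "(real n * (sI / sk)) * \<bar>tv - k * \<bar>q\<bar> / real n\<bar> = \<bar>(real n * (sI / sk)) * (tv - k * \<bar>q\<bar> / real n)\<bar>"
      using sI sk by (simp add: abs_mult)
    also have "(real n * (sI / sk)) * (tv - k * \<bar>q\<bar> / real n) = tv_stat n \<pi> - (real n * (sI / sk)) * (k * \<bar>q\<bar> / real n)"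
      unfolding ts by (rule right_diff_distrib)
    also have "(real n * (sI / sk)) * (k * \<bar>q\<bar> / real n) = sI * \<bar>sk * q\<bar>"
      unfolding sk(2)[symmetric] using n0 sk(1) by (simp add: abs_mult)
    finally show ?thesis .
  qed
  ultimately have 1: "\<bar>tv_stat n \<pi> - sI * \<bar>sk * q\<bar>\<bar> \<le> sI * R * (1 / sk)" by simp
  have "\<bar>std_score \<pi>\<bar> = sI * \<bar>z / I\<bar>"
    unfolding sI(2)[symmetric] using sI(1)
    by (simp add: std_score_def z_def[symmetric] I_def[symmetric] sI_def[symmetric] abs_divide abs_mult)
  then have "sI * \<bar>sk * q\<bar> - \<bar>std_score \<pi>\<bar> = sI * (\<bar>sk * q\<bar> - \<bar>z / I\<bar>)"
    by (simp only: right_diff_distrib)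
  then have "\<bar>sI * \<bar>sk * q\<bar> - \<bar>std_score \<pi>\<bar>\<bar> = sI * \<bar>\<bar>sk * q\<bar> - \<bar>z / I\<bar>\<bar>"
    by (simp only: abs_mult abs_of_pos[OF sI(1)])
  also have "\<dots> \<le> sI * \<bar>sk * q - z / I\<bar>" using sI(1) by (intro mult_left_mono abs_triangle_ineq3) auto
  finally have 2: "\<bar>sI * \<bar>sk * q\<bar> - \<bar>std_score \<pi>\<bar>\<bar> \<le> sI * \<bar>sk * q - z / I\<bar>" .
  have "\<bar>u - w\<bar> \<le> a + b" if "\<bar>u - v\<bar> \<le> a" "\<bar>v - w\<bar> \<le> b" for u v w a b :: real using that by linarith
  from this[OF 1 2] show ?thesis
    by (simp add: sI_def sk_def I_def k_def R_def q_def z_def real_sqrt_divide)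
qed

abbreviation bad_event :: "real \<Rightarrow> nat \<Rightarrow> 'w set" where
  "bad_event \<epsilon> n \<equiv> {\<omega> \<in> space M. \<epsilon> \<le> \<bar>sqrt (real (card (X (Suc n) \<omega>))) * (qmle (Suc n) (X (Suc n) \<omega>) - \<alpha>)
        - z_score (X (Suc n) \<omega>) / fisher_info \<alpha>\<bar> \<or> \<epsilon> \<le> \<bar>qmle (Suc n) (X (Suc n) \<omega>) - \<alpha>\<bar>}"

abbreviation few_blocks :: "real \<Rightarrow> nat \<Rightarrow> 'w set" where
  "few_blocks \<epsilon> n \<equiv> {\<omega> \<in> space M. \<epsilon> \<le> 1 / real (card (X (Suc n) \<omega>))}"

lemma bad_events_vanish:
  assumes "0 < \<epsilon>" "0 < \<epsilon>'"
  shows "(\<lambda>n. prob (bad_event \<epsilon> n \<union> few_blocks \<epsilon>' n)) \<longlonglongrightarrow> 0"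
proof (rule tendsto_sandwich[OF _ _ tendsto_const])
  have ev: "bad_event \<epsilon> n \<in> events" "few_blocks \<epsilon>' n \<in> events" for n by (rule X_event; simp)+
  show "\<forall>\<^sub>F n in sequentially. prob (bad_event \<epsilon> n \<union> few_blocks \<epsilon>' n) \<le> prob (bad_event \<epsilon> n) + prob (few_blocks \<epsilon>' n)"
    using ev by (intro always_eventually allI measure_Un_le)
  have "(\<lambda>n. prob (few_blocks \<epsilon>' n)) \<longlonglongrightarrow> 0"
    by (rule prob_X_tendsto_0[OF _ expectation_inverse_card assms(2)]) simp
  from tendsto_add[OF qmle_linearization[OF assms(1)] this]
  show "(\<lambda>n. prob (bad_event \<epsilon> n) + prob (few_blocks \<epsilon>' n)) \<longlonglongrightarrow> 0" by simp
qed simp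

text \<open>The correction \<open>g\<close> makes room for the confidence statement, where the Fisher information is evaluated
at the estimator: the error of this replacement is a function of the estimator that vanishes and is
continuous at \<open>\<alpha>\<close>.\<close>

lemma corrected_tv_stat_close:
  assumes \<epsilon>: "0 < \<epsilon>" and g: "isCont g \<alpha>" "g \<alpha> = 0"
  shows "(\<lambda>n. prob {\<omega> \<in> space M. \<epsilon> \<le> \<bar>(tv_stat (Suc n) (X (Suc n) \<omega>) - g (qmle (Suc n) (X (Suc n) \<omega>))) - \<bar>std_score (X (Suc n) \<omega>)\<bar>\<bar>}) \<longlonglongrightarrow> 0"
proof -
  define sI where "sI = sqrt (fisher_info \<alpha>)"
  have sI: "0 < sI" using fisher_info_pos[OF \<alpha>] by (simp add: sI_def)
  have R: "1 \<le> rate_const" by (rule rate_const_ge)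
  obtain d where d: "0 < d" "\<And>x. \<bar>x - \<alpha>\<bar> < d \<Longrightarrow> \<bar>g x\<bar> < \<epsilon> / 3"
  proof -
    have "\<exists>d>0. \<forall>x. dist x \<alpha> < d \<longrightarrow> dist (g x) (g \<alpha>) < \<epsilon> / 3"
      using g(1)[unfolded continuous_at_eps_delta, rule_format, of "\<epsilon> / 3"] \<epsilon> by simp
    then show ?thesis using that g(2) by (auto simp: dist_real_def)
  qed
  \<comment> \<open>each of the three error terms gets a third of \<open>\<epsilon>\<close>; \<open>e'\<close> is squared because \<open>1 / k\<close> enters through
    its square root\<close>
  define e where "e = min d (\<epsilon> / (3 * sI))"
  define e' where "e' = (\<epsilon> / (3 * (sI * rate_const)))\<^sup>2"
  have e: "0 < e" "e \<le> d" "sI * e \<le> \<epsilon> / 3"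
  proof -
    show "0 < e" "e \<le> d" using d \<epsilon> sI by (auto simp: e_def)
    have "sI * e \<le> sI * (\<epsilon> / (3 * sI))" using sI by (intro mult_left_mono) (auto simp: e_def)
    then show "sI * e \<le> \<epsilon> / 3" using sI by simp
  qed
  have e': "0 < e'" using \<epsilon> sI R by (simp add: e'_def)
  show ?thesis
  proof (rule prob_tendsto_0_mono[OF _ _ _ bad_events_vanish[OF e(1) e']])
    show "{\<omega> \<in> space M. \<epsilon> \<le> \<bar>(tv_stat (Suc n) (X (Suc n) \<omega>) - g (qmle (Suc n) (X (Suc n) \<omega>))) - \<bar>std_score (X (Suc n) \<omega>)\<bar>\<bar>} \<in> events" for n
      by (rule X_event) simp
    have ev: "bad_event e n \<in> events" "few_blocks e' n \<in> events" for n by (rule X_event; simp)+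
    then show "bad_event e n \<union> few_blocks e' n \<in> events" for n by (intro sets.Un)
    show "\<forall>\<^sub>F n in sequentially. {\<omega> \<in> space M. \<epsilon> \<le> \<bar>(tv_stat (Suc n) (X (Suc n) \<omega>) - g (qmle (Suc n) (X (Suc n) \<omega>))) - \<bar>std_score (X (Suc n) \<omega>)\<bar>\<bar>} \<subseteq> bad_event e n \<union> few_blocks e' n"
    proof (intro always_eventually allI subsetI, rule ccontr)
      fix n \<omega>
      assume big: "\<omega> \<in> {\<omega> \<in> space M. \<epsilon> \<le> \<bar>(tv_stat (Suc n) (X (Suc n) \<omega>) - g (qmle (Suc n) (X (Suc n) \<omega>))) - \<bar>std_score (X (Suc n) \<omega>)\<bar>\<bar>}"
        and no: "\<omega> \<notin> bad_event e n \<union> few_blocks e' n"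
      have \<omega>: "\<omega> \<in> space M" using big by simp
      define \<pi> where "\<pi> = X (Suc n) \<omega>"
      have part: "partition_on {1..Suc n} \<pi>" unfolding \<pi>_def by (rule X_partition) (use \<omega> in auto)
      define l where "l = \<bar>sqrt (real (card \<pi>)) * (qmle (Suc n) \<pi> - \<alpha>) - z_score \<pi> / fisher_info \<alpha>\<bar>"
      have l: "l < e" and q: "\<bar>qmle (Suc n) \<pi> - \<alpha>\<bar> < e" and k: "1 / real (card \<pi>) < e'"
        using no \<omega> by (auto simp: \<pi>_def l_def not_le)
      have A: "\<bar>tv_stat (Suc n) \<pi> - \<bar>std_score \<pi>\<bar>\<bar> \<le> sI * rate_const * sqrt (1 / real (card \<pi>)) + sI * l"
        using tv_stat_approx[OF part] by (simp add: sI_def l_def)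
      have B: "sI * l \<le> \<epsilon> / 3" using mult_left_mono[OF less_imp_le[OF l], of sI] sI e(3) by linarith
      have C: "sI * rate_const * sqrt (1 / real (card \<pi>)) < \<epsilon> / 3"
      proof -
        have "sqrt (1 / real (card \<pi>)) < \<epsilon> / (3 * (sI * rate_const))"
          using k \<epsilon> sI R by (intro real_less_lsqrt) (auto simp: e'_def)
        then have "sI * rate_const * sqrt (1 / real (card \<pi>)) < sI * rate_const * (\<epsilon> / (3 * (sI * rate_const)))"
          using sI R by (intro mult_strict_left_mono) auto
        then show ?thesis using sI R by simp
      qed
      have D: "\<bar>g (qmle (Suc n) \<pi>)\<bar> < \<epsilon> / 3" using d(2) q e(2) by simp
      have dist: "\<epsilon> \<le> \<bar>(tv_stat (Suc n) \<pi> - g (qmle (Suc n) \<pi>)) - \<bar>std_score \<pi>\<bar>\<bar>" using big by (simp add: \<pi>_def)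
      have tri: "\<bar>(u - v) - w\<bar> \<le> \<bar>u - w\<bar> + \<bar>v\<bar>" for u v w :: real by linarith
      have "\<epsilon> \<le> \<bar>tv_stat (Suc n) \<pi> - \<bar>std_score \<pi>\<bar>\<bar> + \<bar>g (qmle (Suc n) \<pi>)\<bar>"
        by (rule order_trans[OF dist tri])
      then show False using A B C D by linarith
    qed
  qed
qed

text \<open>Convergence conditionally on an event \<open>A\<close> of the history, by taking its indicator as the weight in
\<open>z_score_char_tendsto\<close>.\<close>

lemma std_score_weak_conv:
  assumes r: "1 \<le> r" and A: "A = {\<omega> \<in> space M. X r \<omega> \<in> S}" and pos: "0 < prob A"
  shows "weak_conv_m (\<lambda>n. distr (uniform_measure M A) borel (\<lambda>\<omega>. std_score (X (Suc n) \<omega>))) std_normal_distribution"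
proof (rule levy_continuity)
  have Aev: "A \<in> events" unfolding A by (rule X_event[OF r])
  interpret A: prob_space "uniform_measure M A"
    using pos by (intro prob_space_uniform_measure) (auto simp: emeasure_eq_measure)
  have meas [measurable]: "(\<lambda>\<omega>. std_score (X (Suc n) \<omega>)) \<in> borel_measurable M" for n
    by (rule borel_measurable_X) simp
  show "real_distribution (distr (uniform_measure M A) borel (\<lambda>\<omega>. std_score (X (Suc n) \<omega>)))" for n
    by (rule A.real_distribution_distr) simp
  show "real_distribution std_normal_distribution" by (rule real_dist_normal_dist)
  define I where "I = fisher_info \<alpha>"
  have I: "0 < I" using fisher_info_pos[OF \<alpha>] by (simp add: I_def)
  fix t :: real
  define t' where "t' = t / sqrt I"
  have ind: "indicator A \<omega> = (indicator S (X r \<omega>) :: real)" if "\<omega> \<in> space M" for \<omega>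
    using that by (simp add: A indicator_def)
  have EA: "(LINT \<omega>|M. indicator S (X r \<omega>)) = prob A"
  proof -
    have "(LINT \<omega>|M. indicator S (X r \<omega>)) = (LINT \<omega>|M. indicator A \<omega> :: real)"
      by (intro Bochner_Integration.integral_cong refl) (simp add: ind)
    then show ?thesis using Aev by (simp add: Int_absorb2 sets.sets_into_space)
  qed
  have char: "char (distr (uniform_measure M A) borel (\<lambda>\<omega>. std_score (X (Suc n) \<omega>))) t
      = (1 / prob A) *\<^sub>R (LINT \<omega>|M. indicator S (X r \<omega>) *\<^sub>R iexp (t' * z_score (X (Suc n) \<omega>)))" for n
  proof -
    have "char (distr (uniform_measure M A) borel (\<lambda>\<omega>. std_score (X (Suc n) \<omega>))) t
      = (LINT \<omega>|uniform_measure M A. iexp (t * std_score (X (Suc n) \<omega>)))"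
      unfolding char_def by (subst integral_distr) auto
    also have "\<dots> = (1 / prob A) *\<^sub>R (LINT \<omega>|M. indicator A \<omega> *\<^sub>R iexp (t * std_score (X (Suc n) \<omega>)))"
      by (rule integral_uniform_measure[OF prob_space_axioms Aev pos]) measurable
    also have "(LINT \<omega>|M. indicator A \<omega> *\<^sub>R iexp (t * std_score (X (Suc n) \<omega>)))
       = (LINT \<omega>|M. indicator S (X r \<omega>) *\<^sub>R iexp (t' * z_score (X (Suc n) \<omega>)))"
      by (intro Bochner_Integration.integral_cong refl) (simp add: ind std_score_def t'_def I_def)
    finally show ?thesis .
  qed
  have "(\<lambda>n. (1 / prob A) *\<^sub>R (LINT \<omega>|M. indicator S (X r \<omega>) *\<^sub>R iexp (t' * z_score (X (Suc n) \<omega>))))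
      \<longlonglongrightarrow> (1 / prob A) *\<^sub>R of_real ((LINT \<omega>|M. indicator S (X r \<omega>)) * exp (- (fisher_info \<alpha> * t'\<^sup>2 / 2)))"
    by (intro tendsto_scaleR tendsto_const LIMSEQ_Suc[OF z_score_char_tendsto[OF r, of "indicator S"]]) auto
  moreover have "(1 / prob A) *\<^sub>R complex_of_real ((LINT \<omega>|M. indicator S (X r \<omega>)) * exp (- (fisher_info \<alpha> * t'\<^sup>2 / 2)))
      = char std_normal_distribution t"
  proof -
    have "fisher_info \<alpha> * t'\<^sup>2 = t\<^sup>2" using I by (simp add: t'_def I_def power_divide)
    then show ?thesis using pos by (simp add: EA char_std_normal_distribution scaleR_conv_of_real)
  qed
  ultimately show "(\<lambda>n. char (distr (uniform_measure M A) borel (\<lambda>\<omega>. std_score (X (Suc n) \<omega>))) t) \<longlonglongrightarrow> char std_normal_distribution t"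
    unfolding char by simp
qed

lemma corrected_tv_stat_weak_conv:
  assumes r: "1 \<le> r" and A: "A = {\<omega> \<in> space M. X r \<omega> \<in> S}" and pos: "0 < prob A"
    and g: "isCont g \<alpha>" "g \<alpha> = 0"
  shows "weak_conv_m (\<lambda>n. distr (uniform_measure M A) borel (\<lambda>\<omega>. tv_stat (Suc n) (X (Suc n) \<omega>) - g (qmle (Suc n) (X (Suc n) \<omega>))))
    (distr std_normal_distribution borel abs)"
proof -
  have Aev: "A \<in> events" unfolding A by (rule X_event[OF r])
  interpret A: prob_space "uniform_measure M A"
    using pos by (intro prob_space_uniform_measure) (auto simp: emeasure_eq_measure)
  interpret N: real_distribution std_normal_distribution by (rule real_dist_normal_dist)
  have m1 [measurable]: "(\<lambda>\<omega>. std_score (X (Suc n) \<omega>)) \<in> borel_measurable M" for n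
    by (rule borel_measurable_X) simp
  have m2 [measurable]: "(\<lambda>\<omega>. tv_stat (Suc n) (X (Suc n) \<omega>) - g (qmle (Suc n) (X (Suc n) \<omega>))) \<in> borel_measurable M" for n
    by (rule borel_measurable_X) simp
  have d: "real_distribution (distr (uniform_measure M A) borel (\<lambda>\<omega>. std_score (X (Suc n) \<omega>)))" for n
    by (rule A.real_distribution_distr) simp
  have "distr (distr (uniform_measure M A) borel (\<lambda>\<omega>. std_score (X (Suc n) \<omega>))) borel abs
     = distr (uniform_measure M A) borel (\<lambda>\<omega>. \<bar>std_score (X (Suc n) \<omega>)\<bar>)" for n
    by (subst distr_distr) (auto simp: comp_def)
  then have w: "weak_conv_m (\<lambda>n. distr (uniform_measure M A) borel (\<lambda>\<omega>. \<bar>std_score (X (Suc n) \<omega>)\<bar>)) (distr std_normal_distribution borel abs)"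
    using weak_conv_abs[OF d real_dist_normal_dist std_score_weak_conv[OF r A pos]] by simp
  show ?thesis
  proof (rule A.weak_conv_of_prob_diff[OF _ _ _ _ w])
    show "real_distribution (distr std_normal_distribution borel abs)" by (rule N.real_distribution_distr) simp
    fix \<epsilon> :: real assume \<epsilon>: "0 < \<epsilon>"
    let ?B = "\<lambda>n. {\<omega> \<in> space M. \<epsilon> \<le> \<bar>(tv_stat (Suc n) (X (Suc n) \<omega>) - g (qmle (Suc n) (X (Suc n) \<omega>))) - \<bar>std_score (X (Suc n) \<omega>)\<bar>\<bar>}"
    have ev: "?B n \<in> events" for n by (rule X_event) simp
    have "(\<lambda>n. prob (?B n) / prob A) \<longlonglongrightarrow> 0 / prob A"
      using pos by (intro tendsto_divide tendsto_const corrected_tv_stat_close \<epsilon> g) auto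
    then have lim: "(\<lambda>n. prob (?B n) / prob A) \<longlonglongrightarrow> 0" by simp
    have "measure (uniform_measure M A) (?B n) \<le> prob (?B n) / prob A" for n
    proof -
      have "measure (uniform_measure M A) (?B n) = prob (A \<inter> ?B n) / prob A"
        using Aev ev pos by (intro measure_uniform_measure) (auto simp: emeasure_eq_measure)
      also have "\<dots> \<le> prob (?B n) / prob A"
        using ev pos by (intro divide_right_mono finite_measure_mono) auto
      finally show ?thesis .
    qed
    then have "(\<lambda>n. measure (uniform_measure M A) (?B n)) \<longlonglongrightarrow> 0"
      by (intro tendsto_sandwich[OF _ _ tendsto_const lim]) auto
    then show "(\<lambda>n. measure (uniform_measure M A) {\<omega> \<in> space (uniform_measure M A). \<epsilon> \<le>
        \<bar>(tv_stat (Suc n) (X (Suc n) \<omega>) - g (qmle (Suc n) (X (Suc n) \<omega>))) - \<bar>std_score (X (Suc n) \<omega>)\<bar>\<bar>}) \<longlonglongrightarrow> 0"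
      by simp
  qed simp_all
qed

text \<open>A generator of the limit \<open>\<sigma>\<close>-algebra. It is stable under intersection because two partitions of the
chain are both functions of the later one.\<close>

definition history_events :: "'w set set" where
  "history_events = {A. \<exists>r\<ge>1. \<exists>S. A = {\<omega> \<in> space M. X r \<omega> \<in> S}}"

lemma partition_sigma_sets: "1 \<le> n \<Longrightarrow> sets (partition_sigma M X n) = {{\<omega> \<in> space M. X n \<omega> \<in> S} | S. True}"
proof -
  assume n: "1 \<le> n"
  let ?P = "{\<pi>. partition_on {1..n} \<pi>}"
  have "sets (partition_sigma M X n) = {X n -` A \<inter> space M | A. A \<in> sets (count_space ?P)}"
    unfolding partition_sigma_def by (rule sets_vimage_algebra2) (use X_partition[OF n] in auto)
  also have "\<dots> = {{\<omega> \<in> space M. X n \<omega> \<in> S} | S. True}"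
  proof (intro set_eqI iffI)
    fix A assume "A \<in> {X n -` A \<inter> space M | A. A \<in> sets (count_space ?P)}"
    then obtain B where "A = X n -` B \<inter> space M" by blast
    then have "A = {\<omega> \<in> space M. X n \<omega> \<in> B}" by auto
    then show "A \<in> {{\<omega> \<in> space M. X n \<omega> \<in> S} | S. True}" by blast
  next
    fix A assume "A \<in> {{\<omega> \<in> space M. X n \<omega> \<in> S} | S. True}"
    then obtain S where "A = {\<omega> \<in> space M. X n \<omega> \<in> S}" by blast
    then have "A = X n -` (S \<inter> ?P) \<inter> space M" using X_partition[OF n] by auto
    moreover have "S \<inter> ?P \<in> sets (count_space ?P)" by simp
    ultimately show "A \<in> {X n -` A \<inter> space M | A. A \<in> sets (count_space ?P)}" by blast
  qed
  finally show ?thesis .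
qed

lemma history_events_eq: "history_events = (\<Union>n\<in>{1..}. sets (partition_sigma M X n))"
  using partition_sigma_sets by (auto simp: history_events_def)

lemma history_events_closed:
  shows "Int_stable history_events" "history_events \<subseteq> Pow (space M)" "space M \<in> history_events" "history_events \<subseteq> events"
proof -
  show "Int_stable history_events"
  proof (rule Int_stableI)
    fix A B assume "A \<in> history_events" "B \<in> history_events"
    then obtain r S r' S' where AB: "1 \<le> r" "A = {\<omega> \<in> space M. X r \<omega> \<in> S}" "1 \<le> r'" "B = {\<omega> \<in> space M. X r' \<omega> \<in> S'}"
      unfolding history_events_def by blast
    define m where "m = max r r'"
    obtain g where g: "\<And>\<omega>. \<omega> \<in> space M \<Longrightarrow> X r \<omega> = g (X m \<omega>)" using X_history[OF AB(1), of m] by (auto simp: m_def)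
    obtain g' where g': "\<And>\<omega>. \<omega> \<in> space M \<Longrightarrow> X r' \<omega> = g' (X m \<omega>)" using X_history[OF AB(3), of m] by (auto simp: m_def)
    have "A \<inter> B = {\<omega> \<in> space M. X m \<omega> \<in> {\<pi>. g \<pi> \<in> S \<and> g' \<pi> \<in> S'}}" unfolding AB using g g' by auto
    moreover have "1 \<le> m" using AB by (simp add: m_def)
    ultimately show "A \<inter> B \<in> history_events" unfolding history_events_def by blast
  qed
  show "history_events \<subseteq> Pow (space M)" by (auto simp: history_events_def)
  have "space M = {\<omega> \<in> space M. X 1 \<omega> \<in> UNIV}" by simp
  then show "space M \<in> history_events" unfolding history_events_def by blast
  show "history_events \<subseteq> events" unfolding history_events_def using X_event by auto
qed

lemma sets_limit_sigma: "sets (limit_sigma M X) = sigma_sets (space M) history_events"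
  unfolding limit_sigma_def history_events_eq[symmetric] using history_events_closed(2) by (rule sets_measure_of)

lemma space_limit_sigma: "space (limit_sigma M X) = space M"
  unfolding limit_sigma_def by (simp add: space_measure_of_conv)

lemma subalgebra_limit_sigma: "subalgebra M (limit_sigma M X)"
  unfolding subalgebra_def space_limit_sigma sets_limit_sigma
  using sets.sigma_sets_subset[OF history_events_closed(4)] by simp

lemma measurable_limit_sigma:
  fixes F :: "nat set set \<Rightarrow> real"
  assumes "1 \<le> n"
  shows "(\<lambda>\<omega>. F (X n \<omega>)) \<in> borel_measurable (limit_sigma M X)"
proof (rule measurableI)
  fix B :: "real set"
  have "(\<lambda>\<omega>. F (X n \<omega>)) -` B \<inter> space (limit_sigma M X) = {\<omega> \<in> space M. X n \<omega> \<in> {\<pi>. F \<pi> \<in> B}}"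
    by (auto simp: space_limit_sigma)
  also have "\<dots> \<in> history_events" unfolding history_events_def using assms by blast
  finally show "(\<lambda>\<omega>. F (X n \<omega>)) -` B \<inter> space (limit_sigma M X) \<in> sets (limit_sigma M X)"
    unfolding sets_limit_sigma by (rule sigma_sets.Basic)
qed simp

text \<open>On an event of the history with positive probability this is convergence in distribution under the
conditional law; \<open>mixes_generated\<close> does the rest.\<close>

lemma tv_stat_mixes:
  assumes h: "continuous_on UNIV h" "\<And>x. \<bar>h x\<bar> \<le> K"
    and f: "integrable M f" "f \<in> borel_measurable (limit_sigma M X)"
  shows "mixes (\<lambda>n \<omega>. h (tv_stat (Suc n) (X (Suc n) \<omega>))) (LINT x|std_normal_distribution. h \<bar>x\<bar>) f"
proof (rule mixes_generated[OF subalgebra_limit_sigma sets_limit_sigma history_events_closed(1-3) _ _ _ _ f])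
  interpret N: real_distribution std_normal_distribution by (rule real_dist_normal_dist)
  have hb [measurable]: "h \<in> borel_measurable borel" using h(1) by (rule borel_measurable_continuous_onI)
  show "(\<lambda>\<omega>. h (tv_stat (Suc n) (X (Suc n) \<omega>))) \<in> borel_measurable M" for n by (rule borel_measurable_X) simp
  show "\<bar>h (tv_stat (Suc n) (X (Suc n) \<omega>))\<bar> \<le> K" for n \<omega> by (rule h)
  have ih: "integrable std_normal_distribution (\<lambda>x. h \<bar>x\<bar>)"
    by (rule N.integrable_const_bound[where B = K]) (use h in auto)
  show "\<bar>LINT x|std_normal_distribution. h \<bar>x\<bar>\<bar> \<le> K"
  proof -
    have "\<bar>LINT x|std_normal_distribution. h \<bar>x\<bar>\<bar> \<le> (LINT x|std_normal_distribution. \<bar>h \<bar>x\<bar>\<bar>)" by (rule integral_abs_bound)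
    also have "\<dots> \<le> K" using ih h by (intro N.integral_le_const integrable_abs) auto
    finally show ?thesis .
  qed
  fix A assume A0: "A \<in> history_events"
  then have Aev: "A \<in> events" using history_events_closed(4) by blast
  obtain r S where rS: "1 \<le> r" "A = {\<omega> \<in> space M. X r \<omega> \<in> S}" using A0 unfolding history_events_def by blast
  have meas [measurable]: "(\<lambda>\<omega>. tv_stat (Suc n) (X (Suc n) \<omega>)) \<in> borel_measurable M" for n by (rule borel_measurable_X) simp
  have EA: "(LINT \<omega>|M. indicator A \<omega>) = prob A" using Aev by (simp add: Int_absorb2 sets.sets_into_space)
  show "mixes (\<lambda>n \<omega>. h (tv_stat (Suc n) (X (Suc n) \<omega>))) (LINT x|std_normal_distribution. h \<bar>x\<bar>) (indicator A)"
  proof (cases "prob A = 0")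
    case True
    have "A \<in> null_sets M" using Aev True by (simp add: null_sets_def emeasure_eq_measure)
    then have "AE \<omega> in M. \<omega> \<notin> A" by (rule AE_not_in)
    then have "AE \<omega> in M. indicator A \<omega> * Y \<omega> = (0::real)" for Y by eventually_elim simp
    then have zero: "(LINT \<omega>|M. indicator A \<omega> * Y \<omega>) = (0::real)" for Y by (rule integral_eq_zero_AE)
    show ?thesis unfolding mixes_def EA True zero by simp
  next
    case False
    then have pos: "0 < prob A" by (simp add: zero_less_measure_iff)
    interpret A: prob_space "uniform_measure M A"
      using pos by (intro prob_space_uniform_measure) (auto simp: emeasure_eq_measure)
    have w: "weak_conv_m (\<lambda>n. distr (uniform_measure M A) borel (\<lambda>\<omega>. tv_stat (Suc n) (X (Suc n) \<omega>))) (distr std_normal_distribution borel abs)"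
      using corrected_tv_stat_weak_conv[OF rS pos, of "\<lambda>_. 0"] by simp
    have d: "real_distribution (distr (uniform_measure M A) borel (\<lambda>\<omega>. tv_stat (Suc n) (X (Suc n) \<omega>)))" for n
      by (rule A.real_distribution_distr) simp
    have d': "real_distribution (distr std_normal_distribution borel abs)" by (rule N.real_distribution_distr) simp
    have "(\<lambda>n. LINT x|distr (uniform_measure M A) borel (\<lambda>\<omega>. tv_stat (Suc n) (X (Suc n) \<omega>)). h x) \<longlonglongrightarrow> (LINT x|distr std_normal_distribution borel abs. h x)"
      by (rule weak_conv_imp_integral_bdd_continuous_conv[OF d d' w, where B = K])
         (use h in \<open>auto simp: continuous_on_eq_continuous_at\<close>)
    then have "(\<lambda>n. LINT \<omega>|uniform_measure M A. h (tv_stat (Suc n) (X (Suc n) \<omega>))) \<longlonglongrightarrow> (LINT x|std_normal_distribution. h \<bar>x\<bar>)"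
      by (simp add: integral_distr)
    moreover have "(LINT \<omega>|uniform_measure M A. h (tv_stat (Suc n) (X (Suc n) \<omega>))) = (1 / prob A) *\<^sub>R (LINT \<omega>|M. indicator A \<omega> *\<^sub>R h (tv_stat (Suc n) (X (Suc n) \<omega>)))" for n
      by (rule integral_uniform_measure[OF prob_space_axioms Aev pos]) measurable
    ultimately have "(\<lambda>n. prob A * ((1 / prob A) * (LINT \<omega>|M. indicator A \<omega> * h (tv_stat (Suc n) (X (Suc n) \<omega>))))) \<longlonglongrightarrow> prob A * (LINT x|std_normal_distribution. h \<bar>x\<bar>)"
      by (intro tendsto_mult tendsto_const) simp
    then show ?thesis unfolding mixes_def EA using pos by simp
  qed
qed

end

lemma isCont_inv_sqrt_fisher:
  assumes "0 < x" "x < 1"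
  shows "isCont inv_sqrt_fisher x"
proof -
  have "isCont (\<lambda>x. 1 / sqrt (fisher_info x)) x"
    using fisher_info_pos[OF assms] by (intro continuous_intros isCont_fisher_info assms) auto
  moreover have "\<forall>\<^sub>F y in nhds x. inv_sqrt_fisher y = 1 / sqrt (fisher_info y)"
    using assms by (intro eventually_nhds_in_open[THEN eventually_mono, of "{0<..<1}"])
      (auto simp: inv_sqrt_fisher_def)
  ultimately show ?thesis by (subst isCont_cong)
qed

context gibbs_chain
begin

text \<open>The statistic is measurable for the limit \<open>\<sigma>\<close>-algebra \<open>G\<close>, so the weight \<open>f\<close> may be replaced by its
conditional expectation given \<open>G\<close>; on the side of the limit, conditioning \<open>h \<bar>N\<bar>\<close> on \<open>G\<close> gives a
constant by independence.\<close>

lemma tv_stat_stable_convergence: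
  assumes N: "distributed M lborel N std_normal_density"
    and ind: "indep_set {N -` A \<inter> space M | A. A \<in> sets borel} (sets (limit_sigma M X))"
  shows "stable_convergence M (limit_sigma M X) (\<lambda>n \<omega>. tv_stat n (X n \<omega>)) (\<lambda>\<omega>. \<bar>N \<omega>\<bar>)"
  unfolding stable_convergence_def
proof (intro conjI allI impI)
  let ?G = "limit_sigma M X"
  show sub: "subalgebra M ?G" by (rule subalgebra_limit_sigma)
  show "(\<lambda>\<omega>. tv_stat n (X n \<omega>)) \<in> borel_measurable M" for n
  proof (cases "n = 0")
    case True
    then show ?thesis by (simp add: tv_stat_def)
  next
    case False
    then show ?thesis by (intro borel_measurable_X) simp
  qed
  have Nm [measurable]: "N \<in> borel_measurable M" using distributed_measurable[OF N] by simp
  show "(\<lambda>\<omega>. \<bar>N \<omega>\<bar>) \<in> borel_measurable M" by measurable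
  fix f :: "'w \<Rightarrow> real" and h :: "real \<Rightarrow> real"
  assume f: "integrable M f" and h: "continuous_on UNIV h" "bounded (range h)"
  interpret G: finite_measure_subalgebra M ?G using sub by unfold_locales
  obtain K where K: "\<And>x. \<bar>h x\<bar> \<le> K" using h(2) by (auto simp: bounded_iff)
  have hb [measurable]: "h \<in> borel_measurable borel" using h(1) by (rule borel_measurable_continuous_onI)
  define c where "c = (LINT x|std_normal_distribution. h \<bar>x\<bar>)"
  define \<phi> where "\<phi> = real_cond_exp M ?G f"
  have \<phi>: "integrable M \<phi>" "\<phi> \<in> borel_measurable ?G" "(LINT \<omega>|M. \<phi> \<omega>) = (LINT \<omega>|M. f \<omega>)"
    unfolding \<phi>_def using G.real_cond_exp_int[OF f] by simp_all
  have lhs: "(LINT \<omega>|M. f \<omega> * real_cond_exp M ?G (\<lambda>\<omega>. h (tv_stat n (X n \<omega>))) \<omega>) = (LINT \<omega>|M. \<phi> \<omega> * h (tv_stat n (X n \<omega>)))"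
    if n: "1 \<le> n" for n
  proof -
    let ?H = "\<lambda>\<omega>. h (tv_stat n (X n \<omega>))"
    have H: "?H \<in> borel_measurable ?G" "integrable M ?H"
      by (rule measurable_limit_sigma[OF n], rule integrable_X[OF n])
    have HM: "?H \<in> borel_measurable M" using H(2) by (rule borel_measurable_integrable)
    have fM: "f \<in> borel_measurable M" using f by (rule borel_measurable_integrable)
    have "AE \<omega> in M. real_cond_exp M ?G ?H \<omega> = ?H \<omega>" by (rule G.real_cond_exp_F_meas[OF H(2,1)])
    then have "(LINT \<omega>|M. f \<omega> * real_cond_exp M ?G ?H \<omega>) = (LINT \<omega>|M. ?H \<omega> * f \<omega>)"
      using fM HM by (intro integral_cong_AE) (auto simp: mult.commute)
    also have "\<dots> = (LINT \<omega>|M. ?H \<omega> * \<phi> \<omega>)"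
      unfolding \<phi>_def
    proof (rule G.real_cond_exp_intg(2)[symmetric, OF _ H(1) fM])
      show "integrable M (\<lambda>\<omega>. ?H \<omega> * f \<omega>)"
        using integrable_mult_bounded[OF f HM K] by (simp add: mult.commute)
    qed
    finally show ?thesis by (simp add: mult.commute)
  qed
  have rhs: "(LINT \<omega>|M. f \<omega> * real_cond_exp M ?G (\<lambda>\<omega>. h \<bar>N \<omega>\<bar>) \<omega>) = (LINT \<omega>|M. \<phi> \<omega>) * c"
  proof -
    have hN: "(\<lambda>x. h \<bar>x\<bar>) \<in> borel_measurable borel" by measurable
    have int: "integrable M (\<lambda>\<omega>. h \<bar>N \<omega>\<bar>)" by (rule integrable_const_bound[where B = K]) (use K in auto)
    have "(LINT \<omega>|M. h \<bar>N \<omega>\<bar>) = (LINT x|distr M lborel N. h \<bar>x\<bar>)"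
      by (rule integral_distr[symmetric]) (use distributed_measurable[OF N] in auto)
    also have "distr M lborel N = std_normal_distribution" by (rule distributed_distr_eq_density[OF N])
    finally have EN: "(LINT \<omega>|M. h \<bar>N \<omega>\<bar>) = c" by (simp add: c_def)
    have "AE \<omega> in M. real_cond_exp M ?G (\<lambda>\<omega>. h \<bar>N \<omega>\<bar>) \<omega> = c"
      using real_cond_exp_indep[OF sub Nm hN int ind] EN by simp
    then have "(LINT \<omega>|M. f \<omega> * real_cond_exp M ?G (\<lambda>\<omega>. h \<bar>N \<omega>\<bar>) \<omega>) = (LINT \<omega>|M. f \<omega> * c)"
      using borel_measurable_integrable[OF f] by (intro integral_cong_AE) auto
    then show ?thesis using \<phi>(3) by simp
  qed
  have "(\<lambda>n. LINT \<omega>|M. \<phi> \<omega> * h (tv_stat (Suc n) (X (Suc n) \<omega>))) \<longlonglongrightarrow> (LINT \<omega>|M. \<phi> \<omega>) * c"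
    using tv_stat_mixes[OF h(1) K \<phi>(1,2)] by (simp add: mixes_def c_def)
  then have "(\<lambda>n. LINT \<omega>|M. f \<omega> * real_cond_exp M ?G (\<lambda>\<omega>. h (tv_stat (Suc n) (X (Suc n) \<omega>))) \<omega>) \<longlonglongrightarrow> (LINT \<omega>|M. \<phi> \<omega>) * c"
    using lhs by simp
  then show "(\<lambda>n. LINT \<omega>|M. f \<omega> * real_cond_exp M ?G (\<lambda>\<omega>. h (tv_stat n (X n \<omega>))) \<omega>)
      \<longlonglongrightarrow> (LINT \<omega>|M. f \<omega> * real_cond_exp M ?G (\<lambda>\<omega>. h \<bar>N \<omega>\<bar>) \<omega>)"
    unfolding rhs by (rule LIMSEQ_imp_Suc)
qed

text \<open>By \<open>forall_subset_le_iff_tv_dist_le\<close> the event says that the corrected statistic is at most \<open>\<tau>\<close>. Its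
limit law has no atom at \<open>\<tau>\<close>, so the probability converges.\<close>

lemma confidence_band_coverage:
  assumes \<epsilon>: "0 < \<epsilon>" "\<epsilon> < 1"
  defines "\<tau> \<equiv> quantile std_normal_distribution (1 - \<epsilon> / 2)"
  shows "(\<lambda>n. \<P>(\<omega> in M. \<forall>I. I \<subseteq> {0..card (X n \<omega>)} \<longrightarrow>
      \<bar>(\<Sum>i\<in>I. predictive \<alpha> \<mu> n (X n \<omega>) i) - (\<Sum>i\<in>I. predictive_est n (X n \<omega>) i)\<bar>
        \<le> sqrt (real (card (X n \<omega>))) / real n * (\<tau> * inv_sqrt_fisher (qmle n (X n \<omega>))))) \<longlonglongrightarrow> 1 - \<epsilon>"
    (is "(\<lambda>n. prob (?ev n)) \<longlonglongrightarrow> _")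
proof -
  interpret N: real_distribution std_normal_distribution by (rule real_dist_normal_dist)
  define sI where "sI = sqrt (fisher_info \<alpha>)"
  have sI: "0 < sI" using fisher_info_pos[OF \<alpha>] by (simp add: sI_def)
  \<comment> \<open>Multiplied by \<open>n * sI / sqrt k\<close>, the bound in the event becomes \<open>\<tau> * sI * inv_sqrt_fisher qmle\<close>, which
    is \<open>\<tau> + g qmle\<close>.\<close>
  define g where "g x = \<tau> * (sI * inv_sqrt_fisher x - 1)" for x
  have g: "isCont g \<alpha>" "g \<alpha> = 0"
  proof -
    show "isCont g \<alpha>" unfolding g_def by (intro continuous_intros isCont_inv_sqrt_fisher \<alpha>)
    show "g \<alpha> = 0" using sI \<alpha> by (simp add: g_def inv_sqrt_fisher_def sI_def[symmetric])
  qed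
  define V where "V n \<omega> = tv_stat (Suc n) (X (Suc n) \<omega>) - g (qmle (Suc n) (X (Suc n) \<omega>))" for n \<omega>
  have Vm [measurable]: "V n \<in> borel_measurable M" for n unfolding V_def by (rule borel_measurable_X) simp
  have event: "?ev (Suc n) = {\<omega> \<in> space M. V n \<omega> \<le> \<tau>}" for n
  proof (intro Collect_cong conj_cong refl)
    fix \<omega> assume \<omega>: "\<omega> \<in> space M"
    define \<pi> m where "\<pi> = X (Suc n) \<omega>" and "m = Suc n"
    define q where "q = inv_sqrt_fisher (qmle m \<pi>)"
    have m: "1 \<le> m" "0 < real m" by (simp_all add: m_def)
    have part: "partition_on {1..m} \<pi>" unfolding \<pi>_def m_def by (rule X_partition[OF _ \<omega>]) simp
    define sk tv where "sk = sqrt (real (card \<pi>))" and "tv = tv_dist (card \<pi>) (predictive_est m \<pi>) (predictive \<alpha> \<mu> m \<pi>)"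
    have sk: "0 < sk" using partition_card_pos[OF part m(1)] by (simp add: sk_def)
    have a: "0 < real m * (sI / sk)" using m sI sk by simp
    have ts: "tv_stat m \<pi> = real m * (sI / sk) * tv"
      by (simp add: tv_stat_def sI_def sk_def tv_def real_sqrt_divide)
    have "(\<forall>I. I \<subseteq> {0..card \<pi>} \<longrightarrow> \<bar>(\<Sum>i\<in>I. predictive \<alpha> \<mu> m \<pi> i) - (\<Sum>i\<in>I. predictive_est m \<pi> i)\<bar> \<le> sk / real m * (\<tau> * q))
       \<longleftrightarrow> tv \<le> sk / real m * (\<tau> * q)"
      unfolding tv_def by (rule forall_subset_le_iff_tv_dist_le) (simp only: sum_predictive_eq[OF part m(1)])
    also have "\<dots> \<longleftrightarrow> real m * (sI / sk) * tv \<le> real m * (sI / sk) * (sk / real m * (\<tau> * q))"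
      using a by (rule mult_le_cancel_left_pos[symmetric])
    also have "real m * (sI / sk) * (sk / real m * (\<tau> * q)) = sI * (\<tau> * q)" using m sk by simp
    also have "real m * (sI / sk) * tv \<le> sI * (\<tau> * q) \<longleftrightarrow> tv_stat m \<pi> - g (qmle m \<pi>) \<le> \<tau>"
      unfolding ts g_def q_def[symmetric] by (auto simp: algebra_simps)
    finally show "(\<forall>I. I \<subseteq> {0..card (X (Suc n) \<omega>)} \<longrightarrow>
      \<bar>(\<Sum>i\<in>I. predictive \<alpha> \<mu> (Suc n) (X (Suc n) \<omega>) i) - (\<Sum>i\<in>I. predictive_est (Suc n) (X (Suc n) \<omega>) i)\<bar>
        \<le> sqrt (real (card (X (Suc n) \<omega>))) / real (Suc n) * (\<tau> * inv_sqrt_fisher (qmle (Suc n) (X (Suc n) \<omega>)))) \<longleftrightarrow> V n \<omega> \<le> \<tau>"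
      by (simp only: \<pi>_def m_def sk_def q_def V_def)
  qed
  have w: "weak_conv_m (\<lambda>n. distr (uniform_measure M (space M)) borel (V n)) (distr std_normal_distribution borel abs)"
    unfolding V_def by (rule corrected_tv_stat_weak_conv[where r = 1 and S = UNIV, OF _ _ _ g]) (auto simp: prob_space)
  have "measure (distr std_normal_distribution borel abs) {\<tau>} = 0"
  proof -
    have "measure (distr std_normal_distribution borel abs) {\<tau>} = measure std_normal_distribution {x. \<bar>x\<bar> = \<tau>}"
      by (subst measure_distr) (auto intro!: arg_cong[where f = "measure std_normal_distribution"])
    also have "\<dots> \<le> measure std_normal_distribution ({\<tau>} \<union> {- \<tau>})"
      by (rule N.finite_measure_mono) auto
    also have "\<dots> \<le> measure std_normal_distribution {\<tau>} + measure std_normal_distribution {- \<tau>}"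
      by (rule measure_Un_le) auto
    finally show ?thesis by (simp add: std_normal_singleton measure_le_0_iff)
  qed
  moreover have "real_distribution (distr std_normal_distribution borel abs)" by (rule N.real_distribution_distr) simp
  ultimately have "isCont (cdf (distr std_normal_distribution borel abs)) \<tau>"
    using finite_borel_measure.isCont_cdf real_distribution.finite_borel_measure_M by blast
  with w have lim: "(\<lambda>n. cdf (distr (uniform_measure M (space M)) borel (V n)) \<tau>) \<longlonglongrightarrow> cdf (distr std_normal_distribution borel abs) \<tau>"
    by (simp add: weak_conv_m_def weak_conv_def)
  have "cdf (distr std_normal_distribution borel abs) \<tau> = measure std_normal_distribution {x. \<bar>x\<bar> \<le> \<tau>}"
    unfolding cdf_def by (subst measure_distr) (auto intro!: arg_cong[where f = "measure std_normal_distribution"])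
  also have "\<dots> = 1 - \<epsilon>" unfolding \<tau>_def by (rule abs_std_normal_quantile[OF \<epsilon>])
  finally have right: "cdf (distr std_normal_distribution borel abs) \<tau> = 1 - \<epsilon>" .
  have "cdf (distr (uniform_measure M (space M)) borel (V n)) \<tau> = prob (?ev (Suc n))" for n
  proof -
    have "cdf (distr (uniform_measure M (space M)) borel (V n)) \<tau> = measure (uniform_measure M (space M)) (V n -` {..\<tau>} \<inter> space M)"
      unfolding cdf_def by (subst measure_distr) auto
    also have "\<dots> = prob (space M \<inter> (V n -` {..\<tau>} \<inter> space M)) / prob (space M)"
      by (intro measure_uniform_measure) (auto simp: emeasure_space_1)
    also have "space M \<inter> (V n -` {..\<tau>} \<inter> space M) = {\<omega> \<in> space M. V n \<omega> \<le> \<tau>}" by auto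
    finally show ?thesis unfolding event by (simp add: prob_space)
  qed
  with lim right have "(\<lambda>n. prob (?ev (Suc n))) \<longlonglongrightarrow> 1 - \<epsilon>" by simp
  then show ?thesis by (rule LIMSEQ_imp_Suc)
qed

end

theorem corollary4p4:
  fixes M :: "'w measure" and \<mu> :: "real measure" and \<alpha> \<theta>lo \<theta>hi :: real
    and X :: "nat \<Rightarrow> 'w \<Rightarrow> nat set set"
  assumes "prob_space M"
    and "0 < \<alpha>" and "\<alpha> < 1"
    and "real_distribution \<mu>"
    and "measure_support \<mu> \<subseteq> {\<theta>lo..\<theta>hi}"
    and "- \<alpha> < \<theta>lo" and "\<theta>lo \<le> 0" and "0 \<le> \<theta>hi"
    and "gibbs_partition M \<alpha> \<mu> X"
  shows "(\<forall>N. distributed M lborel N std_normal_density \<longrightarrow>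
            prob_space.indep_set M {N -` A \<inter> space M | A. A \<in> sets borel}
              (sets (limit_sigma M X)) \<longrightarrow>
            stable_convergence M (limit_sigma M X)
              (\<lambda>n \<omega>. real n * sqrt (fisher_info \<alpha> / real (card (X n \<omega>)))
                       * tv_dist (card (X n \<omega>)) (predictive_est n (X n \<omega>))
                           (predictive \<alpha> \<mu> n (X n \<omega>)))
              (\<lambda>\<omega>. \<bar>N \<omega>\<bar>)) \<and>
         (\<forall>\<epsilon>. 0 < \<epsilon> \<and> \<epsilon> < 1 \<longrightarrow>
            (\<lambda>n. \<P>(\<omega> in M. \<forall>I. I \<subseteq> {0..card (X n \<omega>)} \<longrightarrow>
                    \<bar>(\<Sum>i\<in>I. predictive \<alpha> \<mu> n (X n \<omega>) i) - (\<Sum>i\<in>I. predictive_est n (X n \<omega>) i)\<bar>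
                      \<le> sqrt (real (card (X n \<omega>))) / real n
                          * (quantile std_normal_distribution (1 - \<epsilon> / 2)
                              * inv_sqrt_fisher (qmle n (X n \<omega>)))))
              \<longlonglongrightarrow> 1 - \<epsilon>)"
proof -
  interpret gibbs_chain M \<mu> \<alpha> \<theta>lo \<theta>hi X
    by (intro gibbs_chain.intro gibbs_mixture.intro gibbs_chain_axioms.intro gibbs_mixture_axioms.intro assms)
  show ?thesis
    using tv_stat_stable_convergence[unfolded tv_stat_def] confidence_band_coverage by blast
qed

end
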